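(* Let $\Phi(z)=\sum_{n\ge0}z^{2^n}$. Then, modulo $16$, $$\sum_{n\ge0}s_{n+1}(SL_2(\mathbb Z))\,z^n=\sum_{i=0}^{5}a_i(z)\,\Phi^i(z),$$ where \begin{align*} a_0(z)={}&8z^{74}+8z^{71}+8z^{68}+8z^{67}+8z^{62}+8z^{61}+8z^{57}+8z^{56}+8z^{54}+8z^{50}+8z^{48}+8z^{47}\\ &+8z^{45}+8z^{44}+8z^{43}+8z^{42}+8z^{41}+8z^{40}+8z^{38}+8z^{35}+8z^{31}+8z^{26}+8z^{24}+8z^{21}\\ &+12z^{20}+12z^{17}+8z^{16}+8z^{15}+4z^{14}+4z^{12}+12z^9+14z^8+8z^7+12z^6+16z^5\\ &+12z^4+12z^3+8z^2+8+\tfrac{10}{z}+\tfrac{12}{z^2}+\tfrac{3}{z^3}+\tfrac{14}{z^4}+\tfrac{9}{z^5}+\tfrac{4}{z^6}+\tfrac{12}{z^7}+\tfrac{4}{z^8}+\tfrac{3}{z^9}+\tfrac{6}{z^{10}},\\ a_1(z)={}&8z^{73}+8z^{72}+8z^{71}+8z^{69}+8z^{68}+8z^{67}+8z^{66}+8z^{64}+8z^{63}+8z^{62}+8z^{61}\\ &+8z^{60}+8z^{59}+8z^{55}+8z^{54}+8z^{49}+8z^{47}+8z^{41}+8z^{38}+8z^{36}+8z^{35}+8z^{32}+8z^{30}\\ &+8z^{29}+8z^{28}+8z^{27}+8z^{24}+8z^{23}+8z^{21}+8z^{17}+8z^{14}+8z^{13}+8z^{12}+8z^9+8z^8\\ &+8z^7+8z^5+12z^4+8z^3+4+\tfrac{16}{z}+\tfrac{6}{z^2}+\tfrac{12}{z^3}+\tfrac{8}{z^4}+\tfrac{6}{z^5}+\tfrac{4}{z^7}+\tfrac{4}{z^9}+\tfrac{8}{z^{10}}+\tfrac{14}{z^{11}},\\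 a_2(z)={}&8z^{72}+8z^{69}+8z^{68}+8z^{66}+8z^{65}+8z^{62}+8z^{61}+8z^{58}+8z^{57}+8z^{56}+8z^{55}\\ &+8z^{53}+8z^{51}+8z^{50}+8z^{49}+8z^{38}+8z^{37}+8z^{36}+8z^{35}+8z^{28}+8z^{25}+8z^{24}+8z^{22}\\ &+8z^{18}+8z^{17}+8z^{14}+8z^{11}+8z^{10}+8z^8+8z^4+12z^3+8z^2+8+\tfrac{4}{z}+\tfrac{8}{z^2}+\tfrac{10}{z^3}\\ &+\tfrac{4}{z^4}+\tfrac{10}{z^6}+\tfrac{12}{z^8}+\tfrac{12}{z^{10}}+\tfrac{8}{z^{11}}+\tfrac{2}{z^{12}},\\ a_3(z)={}&8z^{72}+8z^{69}+8z^{67}+8z^{66}+8z^{61}+8z^{60}+8z^{56}+8z^{55}+8z^{50}+8z^{47}+8z^{46}\\ &+8z^{45}+8z^{42}+8z^{40}+8z^{37}+8z^{33}+8z^{32}+8z^{31}+8z^{30}+8z^{28}+8z^{25}+8z^{20}+8z^{19}\\ &+8z^{17}+8z^{16}+8z^{13}+8z^{12}+8z^{10}+8z^9+8z^8+8z^3+12z^2+8z+\tfrac{8}{z}+\tfrac{4}{z^2}+\tfrac{4}{z^3}+\tfrac{10}{z^4}\\ &+\tfrac{12}{z^5}+\tfrac{12}{z^6}+\tfrac{18}{z^7}+\tfrac{8}{z^8}+\tfrac{12}{z^9}+\tfrac{8}{z^{10}}+\tfrac{4}{z^{11}}+\tfrac{12}{z^{12}}+\tfrac{10}{z^{13}},\\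 a_4(z)={}&8z^{72}+8z^{71}+8z^{70}+8z^{67}+8z^{65}+8z^{64}+8z^{63}+8z^{60}+8z^{59}+8z^{58}+8z^{57}\\ &+8z^{56}+8z^{54}+8z^{53}+8z^{51}+8z^{49}+8z^{48}+8z^{45}+8z^{40}+8z^{37}+8z^{36}+8z^{34}+8z^{33}\\ &+8z^{32}+8z^{30}+8z^{29}+8z^{28}+8z^{25}+8z^{24}+8z^{21}+8z^{18}+8z^{17}+8z^{13}+8z^{11}+8z^9\\ &+12z^8+8z^7+8z^6+8z^5+12z^4+12z^3+6z^2+8z+12+\tfrac{4}{z}+\tfrac{10}{z^2}+\tfrac{14}{z^3}+\tfrac{1}{z^4}\\ &+\tfrac{14}{z^5}+\tfrac{10}{z^6}+\tfrac{5}{z^7}+\tfrac{12}{z^8}+\tfrac{14}{z^9}+\tfrac{12}{z^{10}}+\tfrac{2}{z^{11}}+\tfrac{2}{z^{12}}+\tfrac{1}{z^{13}},\\ a_5(z)={}&8z^{67}+8z^{65}+8z^{63}+8z^{62}+8z^{58}+8z^{57}+8z^{53}+8z^{52}+8z^{50}+8z^{48}\\ &+8z^{46}+8z^{44}+8z^{43}+8z^{40}+8z^{39}+8z^{37}+8z^{34}+8z^{33}+8z^{28}+8z^{26}\\ &+8z^{23}+8z^{20}+8z^{17}+8z^{15}+8z^{13}+8z^{11}+8z^9+8z^8+8z^7+8z^5\\ &+8z^4+4z^2+8z+\tfrac{4}{z^2}+\tfrac{8}{z^3}+\tfrac{14}{z^4}+\tfrac{12}{z^5}+\tfrac{14}{z^7}+\tfrac{4}{z^9}+\tfrac{4}{z^{11}}+\tfrac{6}{z^{13}}.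 \end{align*}
   Context: For a finitely generated group $\Gamma$, $s_n(\Gamma)$ denotes the number of subgroups of index $n$ in $\Gamma$. For formal Laurent series with integer coefficients, an equality "modulo $M$" means that coefficients of equal powers of $z$ agree modulo $M$. $\Phi^i(z)$ denotes $(\Phi(z))^i$. *)

theory Defs
  imports
    "HOL-Algebra.Coset"
    "HOL-Analysis.Determinants"
    "HOL-Computational_Algebra.Formal_Laurent_Series"
    "HOL-Number_Theory.Cong"
begin

definition SL2Z :: "(int ^ 2 ^ 2) monoid" where
  "SL2Z = \<lparr>carrier = {A. det A = 1}, monoid.mult = (**), one = mat 1\<rparr>"

lemma group_SL2Z: "group SL2Z"
proof (rule groupI)
  fix A :: "int ^ 2 ^ 2"
  assume A: "A \<in> carrier SL2Z"
  define B :: "int ^ 2 ^ 2" where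
    "B = vector [vector [A$2$2, - A$1$2], vector [- A$2$1, A$1$1]]"
  have d: "A$1$1 * A$2$2 - A$1$2 * A$2$1 = 1"
    using A by (simp add: SL2Z_def det_2)
  have "det B = 1"
    using d by (simp add: B_def det_2 algebra_simps)
  moreover have "B ** A = mat 1"
    using d by (simp add: B_def matrix_matrix_mult_def mat_def vec_eq_iff forall_2 sum_2 algebra_simps)
  ultimately show "\<exists>B\<in>carrier SL2Z. B \<otimes>\<^bsub>SL2Z\<^esub> A = \<one>\<^bsub>SL2Z\<^esub>"
    by (auto simp: SL2Z_def)
qed (auto simp: SL2Z_def det_mul det_I matrix_mul_assoc)

text \<open>
  For a finitely generated group and \<open>n > 0\<close> the set counted here is finite, so that
  \<^const>\<open>card\<close> is the genuine number of subgroups of index \<open>n\<close>.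
\<close>

definition num_subgroups :: "('a, 'b) monoid_scheme \<Rightarrow> nat \<Rightarrow> nat" where
  "num_subgroups G n =
     card {H. subgroup H G \<and> finite (rcosets\<^bsub>G\<^esub> H) \<and> card (rcosets\<^bsub>G\<^esub> H) = n}"

definition fls_cong :: "int \<Rightarrow> int fls \<Rightarrow> int fls \<Rightarrow> bool" where
  "fls_cong M f g \<longleftrightarrow> (\<forall>k. [fls_nth f k = fls_nth g k] (mod M))"

definition Phi :: "int fls" where
  "Phi = fps_to_fls (\<Sum>n. fps_X ^ (2 ^ n))"

text \<open>
  The infinite sum is taken in the metric topology of formal power series; it converges, so
  \<^const>\<open>Phi\<close> is not an unspecified value of \<^const>\<open>suminf\<close>.
\<close>

lemma Phi_sums:
  "(\<lambda>n. fps_X ^ (2 ^ n) :: int fps) sums Abs_fps (\<lambda>m. if \<exists>n. m = 2 ^ n then 1 else 0)"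
  unfolding sums_def
proof (rule tendsto_fpsI)
  fix m :: nat
  show "\<forall>\<^sub>F k in sequentially. fps_nth (\<Sum>n<k. fps_X ^ (2 ^ n) :: int fps) m =
          fps_nth (Abs_fps (\<lambda>m. if \<exists>n. m = 2 ^ n then 1 else 0)) m"
  proof (rule eventually_sequentiallyI[of m])
    fix k :: nat
    assume k: "m \<le> k"
    have eq: "fps_nth (\<Sum>n<k. fps_X ^ (2 ^ n) :: int fps) m =
        (\<Sum>n<k. if m = 2 ^ n then 1 else 0)"
      by (simp add: fps_sum_nth)
    show "fps_nth (\<Sum>n<k. fps_X ^ (2 ^ n) :: int fps) m =
        fps_nth (Abs_fps (\<lambda>m. if \<exists>n. m = 2 ^ n then 1 else 0)) m"
    proof (cases "\<exists>n. m = 2 ^ n")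
      case True
      then obtain j where j: "m = 2 ^ j" by blast
      have "j < m" using j by simp
      then have "j < k" using k by simp
      have "(\<Sum>n<k. if m = 2 ^ n then 1 else 0 :: int) = (\<Sum>n<k. if n = j then 1 else 0)"
        by (rule sum.cong) (auto simp: j)
      also have "\<dots> = 1" using \<open>j < k\<close> by simp
      finally show ?thesis using True eq by simp
    next
      case False
      then show ?thesis using eq by simp
    qed
  qed
qed

lemma Phi_altdef: "Phi = fps_to_fls (Abs_fps (\<lambda>m. if \<exists>n. m = 2 ^ n then 1 else 0))"
  unfolding Phi_def using sums_unique[OF Phi_sums] by simp

text \<open>
  The monomial \<open>z\<^sup>k\<close> for an arbitrary integer exponent; \<open>powi\<close> is not available here,
  since \<^typ>\<open>int fls\<close> has no \<open>inverse\<close>.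
\<close>

abbreviation zpow :: "int \<Rightarrow> int fls" where
  "zpow k \<equiv> fls_X_intpow k"

definition coeff_a0 :: "int fls" where
  "coeff_a0 =
     8 * zpow 74 + 8 * zpow 71 + 8 * zpow 68 + 8 * zpow 67 + 8 * zpow 62 + 8 * zpow 61 +
     8 * zpow 57 + 8 * zpow 56 + 8 * zpow 54 + 8 * zpow 50 + 8 * zpow 48 + 8 * zpow 47 +
     8 * zpow 45 + 8 * zpow 44 + 8 * zpow 43 + 8 * zpow 42 + 8 * zpow 41 + 8 * zpow 40 +
     8 * zpow 38 + 8 * zpow 35 + 8 * zpow 31 + 8 * zpow 26 + 8 * zpow 24 + 8 * zpow 21 +
     12 * zpow 20 + 12 * zpow 17 + 8 * zpow 16 + 8 * zpow 15 + 4 * zpow 14 +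
     4 * zpow 12 + 12 * zpow 9 + 14 * zpow 8 + 8 * zpow 7 + 12 * zpow 6 + 16 * zpow 5 +
     12 * zpow 4 + 12 * zpow 3 + 8 * zpow 2 + 8 + 10 * zpow (-1) + 12 * zpow (-2) +
     3 * zpow (-3) + 14 * zpow (-4) + 9 * zpow (-5) + 4 * zpow (-6) + 12 * zpow (-7) +
     4 * zpow (-8) + 3 * zpow (-9) + 6 * zpow (-10)"

definition coeff_a1 :: "int fls" where
  "coeff_a1 =
     8 * zpow 73 + 8 * zpow 72 + 8 * zpow 71 + 8 * zpow 69 + 8 * zpow 68 + 8 * zpow 67 +
     8 * zpow 66 + 8 * zpow 64 + 8 * zpow 63 + 8 * zpow 62 + 8 * zpow 61 + 8 * zpow 60 +
     8 * zpow 59 + 8 * zpow 55 + 8 * zpow 54 + 8 * zpow 49 + 8 * zpow 47 + 8 * zpow 41 +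
     8 * zpow 38 + 8 * zpow 36 + 8 * zpow 35 + 8 * zpow 32 + 8 * zpow 30 + 8 * zpow 29 +
     8 * zpow 28 + 8 * zpow 27 + 8 * zpow 24 + 8 * zpow 23 + 8 * zpow 21 + 8 * zpow 17 +
     8 * zpow 14 + 8 * zpow 13 + 8 * zpow 12 + 8 * zpow 9 + 8 * zpow 8 + 8 * zpow 7 +
     8 * zpow 5 + 12 * zpow 4 + 8 * zpow 3 + 4 + 16 * zpow (-1) + 6 * zpow (-2) +
     12 * zpow (-3) + 8 * zpow (-4) + 6 * zpow (-5) + 4 * zpow (-7) + 4 * zpow (-9) +
     8 * zpow (-10) + 14 * zpow (-11)"

definition coeff_a2 :: "int fls" where
  "coeff_a2 =
     8 * zpow 72 + 8 * zpow 69 + 8 * zpow 68 + 8 * zpow 66 + 8 * zpow 65 + 8 * zpow 62 +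
     8 * zpow 61 + 8 * zpow 58 + 8 * zpow 57 + 8 * zpow 56 + 8 * zpow 55 + 8 * zpow 53 +
     8 * zpow 51 + 8 * zpow 50 + 8 * zpow 49 + 8 * zpow 38 + 8 * zpow 37 + 8 * zpow 36 +
     8 * zpow 35 + 8 * zpow 28 + 8 * zpow 25 + 8 * zpow 24 + 8 * zpow 22 + 8 * zpow 18 +
     8 * zpow 17 + 8 * zpow 14 + 8 * zpow 11 + 8 * zpow 10 + 8 * zpow 8 + 8 * zpow 4 +
     12 * zpow 3 + 8 * zpow 2 + 8 + 4 * zpow (-1) + 8 * zpow (-2) + 10 * zpow (-3) +
     4 * zpow (-4) + 10 * zpow (-6) + 12 * zpow (-8) + 12 * zpow (-10) +
     8 * zpow (-11) + 2 * zpow (-12)"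

definition coeff_a3 :: "int fls" where
  "coeff_a3 =
     8 * zpow 72 + 8 * zpow 69 + 8 * zpow 67 + 8 * zpow 66 + 8 * zpow 61 + 8 * zpow 60 +
     8 * zpow 56 + 8 * zpow 55 + 8 * zpow 50 + 8 * zpow 47 + 8 * zpow 46 + 8 * zpow 45 +
     8 * zpow 42 + 8 * zpow 40 + 8 * zpow 37 + 8 * zpow 33 + 8 * zpow 32 + 8 * zpow 31 +
     8 * zpow 30 + 8 * zpow 28 + 8 * zpow 25 + 8 * zpow 20 + 8 * zpow 19 + 8 * zpow 17 +
     8 * zpow 16 + 8 * zpow 13 + 8 * zpow 12 + 8 * zpow 10 + 8 * zpow 9 + 8 * zpow 8 +
     8 * zpow 3 + 12 * zpow 2 + 8 * zpow 1 + 8 * zpow (-1) + 4 * zpow (-2) +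
     4 * zpow (-3) + 10 * zpow (-4) + 12 * zpow (-5) + 12 * zpow (-6) + 18 * zpow (-7) +
     8 * zpow (-8) + 12 * zpow (-9) + 8 * zpow (-10) + 4 * zpow (-11) +
     12 * zpow (-12) + 10 * zpow (-13)"

definition coeff_a4 :: "int fls" where
  "coeff_a4 =
     8 * zpow 72 + 8 * zpow 71 + 8 * zpow 70 + 8 * zpow 67 + 8 * zpow 65 + 8 * zpow 64 +
     8 * zpow 63 + 8 * zpow 60 + 8 * zpow 59 + 8 * zpow 58 + 8 * zpow 57 + 8 * zpow 56 +
     8 * zpow 54 + 8 * zpow 53 + 8 * zpow 51 + 8 * zpow 49 + 8 * zpow 48 + 8 * zpow 45 +
     8 * zpow 40 + 8 * zpow 37 + 8 * zpow 36 + 8 * zpow 34 + 8 * zpow 33 + 8 * zpow 32 +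
     8 * zpow 30 + 8 * zpow 29 + 8 * zpow 28 + 8 * zpow 25 + 8 * zpow 24 + 8 * zpow 21 +
     8 * zpow 18 + 8 * zpow 17 + 8 * zpow 13 + 8 * zpow 11 + 8 * zpow 9 + 12 * zpow 8 +
     8 * zpow 7 + 8 * zpow 6 + 8 * zpow 5 + 12 * zpow 4 + 12 * zpow 3 + 6 * zpow 2 +
     8 * zpow 1 + 12 + 4 * zpow (-1) + 10 * zpow (-2) + 14 * zpow (-3) + 1 * zpow (-4) +
     14 * zpow (-5) + 10 * zpow (-6) + 5 * zpow (-7) + 12 * zpow (-8) + 14 * zpow (-9) +
     12 * zpow (-10) + 2 * zpow (-11) + 2 * zpow (-12) + 1 * zpow (-13)"

definition coeff_a5 :: "int fls" where
  "coeff_a5 =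
     8 * zpow 67 + 8 * zpow 65 + 8 * zpow 63 + 8 * zpow 62 + 8 * zpow 58 + 8 * zpow 57 +
     8 * zpow 53 + 8 * zpow 52 + 8 * zpow 50 + 8 * zpow 48 + 8 * zpow 46 + 8 * zpow 44 +
     8 * zpow 43 + 8 * zpow 40 + 8 * zpow 39 + 8 * zpow 37 + 8 * zpow 34 + 8 * zpow 33 +
     8 * zpow 28 + 8 * zpow 26 + 8 * zpow 23 + 8 * zpow 20 + 8 * zpow 17 + 8 * zpow 15 +
     8 * zpow 13 + 8 * zpow 11 + 8 * zpow 9 + 8 * zpow 8 + 8 * zpow 7 + 8 * zpow 5 +
     8 * zpow 4 + 4 * zpow 2 + 8 * zpow 1 + 4 * zpow (-2) + 8 * zpow (-3) +
     14 * zpow (-4) + 12 * zpow (-5) + 14 * zpow (-7) + 4 * zpow (-9) + 4 * zpow (-11) +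
     6 * zpow (-13)"

end

theory Submission
  imports Defs "HOL-Combinatorics.Cycles"
begin

text \<open>
  \<open>SL\<^sub>2(\<int>)\<close> is the amalgam of \<open>\<int>/4\<close> and \<open>\<int>/6\<close> over \<open>\<int>/2\<close>, so its actions on a finite set are the pairs of
  permutations \<open>(x, y)\<close> with \<open>x\<^sup>2 = y\<^sup>3\<close> and \<open>x\<^sup>4 = 1\<close>. A subgroup of index \<open>n\<close> corresponds to \<open>(n - 1)!\<close>
  transitive actions on \<open>n\<close> labelled points, and splitting off the orbit of one point gives \<open>H' = S H\<close>, where
  \<open>S\<close> is the series of subgroup numbers and \<open>H\<close> the exponential generating function of all pairs. This is done
  separately for subgroups that contain \<open>-1\<close> (pairs with \<open>x\<^sup>2 = 1\<close>) and those that do not (pairs for which \<open>x\<^sup>2\<close>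
  has no fixed point). In both cases the number of pairs is a product of sequences with short recursions, \<open>H\<close>
  satisfies a linear differential equation of order 2, and \<open>S\<close> the Riccati equation
  \<open>S = c + a S + b (S' + S\<^sup>2)\<close> with \<open>a(0) = b(0) = b'(0) = 0\<close>, which determines \<open>S\<close> modulo 16.

  It remains to exhibit a solution of each Riccati equation modulo 16 in terms of \<open>P = \<Phi>\<close>. Since \<open>\<Phi>(z\<^sup>2) = \<Phi> - z\<close>,
  the congruence \<open>f(z)\<^sup>2 = f(z\<^sup>2)\<close> modulo 2 shows that \<open>E = P\<^sup>2 - P + z\<close> is divisible by 2 and
  \<open>E\<^sup>2 - 2E + 4zP - 4z\<^sup>2\<close> by 8; moreover \<open>\<Phi>'\<close> is a polynomial modulo 16. With these relations all
  claims become identities between Laurent polynomials with coefficients modulo 16.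
\<close>

section \<open>The amalgam structure of the modular group\<close>

locale amalgam_words =
  fixes f :: "'m \<Rightarrow> 'm \<Rightarrow> 'm" and e X Y Z :: 'm
  assumes assoc: "f (f a b) c = f a (f b c)"
    and unit [simp]: "f e a = a" "f a e = a"
    and XX: "f X X = Z" and YYY: "f Y (f Y Y) = Z" and ZZ: "f Z Z = e"
begin

inductive_set gen :: "'m set" where
  one: "e \<in> gen"
| X: "w \<in> gen \<Longrightarrow> f w X \<in> gen"
| Y: "w \<in> gen \<Longrightarrow> f w Y \<in> gen"

text \<open>For the matrix group these are the words in the elementary matrices \<open>X\<^bsup>-1\<^esup>Y\<close> and \<open>X\<^bsup>-1\<^esup>Y\<^sup>2\<close>;
  as their entries are nonnegative, no nonempty word is trivial.\<close>

fun pos :: "bool list \<Rightarrow> 'm" where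
  "pos [] = e"
| "pos (b # bs) = f (pos bs) (f (f X Z) (if b then Y else f Y Y))"

definition nf :: "bool \<Rightarrow> nat \<Rightarrow> bool list \<Rightarrow> bool \<Rightarrow> 'm" where
  "nf s i bs t =
     f (if s then Z else e) (f (((\<lambda>m. f m Y) ^^ i) e) (f (pos bs) (if t then X else e)))"

lemma X_Z: "f X Z = f Z X"
  by (simp flip: XX add: assoc)

lemma Y_Z: "f Y Z = f Z Y"
  by (simp flip: YYY add: assoc)

lemma X_Z_left: "f X (f Z a) = f Z (f X a)"
  by (simp add: X_Z flip: assoc)

lemma Y_Z_left: "f Y (f Z a) = f Z (f Y a)"
  by (simp add: Y_Z flip: assoc)

lemma ZZ_left: "f Z (f Z a) = a"
  by (simp add: ZZ flip: assoc)

lemma XX_left: "f X (f X a) = f Z a"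
  by (simp add: XX flip: assoc)

lemma YYY_left: "f Y (f Y (f Y a)) = f Z a"
  by (simp flip: YYY add: assoc)

lemmas Z_simps = assoc X_Z Y_Z X_Z_left Y_Z_left ZZ ZZ_left XX XX_left YYY YYY_left

lemma pos_Z_left: "f (pos bs) (f Z a) = f Z (f (pos bs) a)"
  by (induction bs arbitrary: a) (simp_all add: Z_simps)

lemma pos_Z: "f (pos bs) Z = f Z (pos bs)"
  using pos_Z_left[of bs e] by simp

lemma Ypow_Z_left: "f (((\<lambda>m. f m Y) ^^ i) e) (f Z a) = f Z (f (((\<lambda>m. f m Y) ^^ i) e) a)"
  by (induction i arbitrary: a) (simp_all add: Z_simps)

lemma Ypow_Z: "f (((\<lambda>m. f m Y) ^^ i) e) Z = f Z (((\<lambda>m. f m Y) ^^ i) e)"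
  using Ypow_Z_left[of i e] by simp

lemmas nf_simps = nf_def Z_simps pos_Z_left pos_Z Ypow_Z_left Ypow_Z

lemma nf_X: "f (nf s i bs t) X = (if t then nf (\<not> s) i bs False else nf s i bs True)"
  by (simp add: nf_simps)

lemma nf_Y_True: "f (nf s i bs True) Y = nf (\<not> s) i (True # bs) False"
  by (simp add: nf_simps)

lemma nf_Y_Cons_True: "f (nf s i (True # bs) False) Y = nf s i (False # bs) False"
  by (simp add: nf_simps)

lemma nf_Y_Cons_False: "f (nf s i (False # bs) False) Y = nf s i bs True"
  by (simp add: nf_simps)

lemma nf_Y_Nil: "f (nf s i [] False) Y = nf s (Suc i) [] False"
  by (simp add: nf_simps)

lemma nf_3: "nf s 3 [] False = nf (\<not> s) 0 [] False"
  by (simp add: nf_simps numeral_3_eq_3)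

lemma gen_nf:
  assumes "w \<in> gen"
  shows "\<exists>s i bs t. i < 3 \<and> w = nf s i bs t"
  using assms
proof induction
  case one
  have "e = nf False 0 [] False"
    by (simp add: nf_def)
  then show ?case
    by (metis zero_less_numeral)
next
  case (X w)
  then show ?case
    by (metis nf_X)
next
  case (Y w)
  then obtain s i bs t where i: "i < 3" and w: "w = nf s i bs t"
    by blast
  consider "t" | "\<not> t" "bs = []" | bs' where "\<not> t" "bs = True # bs'" |
    bs' where "\<not> t" "bs = False # bs'"
    by (metis (full_types) list.exhaust)
  then show ?case
  proof cases
    case 1
    then show ?thesis using i w nf_Y_True by metis
  next
    case 2
    show ?thesis
    proof (cases "i = 2")
      case True
      then have "f w Y = nf (\<not> s) 0 [] False"
        using 2 w nf_Y_Nil[of s 2] nf_3[of s] by simp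
      then show ?thesis by (metis zero_less_numeral)
    next
      case False
      then have "Suc i < 3" using i by simp
      then show ?thesis using 2 w nf_Y_Nil by metis
    qed
  next
    case 3
    then show ?thesis using i w nf_Y_Cons_True by metis
  next
    case 4
    then show ?thesis using i w nf_Y_Cons_False by metis
  qed
qed

lemma gen_mult: "v \<in> gen \<Longrightarrow> w \<in> gen \<Longrightarrow> f v w \<in> gen"
  by (rotate_tac 1, induction w rule: gen.induct)
    (auto simp: assoc[symmetric] intro: gen.intros)

end

definition mat2 :: "int \<Rightarrow> int \<Rightarrow> int \<Rightarrow> int \<Rightarrow> int ^ 2 ^ 2" where
  "mat2 a b c d = vector [vector [a, b], vector [c, d]]"

lemma mat2_nth [simp]:
  "mat2 a b c d $ 1 $ 1 = a" "mat2 a b c d $ 1 $ 2 = b"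
  "mat2 a b c d $ 2 $ 1 = c" "mat2 a b c d $ 2 $ 2 = d"
  by (simp_all add: mat2_def)

lemma mat2_eq_iff [simp]: "mat2 a b c d = mat2 a' b' c' d' \<longleftrightarrow> a = a' \<and> b = b' \<and> c = c' \<and> d = d'"
  by (auto simp: vec_eq_iff forall_2)

lemma mat2_cases: obtains a b c d where "A = mat2 a b c d"
  by (rule that[of "A$1$1" "A$1$2" "A$2$1" "A$2$2"]) (simp add: vec_eq_iff forall_2)

lemma mat2_mult [simp]:
  "mat2 a b c d ** mat2 a' b' c' d' =
     mat2 (a * a' + b * c') (a * b' + b * d') (c * a' + d * c') (c * b' + d * d')"
  by (simp add: vec_eq_iff forall_2 matrix_matrix_mult_def sum_2)

lemma mat_1_eq: "mat 1 = mat2 1 0 0 1"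
  by (simp add: vec_eq_iff forall_2 mat_def)

lemma det_mat2 [simp]: "det (mat2 a b c d) = a * d - b * c"
  by (simp add: det_2)

definition mS :: "int ^ 2 ^ 2" where "mS = mat2 0 (-1) 1 0"
definition mU :: "int ^ 2 ^ 2" where "mU = mat2 0 (-1) 1 1"
definition mZ :: "int ^ 2 ^ 2" where "mZ = mat2 (-1) 0 0 (-1)"

interpretation M: amalgam_words "(**)" "mat 1" mS mU mZ
  by unfold_locales (simp_all add: matrix_mul_assoc, simp_all add: mS_def mU_def mZ_def mat_1_eq)

lemma M_pos_form:
  "\<exists>a b c d. M.pos bs = mat2 a b c d \<and> a \<ge> 1 \<and> d \<ge> 1 \<and> b \<ge> 0 \<and> c \<ge> 0 \<and> (bs \<noteq> [] \<longrightarrow> b + c \<ge> 1)"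
proof (induction bs)
  case Nil
  show ?case unfolding M.pos.simps by (simp add: mat_1_eq)
next
  case (Cons x bs)
  then obtain a b c d where "M.pos bs = mat2 a b c d \<and> a \<ge> 1 \<and> d \<ge> 1 \<and> b \<ge> 0 \<and> c \<ge> 0"
    by blast
  then show ?case
    unfolding M.pos.simps by (auto simp: mS_def mZ_def mU_def)
qed

lemma M_nf_eq_1:
  assumes "M.nf s i bs t = mat 1" "i < 3"
  shows "\<not> s \<and> i = 0 \<and> bs = [] \<and> \<not> t"
proof -
  obtain a b c d where bs: "M.pos bs = mat2 a b c d" "a \<ge> 1" "d \<ge> 1" "b \<ge> 0" "c \<ge> 0"
      "bs \<noteq> [] \<longrightarrow> b + c \<ge> 1"
    using M_pos_form by blast
  consider "i = 0" | "i = 1" | "i = 2"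
    using assms(2) by linarith
  then show ?thesis
    using assms(1) bs(2-6) unfolding M.nf_def bs(1)
    by cases (simp_all add: mat_1_eq mS_def mZ_def mU_def numeral_2_eq_2 split: if_splits)
qed

definition act_mult :: "(int ^ 2 ^ 2) \<times> ('b \<Rightarrow> 'b) \<Rightarrow> (int ^ 2 ^ 2) \<times> ('b \<Rightarrow> 'b) \<Rightarrow> (int ^ 2 ^ 2) \<times> ('b \<Rightarrow> 'b)"
  where "act_mult v w = (fst v ** fst w, snd w \<circ> snd v)"

definition act_one :: "(int ^ 2 ^ 2) \<times> ('b \<Rightarrow> 'b)" where
  "act_one = (mat 1, id)"

lemma fst_act_one [simp]: "fst act_one = mat 1"
  by (simp add: act_one_def)

lemma fst_act_mult [simp]: "fst (act_mult v w) = fst v ** fst w"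
  by (simp add: act_mult_def)

locale amalgam_action =
  fixes x y z :: "'b \<Rightarrow> 'b"
  assumes xx: "x \<circ> x = z" and yyy: "y \<circ> (y \<circ> y) = z" and zz: "z \<circ> z = id"
begin

sublocale P: amalgam_words act_mult act_one "(mS, x)" "(mU, y)" "(mZ, z)"
  using xx yyy zz M.XX M.YYY M.ZZ
  by unfold_locales (auto simp: act_mult_def act_one_def matrix_mul_assoc o_assoc)

lemma fst_pos: "fst (P.pos bs) = M.pos bs"
  by (induction bs) simp_all

lemma fst_Ypow: "fst (((\<lambda>m. act_mult m (mU, y)) ^^ i) act_one) = ((\<lambda>m. m ** mU) ^^ i) (mat 1)"
  by (induction i) simp_all

lemma fst_nf: "fst (P.nf s i bs t) = M.nf s i bs t"
  using fst_pos[of bs] fst_Ypow[of i] by (simp add: P.nf_def M.nf_def)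

lemma gen_one_unique:
  assumes "(mat 1, p) \<in> P.gen"
  shows "p = id"
proof -
  obtain s i bs t where i: "i < 3" and w: "(mat 1, p) = P.nf s i bs t"
    using P.gen_nf[OF assms] by blast
  then have "M.nf s i bs t = mat 1"
    by (metis fst_conv fst_nf)
  then have "(mat 1, p) = P.nf False 0 [] False"
    using M_nf_eq_1 i w by metis
  then show ?thesis
    unfolding P.nf_def P.pos.simps by (simp add: act_one_def act_mult_def)
qed

end

lemma carrier_SL2Z [simp]: "A \<in> carrier SL2Z \<longleftrightarrow> det A = 1"
  and mult_SL2Z [simp]: "A \<otimes>\<^bsub>SL2Z\<^esub> B = A ** B"
  and one_SL2Z [simp]: "\<one>\<^bsub>SL2Z\<^esub> = mat 1"
  by (simp_all add: SL2Z_def)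

interpretation SL2Z: group SL2Z
  by (rule group_SL2Z)

lemma mS_simps: "mS ** mS = mZ" "mU ** (mU ** mU) = mZ" "mZ ** mZ = mat 1"
  by (simp_all add: mS_def mU_def mZ_def mat_1_eq)

lemma det_gens [simp]: "det mS = 1" "det mU = 1" "det mZ = 1"
  by (simp_all add: mS_def mU_def mZ_def)

text \<open>Column operations run the Euclidean algorithm on the first row.\<close>

lemma SL2Z_induct [consumes 1, case_names one S U]:
  assumes "det g = 1"
    and one: "P (mat 1)"
    and S: "\<And>g. det g = 1 \<Longrightarrow> P g \<Longrightarrow> P (g ** mS)"
    and U: "\<And>g. det g = 1 \<Longrightarrow> P g \<Longrightarrow> P (g ** mU)"
  shows "P g"
proof -
  define Q where "Q g \<longleftrightarrow> det g = 1 \<and> P g" for g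
  have QS: "Q (g ** mS)" and QU: "Q (g ** mU)" if "Q g" for g
    using that S U by (auto simp: Q_def det_mul)
  have QSi: "Q (g ** mat2 0 1 (-1) 0)" if "Q g" for g
    using QS[OF QS[OF QS[OF that]]]
    by (simp add: matrix_mul_assoc[symmetric]) (simp add: mS_def)
  have QT: "Q (g ** mat2 1 1 0 1)" if "Q g" for g
    using QU[OF QSi[OF that]]
    by (simp add: matrix_mul_assoc[symmetric]) (simp add: mU_def)
  have QTi: "Q (g ** mat2 1 (-1) 0 1)" if "Q g" for g
    using QS[OF QU[OF QU[OF QU[OF QU[OF QU[OF that]]]]]]
    by (simp add: matrix_mul_assoc[symmetric]) (simp add: mU_def mS_def)
  have T_pos: "Q (g ** mat2 1 (int n) 0 1)" if "Q g" for g n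
  proof (induction n)
    case 0
    then show ?case using that by (simp add: mat_1_eq[symmetric])
  next
    case (Suc n)
    from QT[OF this] show ?case
      by (simp add: matrix_mul_assoc[symmetric] algebra_simps)
  qed
  have T_neg: "Q (g ** mat2 1 (- int n) 0 1)" if "Q g" for g n
  proof (induction n)
    case 0
    then show ?case using that by (simp add: mat_1_eq[symmetric])
  next
    case (Suc n)
    from QTi[OF this] show ?case
      by (simp add: matrix_mul_assoc[symmetric] algebra_simps)
  qed
  have QTn: "Q (g ** mat2 1 n 0 1)" if "Q g" for g n
    using T_pos[OF that, of "nat n"] T_neg[OF that, of "nat (- n)"] by (cases "n \<ge> 0") auto
  have Q1: "Q (mat 1)"
    using one by (simp add: Q_def)
  have main: "Q (mat2 a b c d)" if "a * d - b * c = 1" for a b c d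
    using that
  proof (induction "nat \<bar>b\<bar>" arbitrary: a b c d rule: less_induct)
    case less
    show ?case
    proof (cases "b = 0")
      case True
      then have ad: "a * d = 1"
        using less.prems by simp
      then consider "a = 1" "d = 1" | "a = -1" "d = -1"
        by (auto simp: zmult_eq_1_iff)
      then show ?thesis
      proof cases
        case 1
        then show ?thesis
          using True QSi[OF QTn[OF QS[OF Q1], of "- c"]] by (simp add: mS_def)
      next
        case 2
        then show ?thesis
          using True QS[OF QTn[OF QS[OF Q1], of c]] by (simp add: mS_def)
      qed
    next
      case False
      define k where "k = a div b"
      have k: "k * b - a = - (a mod b)"
        using div_mult_mod_eq[of a b] by (simp add: k_def algebra_simps)
      have "nat \<bar>k * b - a\<bar> < nat \<bar>b\<bar>"
        using False unfolding k by (simp add: abs_mod_less)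
      moreover have "b * (k * d - c) - (k * b - a) * d = 1"
        using less.prems by (simp add: algebra_simps)
      ultimately have "Q (mat2 b (k * b - a) d (k * d - c))"
        by (rule less.hyps)
      from QSi[OF QTn[OF this, of "- k"]] show ?thesis
        by (simp add: algebra_simps)
    qed
  qed
  obtain a b c d where "g = mat2 a b c d"
    by (rule mat2_cases)
  then show ?thesis
    using main[of a d b c] assms(1) by (simp add: Q_def)
qed

lemma SL2Z_inverse:
  assumes "det (g :: int ^ 2 ^ 2) = 1"
  obtains h where "det h = 1" "g ** h = mat 1" "h ** g = mat 1"
  using assms SL2Z.inv_closed[of g] SL2Z.r_inv[of g] SL2Z.l_inv[of g] by auto

context amalgam_action
begin

lemma gen_total: "det g = 1 \<Longrightarrow> \<exists>p. (g, p) \<in> P.gen"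
proof (induction rule: SL2Z_induct)
  case one
  then show ?case using P.gen.one by (auto simp: act_one_def)
next
  case (S g)
  then obtain p where "(g, p) \<in> P.gen" by blast
  from P.gen.X[OF this] show ?case unfolding act_mult_def[of "(g, p)"] by auto
next
  case (U g)
  then obtain p where "(g, p) \<in> P.gen" by blast
  from P.gen.Y[OF this] show ?case unfolding act_mult_def[of "(g, p)"] by auto
qed

lemma gen_comp: "(g, p) \<in> P.gen \<Longrightarrow> (h, q) \<in> P.gen \<Longrightarrow> (g ** h, q \<circ> p) \<in> P.gen"
  using P.gen_mult[of "(g, p)" "(h, q)"] by (simp add: act_mult_def)

lemma gen_unique:
  assumes "det g = 1" "(g, p) \<in> P.gen" "(g, q) \<in> P.gen"
  shows "p = q"
proof -
  obtain h where h: "det h = 1" "g ** h = mat 1" "h ** g = mat 1"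
    using SL2Z_inverse[OF assms(1)] .
  obtain r where r: "(h, r) \<in> P.gen"
    using gen_total[OF h(1)] by blast
  have "r \<circ> q = id"
    using gen_comp[OF assms(3) r] h gen_one_unique by simp
  moreover have "p \<circ> r = id"
    using gen_comp[OF r assms(2)] h gen_one_unique by simp
  ultimately show ?thesis
    by (metis comp_assoc comp_id id_comp)
qed

definition act :: "int ^ 2 ^ 2 \<Rightarrow> 'b \<Rightarrow> 'b" where
  "act g = (THE p. (g, p) \<in> P.gen)"

lemma act_eqI: "det g = 1 \<Longrightarrow> (g, p) \<in> P.gen \<Longrightarrow> act g = p"
  unfolding act_def using gen_unique by blast

lemma act_gen: "det g = 1 \<Longrightarrow> (g, act g) \<in> P.gen"
  using gen_total act_eqI by metis

lemma act_one: "act (mat 1) = id"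
  by (rule act_eqI) (use P.gen.one in \<open>auto simp: act_one_def\<close>)

lemma act_mult: "det g = 1 \<Longrightarrow> det h = 1 \<Longrightarrow> act (g ** h) = act h \<circ> act g"
  by (rule act_eqI) (auto simp: det_mul intro: gen_comp act_gen)

lemma act_S: "act mS = x"
  by (rule act_eqI) (use P.gen.X[OF P.gen.one] in \<open>auto simp: act_one_def act_mult_def\<close>)

lemma act_U: "act mU = y"
  by (rule act_eqI) (use P.gen.Y[OF P.gen.one] in \<open>auto simp: act_one_def act_mult_def\<close>)

lemma act_Z: "act mZ = z"
  using act_mult[of mS mS] by (simp add: act_S xx mS_simps)

lemma act_eq_iff:
  assumes "det g = 1" "det h = 1" "det k = 1" "h ** k = mat 1"
  shows "act g a = act h a \<longleftrightarrow> act (g ** k) a = a"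
proof -
  have kh: "k ** h = mat 1"
    using assms SL2Z.inv_comm[of h k] by simp
  have "act k (act h b) = b" "act h (act k b) = b" for b
    using act_mult[OF assms(2,3)] act_mult[OF assms(3,2)] assms(4) kh
    by (auto simp: act_one fun_eq_iff)
  then show ?thesis
    using assms by (metis act_mult comp_apply)
qed

lemma act_closed:
  assumes "x ` B \<subseteq> B" "y ` B \<subseteq> B" "det g = 1" "b \<in> B"
  shows "act g b \<in> B"
  using assms(3)
proof (induction rule: SL2Z_induct)
  case one
  then show ?case using assms by (simp add: act_one)
qed (use assms in \<open>auto simp: act_mult act_S act_U\<close>)

end

section \<open>Subgroups and transitive pairs of permutations\<close>

text \<open>The flag \<open>e\<close> tells whether the central element \<open>-1\<close> acts trivially or without fixed points. For
  a transitive pair one of the two holds.\<close>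

definition amalgam_pairs :: "bool \<Rightarrow> 'b set \<Rightarrow> (('b \<Rightarrow> 'b) \<times> ('b \<Rightarrow> 'b)) set" where
  "amalgam_pairs e A = {(x, y). x permutes A \<and> y permutes A \<and> x \<circ> x = y \<circ> (y \<circ> y) \<and>
     (x \<circ> x) \<circ> (x \<circ> x) = id \<and> (\<forall>a\<in>A. (x (x a) = a) = e)}"

definition transitive_pairs :: "bool \<Rightarrow> 'b set \<Rightarrow> 'b \<Rightarrow> (('b \<Rightarrow> 'b) \<times> ('b \<Rightarrow> 'b)) set" where
  "transitive_pairs e A a = {(x, y) \<in> amalgam_pairs e A.
     \<forall>B\<subseteq>A. a \<in> B \<longrightarrow> x ` B \<subseteq> B \<longrightarrow> y ` B \<subseteq> B \<longrightarrow> B = A}"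

definition SL2Z_subgroups :: "bool \<Rightarrow> nat \<Rightarrow> (int ^ 2 ^ 2) set set" where
  "SL2Z_subgroups e k = {H. subgroup H SL2Z \<and> finite (rcosets\<^bsub>SL2Z\<^esub> H) \<and>
     card (rcosets\<^bsub>SL2Z\<^esub> H) = k \<and> (mZ \<in> H) = e}"

definition pair_act :: "('b \<Rightarrow> 'b) \<times> ('b \<Rightarrow> 'b) \<Rightarrow> int ^ 2 ^ 2 \<Rightarrow> 'b \<Rightarrow> 'b" where
  "pair_act xy = amalgam_action.act (fst xy) (snd xy)"

definition stabilizer :: "('b \<Rightarrow> 'b) \<times> ('b \<Rightarrow> 'b) \<Rightarrow> 'b \<Rightarrow> (int ^ 2 ^ 2) set" where
  "stabilizer xy a = {g. det g = 1 \<and> pair_act xy g a = a}"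

lemma amalgam_action_pair:
  "(x, y) \<in> amalgam_pairs e A \<Longrightarrow> amalgam_action x y (x \<circ> x)"
  by unfold_locales (auto simp: amalgam_pairs_def)

lemma pair_act_one: "xy \<in> amalgam_pairs e A \<Longrightarrow> pair_act xy (mat 1) = id"
  and pair_act_mult: "xy \<in> amalgam_pairs e A \<Longrightarrow> det g = 1 \<Longrightarrow> det h = 1 \<Longrightarrow>
    pair_act xy (g ** h) = pair_act xy h \<circ> pair_act xy g"
  and pair_act_S: "xy \<in> amalgam_pairs e A \<Longrightarrow> pair_act xy mS = fst xy"
  and pair_act_U: "xy \<in> amalgam_pairs e A \<Longrightarrow> pair_act xy mU = snd xy"
  and pair_act_Z: "xy \<in> amalgam_pairs e A \<Longrightarrow> pair_act xy mZ = fst xy \<circ> fst xy"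
  using amalgam_action.act_one amalgam_action.act_mult amalgam_action.act_S amalgam_action.act_U
    amalgam_action.act_Z amalgam_action_pair
  unfolding pair_act_def by (metis prod.collapse)+

lemma pair_act_eq_iff:
  assumes "xy \<in> amalgam_pairs e A" "det g = 1" "det h = 1" "det k = 1" "h ** k = mat 1"
  shows "pair_act xy g a = pair_act xy h a \<longleftrightarrow> pair_act xy (g ** k) a = a"
  using amalgam_action.act_eq_iff[OF amalgam_action_pair, of "fst xy" "snd xy"] assms
  unfolding pair_act_def by simp

lemma pair_act_in:
  assumes xy: "xy \<in> amalgam_pairs e A" and "det g = 1" "b \<in> A"
  shows "pair_act xy g b \<in> A"
proof -
  have "fst xy ` A \<subseteq> A" "snd xy ` A \<subseteq> A"
    using xy by (auto simp: amalgam_pairs_def permutes_in_image)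
  then show ?thesis
    using amalgam_action.act_closed[OF amalgam_action_pair, of "fst xy" "snd xy"] assms
    unfolding pair_act_def by simp
qed

lemma transitive_pairs_pairs: "xy \<in> transitive_pairs e A a \<Longrightarrow> xy \<in> amalgam_pairs e A"
  by (auto simp: transitive_pairs_def)

lemma transitive_onto:
  assumes xy: "xy \<in> transitive_pairs e A a" and "a \<in> A"
  shows "(\<lambda>g. pair_act xy g a) ` {g. det g = 1} = A"
proof -
  note P = transitive_pairs_pairs[OF xy]
  define B where "B = (\<lambda>g. pair_act xy g a) ` {g. det g = 1}"
  have "a \<in> B"
    unfolding B_def by (rule image_eqI[of _ _ "mat 1"]) (auto simp: pair_act_one[OF P])
  moreover have "fst xy ` B \<subseteq> B"
  proof (clarsimp simp: B_def)
    fix g :: "int ^ 2 ^ 2" assume "det g = 1"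
    then show "fst xy (pair_act xy g a) \<in> (\<lambda>g. pair_act xy g a) ` {g. det g = 1}"
      by (intro image_eqI[of _ _ "g ** mS"])
        (auto simp: pair_act_mult[OF P] pair_act_S[OF P] det_mul)
  qed
  moreover have "snd xy ` B \<subseteq> B"
  proof (clarsimp simp: B_def)
    fix g :: "int ^ 2 ^ 2" assume "det g = 1"
    then show "snd xy (pair_act xy g a) \<in> (\<lambda>g. pair_act xy g a) ` {g. det g = 1}"
      by (intro image_eqI[of _ _ "g ** mU"])
        (auto simp: pair_act_mult[OF P] pair_act_U[OF P] det_mul)
  qed
  moreover have "B \<subseteq> A"
    using pair_act_in[OF P] \<open>a \<in> A\<close> by (auto simp: B_def)
  moreover have "\<forall>B\<subseteq>A. a \<in> B \<longrightarrow> fst xy ` B \<subseteq> B \<longrightarrow> snd xy ` B \<subseteq> B \<longrightarrow> B = A"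
    using xy by (simp add: transitive_pairs_def case_prod_unfold)
  ultimately show ?thesis
    unfolding B_def[symmetric] by blast
qed

lemma rcos_eq_iff:
  assumes "subgroup H SL2Z" "det g = 1" "det h = 1" "det k = 1" "h ** k = mat 1"
  shows "H #>\<^bsub>SL2Z\<^esub> g = H #>\<^bsub>SL2Z\<^esub> h \<longleftrightarrow> g ** k \<in> H"
proof -
  have k: "k = inv\<^bsub>SL2Z\<^esub> h"
    using assms SL2Z.inv_equality[of k h] SL2Z.inv_comm[of h k] by simp
  have "h \<in> carrier SL2Z" "g \<in> carrier SL2Z"
    using assms by simp_all
  then have "H #>\<^bsub>SL2Z\<^esub> g = H #>\<^bsub>SL2Z\<^esub> h \<longleftrightarrow> g \<in> H #>\<^bsub>SL2Z\<^esub> h"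
    using SL2Z.rcos_self[of g H] SL2Z.repr_independence[of g H h] assms(1) by blast
  then show ?thesis
    using subgroup.rcos_module[OF assms(1) group_SL2Z, of h g] assms(2,3) k by simp
qed

lemma stabilizer_subgroup:
  assumes P: "xy \<in> amalgam_pairs e A"
  shows "subgroup (stabilizer xy a) SL2Z"
proof (rule SL2Z.subgroupI)
  show "stabilizer xy a \<noteq> {}"
    using pair_act_one[OF P] by (auto simp: stabilizer_def intro: exI[of _ "mat 1"])
  fix g assume g: "g \<in> stabilizer xy a"
  then have dg: "det g = 1" "det (inv\<^bsub>SL2Z\<^esub> g) = 1"
    using SL2Z.inv_closed[of g] by (auto simp: stabilizer_def)
  have "mat 1 ** inv\<^bsub>SL2Z\<^esub> g = inv\<^bsub>SL2Z\<^esub> g" "g ** inv\<^bsub>SL2Z\<^esub> g = mat 1"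
    using dg SL2Z.r_inv[of g] by simp_all
  then show "inv\<^bsub>SL2Z\<^esub> g \<in> stabilizer xy a"
    using g dg pair_act_eq_iff[OF P, of "mat 1" g "inv\<^bsub>SL2Z\<^esub> g" a] pair_act_one[OF P]
    by (auto simp: stabilizer_def)
qed (auto simp: stabilizer_def pair_act_mult[OF P] det_mul)

lemma stabilizer_rcos_iff:
  assumes P: "xy \<in> amalgam_pairs e A" and "det g = 1" "det h = 1"
  shows "stabilizer xy a #>\<^bsub>SL2Z\<^esub> g = stabilizer xy a #>\<^bsub>SL2Z\<^esub> h \<longleftrightarrow>
    pair_act xy g a = pair_act xy h a"
proof -
  obtain k where k: "det k = 1" "h ** k = mat 1"
    using SL2Z_inverse[OF assms(3)] by metis
  show ?thesis
    using rcos_eq_iff[OF stabilizer_subgroup[OF P] assms(2,3) k]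
      pair_act_eq_iff[OF P assms(2,3) k] assms k
    by (simp add: stabilizer_def det_mul)
qed

lemma stabilizer_in_subgroups:
  assumes xy: "xy \<in> transitive_pairs e B a" and B: "finite B" "a \<in> B"
  shows "stabilizer xy a \<in> SL2Z_subgroups e (card B)"
proof -
  note P = transitive_pairs_pairs[OF xy]
  let ?H = "stabilizer xy a"
  define q where "q b = ?H #>\<^bsub>SL2Z\<^esub> (SOME g. det g = 1 \<and> pair_act xy g a = b)" for b
  have q: "q (pair_act xy g a) = ?H #>\<^bsub>SL2Z\<^esub> g" if "det g = 1" for g
  proof -
    let ?g = "SOME g'. det g' = 1 \<and> pair_act xy g' a = pair_act xy g a"
    have "det ?g = 1 \<and> pair_act xy ?g a = pair_act xy g a"
      by (rule someI[of _ g]) (use that in simp)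
    then show ?thesis
      unfolding q_def using stabilizer_rcos_iff[OF P] that by blast
  qed
  have onto: "\<exists>g. det g = 1 \<and> b = pair_act xy g a" if "b \<in> B" for b
    using transitive_onto[OF xy B(2)] that by blast
  have "inj_on q B"
  proof (rule inj_onI)
    fix b c assume "b \<in> B" "c \<in> B" and eq: "q b = q c"
    then obtain g h where gh: "det g = 1" "b = pair_act xy g a" "det h = 1" "c = pair_act xy h a"
      using onto by blast
    then show "b = c"
      using eq q stabilizer_rcos_iff[OF P, of g h a] by simp
  qed
  moreover have "q ` B = rcosets\<^bsub>SL2Z\<^esub> ?H"
  proof
    show "q ` B \<subseteq> rcosets\<^bsub>SL2Z\<^esub> ?H"
      using onto q unfolding RCOSETS_def by fastforce
    show "rcosets\<^bsub>SL2Z\<^esub> ?H \<subseteq> q ` B"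
    proof
      fix C assume "C \<in> rcosets\<^bsub>SL2Z\<^esub> ?H"
      then obtain g where "det g = 1" "C = ?H #>\<^bsub>SL2Z\<^esub> g"
        by (auto simp: RCOSETS_def)
      then show "C \<in> q ` B"
        using q pair_act_in[OF P _ B(2)] by auto
    qed
  qed
  ultimately have "bij_betw q B (rcosets\<^bsub>SL2Z\<^esub> ?H)"
    by (simp add: bij_betw_def)
  moreover have "(mZ \<in> ?H) = e"
    using P B(2) pair_act_Z[OF P] by (auto simp: stabilizer_def amalgam_pairs_def)
  ultimately show ?thesis
    using stabilizer_subgroup[OF P] B(1)
    by (auto simp: SL2Z_subgroups_def bij_betw_finite bij_betw_same_card)
qed

text \<open>The permutation \<open>perm_of F B s\<close> is right translation by \<open>s\<close>, transported along a map \<open>F\<close>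
  whose fibres are the right cosets of a subgroup.\<close>

definition perm_of :: "(int ^ 2 ^ 2 \<Rightarrow> 'b) \<Rightarrow> 'b set \<Rightarrow> int ^ 2 ^ 2 \<Rightarrow> 'b \<Rightarrow> 'b" where
  "perm_of F B s b = (if b \<in> B then F ((SOME g. det g = 1 \<and> F g = b) ** s) else b)"

locale coset_labelling =
  fixes H :: "(int ^ 2 ^ 2) set" and B :: "'b set" and F :: "int ^ 2 ^ 2 \<Rightarrow> 'b" and a :: 'b
    and e :: bool
  assumes H: "subgroup H SL2Z" and B: "finite B" and onto: "F ` {g. det g = 1} = B"
    and F_eq: "\<And>g h. det g = 1 \<Longrightarrow> det h = 1 \<Longrightarrow>
      F g = F h \<longleftrightarrow> H #>\<^bsub>SL2Z\<^esub> g = H #>\<^bsub>SL2Z\<^esub> h"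
    and base: "F (mat 1) = a" and type: "(mZ \<in> H) = e"
begin

lemma perm_of_F:
  assumes "det g = 1" "det s = 1"
  shows "perm_of F B s (F g) = F (g ** s)"
proof -
  let ?g = "SOME g'. det g' = 1 \<and> F g' = F g"
  have g: "det ?g = 1 \<and> F ?g = F g"
    by (rule someI[of _ g]) (use assms in simp)
  then have "H #>\<^bsub>SL2Z\<^esub> ?g = H #>\<^bsub>SL2Z\<^esub> g"
    using F_eq assms by blast
  then have "H #>\<^bsub>SL2Z\<^esub> (?g ** s) = H #>\<^bsub>SL2Z\<^esub> (g ** s)"
    using SL2Z.coset_mult_assoc[OF subgroup.subset[OF H], of g s]
      SL2Z.coset_mult_assoc[OF subgroup.subset[OF H], of ?g s] g assms by simp
  then show ?thesis
    using g assms onto F_eq[of "?g ** s" "g ** s"] by (auto simp: perm_of_def det_mul)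
qed

lemma F_obtain:
  assumes "b \<in> B" obtains g where "det g = 1" "b = F g"
  using assms onto by blast

lemma F_in: "det g = 1 \<Longrightarrow> F g \<in> B"
  using onto by blast

lemma perm_of_permutes:
  assumes s: "det s = 1"
  shows "perm_of F B s permutes B"
proof (rule bij_imp_permutes)
  obtain k where k: "det k = 1" "s ** k = mat 1" "k ** s = mat 1"
    using SL2Z_inverse[OF s] .
  have "perm_of F B s ` B = B"
  proof
    show "perm_of F B s ` B \<subseteq> B"
      by (auto elim!: F_obtain simp: perm_of_F s F_in det_mul)
    show "B \<subseteq> perm_of F B s ` B"
    proof
      fix b assume "b \<in> B"
      then obtain g where g: "det g = 1" "b = F g" by (rule F_obtain)
      have "perm_of F B s (F (g ** k)) = b"
        using g s k by (simp add: perm_of_F det_mul matrix_mul_assoc[symmetric])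
      then show "b \<in> perm_of F B s ` B"
        using g k F_in[of "g ** k"] by (force simp: det_mul)
    qed
  qed
  then show "bij_betw (perm_of F B s) B B"
    using B by (simp add: bij_betw_def eq_card_imp_inj_on)
qed (simp add: perm_of_def)

definition xy where "xy = (perm_of F B mS, perm_of F B mU)"

lemma xy_pairs: "xy \<in> amalgam_pairs e B"
proof -
  let ?x = "perm_of F B mS" and ?y = "perm_of F B mU"
  have out: "?x b = b" "?y b = b" if "b \<notin> B" for b
    using that by (simp_all add: perm_of_def)
  have xx: "?x (?x (F g)) = F (g ** mZ)" and yyy: "?y (?y (?y (F g))) = F (g ** mZ)" if "det g = 1" for g
    using that by (simp_all add: perm_of_F det_mul matrix_mul_assoc[symmetric] mS_simps)
  have "?x \<circ> ?x = ?y \<circ> (?y \<circ> ?y)"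
  proof
    fix b show "(?x \<circ> ?x) b = (?y \<circ> (?y \<circ> ?y)) b"
      by (cases "b \<in> B") (auto elim!: F_obtain simp: xx yyy out)
  qed
  moreover have "(?x \<circ> ?x) \<circ> (?x \<circ> ?x) = id"
  proof
    fix b show "((?x \<circ> ?x) \<circ> (?x \<circ> ?x)) b = id b"
      by (cases "b \<in> B")
        (auto elim!: F_obtain simp: xx out det_mul matrix_mul_assoc[symmetric] mS_simps)
  qed
  moreover have "(?x (?x b) = b) = e" if b: "b \<in> B" for b
  proof -
    obtain g where g: "det g = 1" "b = F g" using b by (rule F_obtain)
    obtain k where k: "det k = 1" "g ** k = mat 1" "k ** g = mat 1"
      using SL2Z_inverse[OF g(1)] .
    have "g ** mZ = mZ ** g"
      by (rule mat2_cases[of g]) (simp add: mZ_def)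
    then have "g ** mZ ** k = mZ"
      using k by (simp add: matrix_mul_assoc[symmetric])
    then show ?thesis
      using xx[OF g(1)] F_eq[of "g ** mZ" g] rcos_eq_iff[OF H _ g(1) k(1,2), of "g ** mZ"] type g
      by (simp add: det_mul)
  qed
  ultimately show ?thesis
    using perm_of_permutes by (simp add: xy_def amalgam_pairs_def)
qed

lemma act_F:
  assumes "det g = 1" "det h = 1"
  shows "pair_act xy g (F h) = F (h ** g)"
  using assms(1)
proof (induction rule: SL2Z_induct)
  case one
  then show ?case by (simp add: pair_act_one[OF xy_pairs])
next
  case (S g)
  then show ?case
    using assms(2) pair_act_mult[OF xy_pairs, of g mS] pair_act_S[OF xy_pairs]
    by (simp add: xy_def perm_of_F det_mul matrix_mul_assoc)
next
  case (U g)
  then show ?case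
    using assms(2) pair_act_mult[OF xy_pairs, of g mU] pair_act_U[OF xy_pairs]
    by (simp add: xy_def perm_of_F det_mul matrix_mul_assoc)
qed

lemma act_base: "det g = 1 \<Longrightarrow> pair_act xy g a = F g"
  using act_F[of g "mat 1"] base by simp

lemma xy_transitive: "xy \<in> transitive_pairs e B a"
proof -
  have "C = B" if C: "C \<subseteq> B" "a \<in> C" "fst xy ` C \<subseteq> C" "snd xy ` C \<subseteq> C" for C
  proof -
    have "F g \<in> C" if "det g = 1" for g
      using amalgam_action.act_closed[OF amalgam_action_pair C(3,4) that C(2)] xy_pairs act_base[OF that]
      by (metis pair_act_def prod.collapse)
    then show ?thesis
      using C(1) onto by blast
  qed
  then show ?thesis
    using xy_pairs unfolding transitive_pairs_def by (simp add: case_prod_unfold)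
qed

lemma xy_stabilizer: "stabilizer xy a = H"
proof -
  have "F g = a \<longleftrightarrow> g \<in> H" if "det g = 1" for g
    using F_eq[of g "mat 1"] rcos_eq_iff[OF H that, of "mat 1" "mat 1"] that base by simp
  then have "g \<in> stabilizer xy a \<longleftrightarrow> g \<in> H" for g
    using act_base[of g] subgroup.mem_carrier[OF H, of g]
    by (cases "det g = 1") (auto simp add: stabilizer_def)
  then show ?thesis
    by blast
qed

end

lemma finite_amalgam_pairs: "finite A \<Longrightarrow> finite (amalgam_pairs e A)"
  by (rule finite_subset[of _ "{p. p permutes A} \<times> {p. p permutes A}"])
    (auto simp: amalgam_pairs_def finite_permutations)

lemma finite_transitive_pairs: "finite A \<Longrightarrow> finite (transitive_pairs e A a)"
  by (rule finite_subset[OF _ finite_amalgam_pairs]) (auto simp: transitive_pairs_def)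

lemma card_stabilizer_fibre:
  assumes H: "H \<in> SL2Z_subgroups e k" and B: "finite B" "card B = k" "a \<in> B"
  shows "card {xy \<in> transitive_pairs e B a. stabilizer xy a = H} = fact (k - 1)"
proof -
  have sub: "subgroup H SL2Z" and type: "(mZ \<in> H) = e"
    and fin: "finite (rcosets\<^bsub>SL2Z\<^esub> H)" "card (rcosets\<^bsub>SL2Z\<^esub> H) = k"
    using H by (auto simp: SL2Z_subgroups_def)
  have H1: "H #>\<^bsub>SL2Z\<^esub> mat 1 = H"
    using SL2Z.coset_mult_one[OF subgroup.subset[OF sub]] by simp
  have rc: "H #>\<^bsub>SL2Z\<^esub> g \<in> rcosets\<^bsub>SL2Z\<^esub> H" if "det g = 1" for g
    using that by (auto simp: RCOSETS_def)
  have rc': "\<exists>g. det g = 1 \<and> C = H #>\<^bsub>SL2Z\<^esub> g" if "C \<in> rcosets\<^bsub>SL2Z\<^esub> H" for C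
    using that by (auto simp: RCOSETS_def)
  obtain f1 where f1: "bij_betw f1 (rcosets\<^bsub>SL2Z\<^esub> H) B"
    using finite_same_card_bij[OF fin(1) B(1)] fin(2) B(2) by auto
  define f0 where "f0 = Transposition.transpose (f1 H) a \<circ> f1"
  have "f1 H \<in> B"
    using f1 rc[of "mat 1"] H1 by (auto simp: bij_betw_def)
  then have f0: "bij_betw f0 (rcosets\<^bsub>SL2Z\<^esub> H) B"
    unfolding f0_def
    by (intro bij_betw_trans[OF f1] permutes_imp_bij permutes_swap_id B(3))
  have f0_H: "f0 H = a"
    by (simp add: f0_def)
  define F where "F p g = p (f0 (H #>\<^bsub>SL2Z\<^esub> g))" for p :: "'a \<Rightarrow> 'a" and g
  have lab: "coset_labelling H B (F p) a e" if p: "p permutes (B - {a})" for p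
  proof (rule coset_labelling.intro)
    have pB: "p permutes B"
      using p by (rule permutes_subset) auto
    have img: "F p ` {g. det g = 1} = p ` f0 ` (rcosets\<^bsub>SL2Z\<^esub> H)"
    proof (intro subset_antisym subsetI)
      fix b assume "b \<in> F p ` {g. det g = 1}"
      then show "b \<in> p ` f0 ` (rcosets\<^bsub>SL2Z\<^esub> H)"
        using rc by (auto simp: F_def)
    next
      fix b assume "b \<in> p ` f0 ` (rcosets\<^bsub>SL2Z\<^esub> H)"
      then obtain C where "C \<in> rcosets\<^bsub>SL2Z\<^esub> H" "b = p (f0 C)"
        by blast
      then show "b \<in> F p ` {g. det g = 1}"
        using rc'[of C] by (auto simp: F_def)
    qed
    show "F p ` {g. det g = 1} = B"
      unfolding img using f0 permutes_image[OF pB] by (simp add: bij_betw_def)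
    show "F p (mat 1) = a"
      using p by (simp add: F_def H1 f0_H permutes_not_in)
    fix g h :: "int ^ 2 ^ 2" assume "det g = 1" "det h = 1"
    then show "F p g = F p h \<longleftrightarrow> H #>\<^bsub>SL2Z\<^esub> g = H #>\<^bsub>SL2Z\<^esub> h"
      using inj_on_eq_iff[OF bij_betw_imp_inj_on[OF f0] rc rc, of g h] injD[OF permutes_inj[OF pB]]
      unfolding F_def by metis
  qed (use sub type B in auto)
  define \<Psi> where "\<Psi> p = (perm_of (F p) B mS, perm_of (F p) B mU)" for p
  have \<Psi>: "\<Psi> p = coset_labelling.xy B (F p)" if p: "p permutes (B - {a})" for p
    using coset_labelling.xy_def[OF lab[OF p]] by (simp add: \<Psi>_def)
  have B_obtain: "\<exists>g. det g = 1 \<and> b = f0 (H #>\<^bsub>SL2Z\<^esub> g)" if b: "b \<in> B" for b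
  proof -
    obtain C where "C \<in> rcosets\<^bsub>SL2Z\<^esub> H" "b = f0 C"
      using b f0 by (auto simp: bij_betw_def)
    then show ?thesis using rc' by blast
  qed
  have "bij_betw \<Psi> {p. p permutes (B - {a})} {xy \<in> transitive_pairs e B a. stabilizer xy a = H}"
  proof (rule bij_betwI')
    fix p q assume p: "p \<in> {p. p permutes (B - {a})}" and q: "q \<in> {p. p permutes (B - {a})}"
    show "\<Psi> p = \<Psi> q \<longleftrightarrow> p = q"
    proof
      assume eq: "\<Psi> p = \<Psi> q"
      show "p = q"
      proof
        fix b show "p b = q b"
        proof (cases "b \<in> B")
          case True
          then obtain g where g: "det g = 1" "b = f0 (H #>\<^bsub>SL2Z\<^esub> g)"
            using B_obtain by blast
          have "F p g = F q g"
            using coset_labelling.act_base[OF lab[of p] g(1)] coset_labelling.act_base[OF lab[of q] g(1)]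
            p q eq \<Psi>[of p] \<Psi>[of q] by simp
          then show ?thesis
            by (simp add: F_def g)
        next
          case False
          then have "p b = b" "q b = b"
            using p q permutes_not_in[of _ "B - {a}" b] by simp_all
          then show ?thesis
            by simp
        qed
      qed
    qed simp
  next
    fix p assume "p \<in> {p. p permutes (B - {a})}"
    then have p: "p permutes (B - {a})" by simp
    show "\<Psi> p \<in> {xy \<in> transitive_pairs e B a. stabilizer xy a = H}"
      using coset_labelling.xy_transitive[OF lab[OF p]] coset_labelling.xy_stabilizer[OF lab[OF p]]
      by (simp add: \<Psi>[OF p])
  next
    fix xy assume "xy \<in> {xy \<in> transitive_pairs e B a. stabilizer xy a = H}"
    then have xy: "xy \<in> transitive_pairs e B a" and stab: "stabilizer xy a = H"
      by auto
    note P = transitive_pairs_pairs[OF xy]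
    define p where "p b = (if b \<in> B then pair_act xy (SOME g. det g = 1 \<and> f0 (H #>\<^bsub>SL2Z\<^esub> g) = b) a else b)" for b
    have p: "p (f0 (H #>\<^bsub>SL2Z\<^esub> g)) = pair_act xy g a" if g: "det g = 1" for g
    proof -
      let ?g = "SOME g'. det g' = 1 \<and> f0 (H #>\<^bsub>SL2Z\<^esub> g') = f0 (H #>\<^bsub>SL2Z\<^esub> g)"
      have g': "det ?g = 1 \<and> f0 (H #>\<^bsub>SL2Z\<^esub> ?g) = f0 (H #>\<^bsub>SL2Z\<^esub> g)"
        by (rule someI[of _ g]) (use g in simp)
      then have "H #>\<^bsub>SL2Z\<^esub> ?g = H #>\<^bsub>SL2Z\<^esub> g"
        using inj_on_eq_iff[OF bij_betw_imp_inj_on[OF f0] rc rc, of ?g g] g by simp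
      then have "pair_act xy ?g a = pair_act xy g a"
        using stabilizer_rcos_iff[OF P, of ?g g a] stab g g' by simp
      moreover have "f0 (H #>\<^bsub>SL2Z\<^esub> g) \<in> B"
        using f0 rc[OF g] by (auto simp: bij_betw_def)
      ultimately show ?thesis
        by (simp add: p_def)
    qed
    have "p ` B = (\<lambda>g. pair_act xy g a) ` {g. det g = 1}"
    proof
      show "p ` B \<subseteq> (\<lambda>g. pair_act xy g a) ` {g. det g = 1}"
        using B_obtain p by force
      show "(\<lambda>g. pair_act xy g a) ` {g. det g = 1} \<subseteq> p ` B"
      proof clarsimp
        fix g :: "int ^ 2 ^ 2" assume g: "det g = 1"
        have "f0 (H #>\<^bsub>SL2Z\<^esub> g) \<in> B"
          using f0 rc[OF g] by (auto simp: bij_betw_def)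
        then show "pair_act xy g a \<in> p ` B"
          using p[OF g] by (metis image_eqI)
      qed
    qed
    also have "\<dots> = B"
      by (rule transitive_onto[OF xy B(3)])
    finally have "bij_betw p B B"
      using B(1) by (simp add: bij_betw_def eq_card_imp_inj_on)
    then have pB: "p permutes B"
      by (rule bij_imp_permutes) (simp add: p_def)
    have pa: "p a = a"
      using p[of "mat 1"] by (simp add: H1 f0_H pair_act_one[OF P])
    have pBa: "p permutes (B - {a})"
      using permutes_superset[OF pB, of "B - {a}"] pa by auto
    have F: "F p g = pair_act xy g a" if "det g = 1" for g
      using p[OF that] by (simp add: F_def)
    have perm: "perm_of (F p) B s = (\<lambda>b. pair_act xy s b)"
      if s: "det s = 1" "pair_act xy s permutes B" for s
    proof
      fix b show "perm_of (F p) B s b = pair_act xy s b"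
      proof (cases "b \<in> B")
        case True
        then obtain g where g: "det g = 1" "b = pair_act xy g a"
          using transitive_onto[OF xy B(3)] by blast
        have "perm_of (F p) B s (F p g) = F p (g ** s)"
          by (rule coset_labelling.perm_of_F[OF lab[OF pBa] g(1) s(1)])
        then show ?thesis
          using g s by (simp add: F det_mul pair_act_mult[OF P])
      next
        case False
        then show ?thesis
          using s(2) by (simp add: perm_of_def permutes_not_in)
      qed
    qed
    have "\<Psi> p = xy"
      using P perm[of mS] perm[of mU] unfolding \<Psi>_def pair_act_S[OF P] pair_act_U[OF P]
      by (cases xy) (simp add: amalgam_pairs_def)
    then show "\<exists>p\<in>{p. p permutes (B - {a})}. xy = \<Psi> p"
      using pBa by blast
  qed
  then have "card {xy \<in> transitive_pairs e B a. stabilizer xy a = H} = card {p. p permutes (B - {a})}"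
    by (simp add: bij_betw_same_card)
  also have "\<dots> = fact (k - 1)"
    using B by (simp add: card_permutations)
  finally show ?thesis .
qed

lemma SL2Z_subgroups_eq_stabilizers:
  assumes "finite B" "a \<in> B"
  shows "SL2Z_subgroups e (card B) = (\<lambda>xy. stabilizer xy a) ` transitive_pairs e B a"
proof
  show "(\<lambda>xy. stabilizer xy a) ` transitive_pairs e B a \<subseteq> SL2Z_subgroups e (card B)"
    using stabilizer_in_subgroups[OF _ assms] by auto
  show "SL2Z_subgroups e (card B) \<subseteq> (\<lambda>xy. stabilizer xy a) ` transitive_pairs e B a"
  proof
    fix H assume "H \<in> SL2Z_subgroups e (card B)"
    from card_stabilizer_fibre[OF this assms(1) refl assms(2)]
    have "card {xy \<in> transitive_pairs e B a. stabilizer xy a = H} \<noteq> 0"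
      by simp
    then have "{xy \<in> transitive_pairs e B a. stabilizer xy a = H} \<noteq> {}"
      by (metis card.empty)
    then show "H \<in> (\<lambda>xy. stabilizer xy a) ` transitive_pairs e B a"
      by blast
  qed
qed

lemma card_transitive_pairs:
  assumes "finite B" "a \<in> B"
  shows "card (transitive_pairs e B a) = fact (card B - 1) * card (SL2Z_subgroups e (card B))"
proof -
  have "card (transitive_pairs e B a) =
      (\<Sum>H\<in>SL2Z_subgroups e (card B). \<Sum>xy\<in>{xy \<in> transitive_pairs e B a. stabilizer xy a = H}. 1)"
    unfolding SL2Z_subgroups_eq_stabilizers[OF assms]
    by (subst sum.group) (auto simp: finite_transitive_pairs assms)
  also have "\<dots> = (\<Sum>H\<in>SL2Z_subgroups e (card B). fact (card B - 1))"
    by (intro sum.cong refl) (simp add: card_stabilizer_fibre[OF _ assms(1) refl assms(2)])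
  finally show ?thesis
    by simp
qed

lemma num_subgroups_SL2Z:
  assumes "n > 0"
  shows "num_subgroups SL2Z n = card (SL2Z_subgroups True n) + card (SL2Z_subgroups False n)"
proof -
  have fin: "finite (SL2Z_subgroups e n)" for e
    using SL2Z_subgroups_eq_stabilizers[of "{..<n}" 0 e] assms finite_transitive_pairs[of "{..<n}" e 0]
    by simp
  have "{H. subgroup H SL2Z \<and> finite (rcosets\<^bsub>SL2Z\<^esub> H) \<and> card (rcosets\<^bsub>SL2Z\<^esub> H) = n} =
      SL2Z_subgroups True n \<union> SL2Z_subgroups False n"
    by (auto simp: SL2Z_subgroups_def)
  moreover have "SL2Z_subgroups True n \<inter> SL2Z_subgroups False n = {}"
    by (auto simp: SL2Z_subgroups_def)
  ultimately show ?thesis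
    unfolding num_subgroups_def by (simp add: card_Un_disjoint fin)
qed

lemma permutes_comp_disjoint:
  assumes "x permutes B" "x' permutes C" "B \<inter> C = {}"
  shows "(x \<circ> x') b = (if b \<in> B then x b else x' b)"
  using assms by (auto simp: permutes_not_in disjoint_iff dest: permutes_in_image[of x' C b])
    (metis permutes_in_image permutes_not_in)+

lemma amalgam_pairs_union:
  assumes "(x, y) \<in> amalgam_pairs e B" "(x', y') \<in> amalgam_pairs e C" "B \<inter> C = {}"
  shows "(x \<circ> x', y \<circ> y') \<in> amalgam_pairs e (B \<union> C)"
proof -
  have p: "x permutes B" "y permutes B" "x' permutes C" "y' permutes C"
    using assms by (auto simp: amalgam_pairs_def)
  note x = permutes_comp_disjoint[OF p(1,3) assms(3)]
  note y = permutes_comp_disjoint[OF p(2,4) assms(3)]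
  have B: "x b \<in> B \<longleftrightarrow> b \<in> B" "y b \<in> B \<longleftrightarrow> b \<in> B" for b
    using p by (simp_all add: permutes_in_image)
  have C: "x' b \<in> B \<longleftrightarrow> b \<in> B" "y' b \<in> B \<longleftrightarrow> b \<in> B" for b
    using p assms(3) by (metis disjoint_iff permutes_in_image permutes_not_in)+
  have r: "x (x b) = y (y (y b))" "x (x (x (x b))) = b" "x' (x' b) = y' (y' (y' b))" "x' (x' (x' (x' b))) = b" for b
    using assms(1,2) by (auto simp: amalgam_pairs_def fun_eq_iff)
  have t: "b \<in> B \<Longrightarrow> (x (x b) = b) = e" "b \<in> C \<Longrightarrow> (x' (x' b) = b) = e" for b
    using assms(1,2) by (auto simp: amalgam_pairs_def)
  have "x \<circ> x' permutes B \<union> C" "y \<circ> y' permutes B \<union> C"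
    using p by (auto intro!: permutes_compose intro: permutes_subset)
  moreover have "(x \<circ> x') ((x \<circ> x') b) = (y \<circ> y') ((y \<circ> y') ((y \<circ> y') b))" for b
    unfolding x y by (simp add: B C r(1,3))
  moreover have "(x \<circ> x') ((x \<circ> x') ((x \<circ> x') ((x \<circ> x') b))) = b" for b
    unfolding x by (simp add: B C r(2,4))
  moreover have "((x \<circ> x') ((x \<circ> x') b) = b) = e" if "b \<in> B \<union> C" for b
    unfolding x using that t by (auto simp: B C)
  ultimately show ?thesis
    unfolding amalgam_pairs_def mem_Collect_eq prod.case fun_eq_iff by simp
qed

lemma permutes_restrict_invariant:
  assumes "x permutes A" "finite B" "x ` B \<subseteq> B"
  shows "restrict_id x B permutes B" "B \<subseteq> A \<Longrightarrow> restrict_id x (A - B) permutes (A - B)"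
proof -
  have inj: "inj x"
    using assms(1) by (rule permutes_inj)
  have inj_on: "inj_on x C" for C
    using inj by (rule inj_on_subset) simp
  have xB: "x ` B = B"
    by (rule endo_inj_surj[OF assms(2,3) inj_on])
  then show "restrict_id x B permutes B"
    using inj by (intro permutes_restrict_id) (simp add: bij_betw_def inj_on)
  assume "B \<subseteq> A"
  have "x ` (A - B) = A - B"
    using xB permutes_image[OF assms(1)] inj by (simp add: image_set_diff)
  then show "restrict_id x (A - B) permutes (A - B)"
    using inj by (intro permutes_restrict_id) (simp add: bij_betw_def inj_on)
qed

lemma amalgam_pairs_restrict:
  assumes "(x, y) \<in> amalgam_pairs e A" "C \<subseteq> A" "restrict_id x C permutes C" "restrict_id y C permutes C"
  shows "(restrict_id x C, restrict_id y C) \<in> amalgam_pairs e C"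
proof -
  have C: "x b \<in> C" "y b \<in> C" if "b \<in> C" for b
    using permutes_in_image[OF assms(3), of b] permutes_in_image[OF assms(4), of b] that
    by (simp_all add: restrict_id_def)
  have r: "x (x b) = y (y (y b))" "x (x (x (x b))) = b" for b
    using assms(1) by (auto simp: amalgam_pairs_def fun_eq_iff)
  have "restrict_id x C (restrict_id x C b) = restrict_id y C (restrict_id y C (restrict_id y C b))" for b
    by (auto simp: restrict_id_def C r(1))
  moreover have "restrict_id x C (restrict_id x C (restrict_id x C (restrict_id x C b))) = b" for b
    by (auto simp: restrict_id_def C r(2))
  moreover have "(restrict_id x C (restrict_id x C b) = b) = e" if "b \<in> C" for b
    using assms(1,2) that by (auto simp: restrict_id_def C amalgam_pairs_def)
  ultimately show ?thesis
    using assms(3,4) unfolding amalgam_pairs_def mem_Collect_eq prod.case fun_eq_iff by simp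
qed

lemma card_amalgam_pairs_orbit:
  fixes A :: "'a set"
  assumes A: "finite A" "a \<in> A"
  shows "card (amalgam_pairs e A) =
    (\<Sum>B | B \<subseteq> A \<and> a \<in> B. card (transitive_pairs e B a) * card (amalgam_pairs e (A - B)))"
proof -
  define D where "D = (SIGMA B : {B. B \<subseteq> A \<and> a \<in> B}. transitive_pairs e B a \<times> amalgam_pairs e (A - B))"
  define \<Psi> :: "'a set \<times> (('a \<Rightarrow> 'a) \<times> ('a \<Rightarrow> 'a)) \<times> (('a \<Rightarrow> 'a) \<times> ('a \<Rightarrow> 'a)) \<Rightarrow> _"
    where "\<Psi> = (\<lambda>(B, (x, y), (x', y')). (x \<circ> x', y \<circ> y'))"
  have inj: "inj_on \<Psi> D"
  proof (rule inj_onI)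
    fix u v assume uv: "u \<in> D" "v \<in> D" and eq: "\<Psi> u = \<Psi> v"
    obtain B x y x' y' where u: "u = (B, (x, y), (x', y'))"
      by (metis prod.collapse)
    obtain C r s r' s' where v: "v = (C, (r, s), (r', s'))"
      by (metis prod.collapse)
    have B: "B \<subseteq> A" "a \<in> B" "(x, y) \<in> transitive_pairs e B a" "(x', y') \<in> amalgam_pairs e (A - B)"
      and C: "C \<subseteq> A" "a \<in> C" "(r, s) \<in> transitive_pairs e C a" "(r', s') \<in> amalgam_pairs e (A - C)"
      using uv by (auto simp: u v D_def)
    have pB: "x permutes B" "y permutes B" "x' permutes (A - B)" "y' permutes (A - B)"
      and pC: "r permutes C" "s permutes C" "r' permutes (A - C)" "s' permutes (A - C)"
      using B C by (auto simp: transitive_pairs_def amalgam_pairs_def)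
    have d: "B \<inter> (A - B) = {}" "C \<inter> (A - C) = {}"
      by auto
    have eq2: "(x \<circ> x') b = (r \<circ> r') b" "(y \<circ> y') b = (s \<circ> s') b" for b
      using eq by (simp_all only: \<Psi>_def u v prod.case prod.inject)
    have eq': "(if b \<in> B then x b else x' b) = (if b \<in> C then r b else r' b)"
      "(if b \<in> B then y b else y' b) = (if b \<in> C then s b else s' b)" for b
      using eq2[of b] by (simp_all only: permutes_comp_disjoint[OF pB(1,3) d(1)]
        permutes_comp_disjoint[OF pB(2,4) d(1)] permutes_comp_disjoint[OF pC(1,3) d(2)]
        permutes_comp_disjoint[OF pC(2,4) d(2)])
    have inB: "x b \<in> B" "y b \<in> B" if "b \<in> B" for b
      using that pB by (simp_all add: permutes_in_image)
    have inC: "r b \<in> C" "s b \<in> C" if "b \<in> C" for b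
      using that pC by (simp_all add: permutes_in_image)
    have eqBC: "x b = r b" "y b = s b" if "b \<in> B \<inter> C" for b
      using eq'[of b] that by simp_all
    have "B \<inter> C = B"
    proof -
      have "x ` (B \<inter> C) \<subseteq> B \<inter> C" "y ` (B \<inter> C) \<subseteq> B \<inter> C"
        using inB inC eqBC by fastforce+
      then show ?thesis
        using B(2,3) C(2) unfolding transitive_pairs_def by blast
    qed
    moreover have "B \<inter> C = C"
    proof -
      have "r ` (B \<inter> C) \<subseteq> B \<inter> C" "s ` (B \<inter> C) \<subseteq> B \<inter> C"
        using inB inC eqBC by fastforce+
      then show ?thesis
        using B(2) C(2,3) unfolding transitive_pairs_def by blast
    qed
    ultimately have BC: "B = C"
      by simp
    have "x b = r b \<and> y b = s b \<and> x' b = r' b \<and> y' b = s' b" for b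
      using eq'[of b] pB pC unfolding BC by (cases "b \<in> C") (auto simp: permutes_not_in)
    then show "u = v"
      unfolding u v BC by (simp add: fun_eq_iff)
  qed
  have img: "\<Psi> ` D = amalgam_pairs e A"
  proof
    show "\<Psi> ` D \<subseteq> amalgam_pairs e A"
    proof
      fix w assume "w \<in> \<Psi> ` D"
      then obtain B x y x' y' where B: "B \<subseteq> A" "(x, y) \<in> amalgam_pairs e B"
          "(x', y') \<in> amalgam_pairs e (A - B)" "w = (x \<circ> x', y \<circ> y')"
        by (auto simp: D_def \<Psi>_def transitive_pairs_def)
      then show "w \<in> amalgam_pairs e A"
        using amalgam_pairs_union[OF B(2,3)] by (simp add: Un_absorb1)
    qed
    show "amalgam_pairs e A \<subseteq> \<Psi> ` D"
    proof
      fix w assume w: "w \<in> amalgam_pairs e A"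
      obtain x y where xy: "w = (x, y)" by (cases w)
      have p: "x permutes A" "y permutes A"
        using w by (auto simp: xy amalgam_pairs_def)
      define B where "B = \<Inter>{C. C \<subseteq> A \<and> a \<in> C \<and> x ` C \<subseteq> C \<and> y ` C \<subseteq> C}"
      have AC: "A \<in> {C. C \<subseteq> A \<and> a \<in> C \<and> x ` C \<subseteq> C \<and> y ` C \<subseteq> C}"
        using A p by (auto simp: permutes_in_image)
      have BA: "B \<subseteq> A" "a \<in> B" "x ` B \<subseteq> B" "y ` B \<subseteq> B"
        using Inter_lower[OF AC] by (auto simp: B_def image_subset_iff)
      have least: "B \<subseteq> C" if "C \<subseteq> A" "a \<in> C" "x ` C \<subseteq> C" "y ` C \<subseteq> C" for C
        using that unfolding B_def by (intro Inter_lower) simp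
      have fB: "finite B"
        using BA(1) A(1) by (rule finite_subset)
      note rx = permutes_restrict_invariant[OF p(1) fB BA(3)] permutes_restrict_invariant(2)[OF p(1) fB BA(3) BA(1)]
      note ry = permutes_restrict_invariant[OF p(2) fB BA(4)] permutes_restrict_invariant(2)[OF p(2) fB BA(4) BA(1)]
      have 1: "(restrict_id x B, restrict_id y B) \<in> amalgam_pairs e B"
        using w unfolding xy by (rule amalgam_pairs_restrict) (use BA rx ry in auto)
      have 2: "(restrict_id x (A - B), restrict_id y (A - B)) \<in> amalgam_pairs e (A - B)"
        using w unfolding xy by (rule amalgam_pairs_restrict) (use BA rx ry in auto)
      have "C = B" if C: "C \<subseteq> B" "a \<in> C" "restrict_id x B ` C \<subseteq> C" "restrict_id y B ` C \<subseteq> C" for C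
      proof -
        have "restrict_id x B ` C = x ` C" "restrict_id y B ` C = y ` C"
          using C(1) by (auto simp: restrict_id_def image_iff)
        then show ?thesis
          using least[of C] C BA by auto
      qed
      then have "(restrict_id x B, restrict_id y B) \<in> transitive_pairs e B a"
        using 1 unfolding transitive_pairs_def by simp
      moreover have "\<Psi> (B, (restrict_id x B, restrict_id y B), (restrict_id x (A - B), restrict_id y (A - B))) = w"
        unfolding \<Psi>_def xy prod.case prod.inject fun_eq_iff
        using permutes_comp_disjoint[OF rx(1,3)] permutes_comp_disjoint[OF ry(1,3)] p
        by (auto simp: restrict_id_def permutes_not_in)
      ultimately show "w \<in> \<Psi> ` D"
        using 2 BA by (force simp: D_def)
    qed
  qed
  have "card (amalgam_pairs e A) = card D"
    using card_image[OF inj] img by simp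
  also have "\<dots> = (\<Sum>B | B \<subseteq> A \<and> a \<in> B. card (transitive_pairs e B a \<times> amalgam_pairs e (A - B)))"
    unfolding D_def
    using A finite_subset[OF _ A(1)]
    by (intro card_SigmaI) (auto simp: finite_transitive_pairs finite_amalgam_pairs)
  finally show ?thesis
    by (simp add: card_cartesian_product)
qed

section \<open>Counting pairs of permutations\<close>

definition roots :: "bool \<Rightarrow> nat \<Rightarrow> 'a set \<Rightarrow> ('a \<Rightarrow> 'a) \<Rightarrow> ('a \<Rightarrow> 'a) set" where
  "roots q m A z = {x. x permutes A \<and> x ^^ m = z \<and> (q \<or> (\<forall>b\<in>A. x b \<noteq> b))}"

lemma finite_roots: "finite A \<Longrightarrow> finite (roots q m A z)"
  by (rule finite_subset[of _ "{p. p permutes A}"]) (auto simp: roots_def finite_permutations)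

lemma card_roots_split:
  assumes "finite A" "a \<in> A"
  shows "card {x \<in> roots q m A z. P x} = (\<Sum>b\<in>A. card {x \<in> roots q m A z. P x \<and> x a = b})"
proof -
  have "card {x \<in> roots q m A z. P x} =
      (\<Sum>b\<in>A. \<Sum>x\<in>{x \<in> {x \<in> roots q m A z. P x}. x a = b}. 1)"
    using assms by (subst sum.group) (simp_all add: finite_roots, auto simp: roots_def permutes_in_image)
  then show ?thesis
    by (simp add: conj_ac)
qed

lemma funpow_permutes_in: "c permutes C \<Longrightarrow> (c ^^ m) b \<in> C \<longleftrightarrow> b \<in> C"
  by (induction m) (simp_all add: permutes_in_image)

lemma funpow_comp_disjoint:
  assumes "c permutes C" "x permutes D" "C \<inter> D = {}"
  shows "((c \<circ> x) ^^ m) b = (if b \<in> C then (c ^^ m) b else (x ^^ m) b)"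
proof (induction m)
  case (Suc m)
  have "(x ^^ m) b \<notin> C" if "b \<notin> C"
    using permutes_funpow[OF assms(2), of m] that assms(3)
    by (cases "b \<in> D") (auto simp: permutes_not_in permutes_in_image disjoint_iff)
  then show ?case
    using Suc funpow_permutes_in[OF assms(1), of m b]
    by (simp only: funpow.simps comp_apply[of _ "_ ^^ m"] permutes_comp_disjoint[OF assms]) auto
qed simp

lemma card_roots_cut:
  assumes A: "finite A" "C \<subseteq> A" and c: "c permutes C" "\<And>b. b \<in> C \<Longrightarrow> (c ^^ m) b = z b"
    and q: "q \<or> (\<forall>b\<in>C. c b \<noteq> b)"
    and z: "z permutes A"
  shows "card {x \<in> roots q m A z. \<forall>b\<in>C. x b = c b} = card (roots q m (A - C) (restrict_id z (A - C)))"
proof -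
  have d: "C \<inter> (A - C) = {}" by auto
  have "bij_betw (\<lambda>x. c \<circ> x) (roots q m (A - C) (restrict_id z (A - C)))
      {x \<in> roots q m A z. \<forall>b\<in>C. x b = c b}"
  proof (rule bij_betwI')
    fix x y
    show "c \<circ> x = c \<circ> y \<longleftrightarrow> x = y"
      using permutes_inj[OF c(1)] by (simp add: fun.inj_map_strong fun_eq_iff inj_eq)
  next
    fix x assume x: "x \<in> roots q m (A - C) (restrict_id z (A - C))"
    then have p: "x permutes (A - C)" by (simp add: roots_def)
    note cx = permutes_comp_disjoint[OF c(1) p d]
    have "c \<circ> x permutes A"
      using p A by (intro permutes_compose permutes_subset[OF c(1)] permutes_subset[OF p]) auto
    moreover have "((c \<circ> x) ^^ m) b = z b" for b
      using x c(2) z A(2) unfolding funpow_comp_disjoint[OF c(1) p d]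
      by (auto simp: roots_def restrict_id_def permutes_not_in)
    moreover have "q \<or> (\<forall>b\<in>A. (c \<circ> x) b \<noteq> b)"
      using q x unfolding cx by (auto simp: roots_def)
    moreover have "\<forall>b\<in>C. (c \<circ> x) b = c b"
      unfolding cx by simp
    ultimately show "c \<circ> x \<in> {x \<in> roots q m A z. \<forall>b\<in>C. x b = c b}"
      by (auto simp: roots_def)
  next
    fix x assume "x \<in> {x \<in> roots q m A z. \<forall>b\<in>C. x b = c b}"
    then have x: "x permutes A" "x ^^ m = z" "q \<or> (\<forall>b\<in>A. x b \<noteq> b)" "\<And>b. b \<in> C \<Longrightarrow> x b = c b"
      by (auto simp: roots_def)
    define y where "y = restrict_id x (A - C)"
    have "x ` C \<subseteq> C"
      using x(4) c(1) by (auto simp: permutes_in_image)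
    then have p: "y permutes (A - C)"
      unfolding y_def using A x(1) finite_subset[OF A(2,1)] by (intro permutes_restrict_invariant(2))
    note cy = permutes_comp_disjoint[OF c(1) p d]
    have cyx: "c \<circ> y = x"
    proof
      fix b show "(c \<circ> y) b = x b"
        unfolding cy using x(1,4) by (auto simp: y_def restrict_id_def permutes_not_in)
    qed
    have "(y ^^ m) b = restrict_id z (A - C) b" for b
    proof (cases "b \<in> A - C")
      case True
      then show ?thesis
        using funpow_comp_disjoint[OF c(1) p d, of m b] cyx x(2) by simp
    next
      case False
      then show ?thesis
        using p by (induction m) (auto simp: permutes_not_in)
    qed
    moreover have "q \<or> (\<forall>b\<in>A - C. y b \<noteq> b)"
      using x(3) by (auto simp: y_def)
    ultimately have "y \<in> roots q m (A - C) (restrict_id z (A - C))"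
      using p by (auto simp: roots_def)
    then show "\<exists>y\<in>roots q m (A - C) (restrict_id z (A - C)). x = c \<circ> y"
      using cyx by blast
  qed
  then show ?thesis
    by (simp add: bij_betw_same_card)
qed

lemma card_roots_cut_cycle:
  assumes "finite A" "set cs \<subseteq> A" "z permutes A"
    and "\<And>b. b \<in> set cs \<Longrightarrow> (cycle_of_list cs ^^ m) b = z b"
  shows "card {x \<in> roots True m A z. \<forall>b\<in>set cs. x b = cycle_of_list cs b} =
    card (roots True m (A - set cs) (restrict_id z (A - set cs)))"
  using card_roots_cut[OF assms(1,2) cycle_permutes assms(4), of True] assms(3) by simp

lemma restrict_id_id: "restrict_id (\<lambda>d. d) A = (\<lambda>d. d)"
  by (auto simp: restrict_id_def)

lemma roots_empty: "roots q m {} (\<lambda>d. d) = {\<lambda>d. d}"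
proof -
  have "((\<lambda>d. d) ^^ m) = (\<lambda>d. d)"
    by (induction m) (auto simp: fun_eq_iff)
  then show ?thesis
    by (auto simp: roots_def permutes_def fun_eq_iff)
qed

lemma permutes_ident: "(\<lambda>d. d) permutes A"
  using permutes_id[of A] by (simp add: id_def)

lemma funpow_ident: "((\<lambda>d. d) ^^ m) b = b"
  by (induction m) auto

lemmas card_roots_id_cut = card_roots_cut[where z = "\<lambda>d. d", unfolded restrict_id_id, OF _ _ _ _ _ permutes_ident]

fun invs :: "nat \<Rightarrow> nat" where
  "invs 0 = 1" | "invs (Suc 0) = 1"
| "invs (Suc (Suc n)) = invs (Suc n) + (n + 1) * invs n"

fun cubics :: "nat \<Rightarrow> nat" where
  "cubics 0 = 1" | "cubics (Suc 0) = 1" | "cubics (Suc (Suc 0)) = 1"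
| "cubics (Suc (Suc (Suc n))) = cubics (Suc (Suc n)) + (n + 2) * (n + 1) * cubics n"

fun free_invs :: "nat \<Rightarrow> nat" where
  "free_invs 0 = 1" | "free_invs (Suc 0) = 0"
| "free_invs (Suc (Suc n)) = (n + 1) * free_invs n"

fun sq_roots :: "nat \<Rightarrow> nat" where
  "sq_roots n = (if n = 0 then 1 else if n < 4 then 0 else (n - 2) * sq_roots (n - 4))"

fun cub_roots :: "nat \<Rightarrow> nat" where
  "cub_roots n = (if n < 2 then 1 else
     cub_roots (n - 2) + (if n < 6 then 0 else (n - 2) * (n - 4) * cub_roots (n - 6)))"

declare sq_roots.simps [simp del] cub_roots.simps [simp del]

lemma invs_rec: "n > 0 \<Longrightarrow> invs n = invs (n - 1) + (n - 1) * invs (n - 2)"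
  by (cases n rule: invs.cases) auto

lemma free_invs_rec: "n > 0 \<Longrightarrow> free_invs n = (n - 1) * free_invs (n - 2)"
  by (cases n rule: free_invs.cases) auto

lemma cubics_rec: "n > 0 \<Longrightarrow> cubics n = cubics (n - 1) + (n - 1) * ((n - 2) * cubics (n - 3))"
  by (cases n rule: cubics.cases) (auto simp: algebra_simps)

lemma roots2_iff: "x \<in> roots q 2 A z \<longleftrightarrow> x permutes A \<and> (\<forall>b. x (x b) = z b) \<and> (q \<or> (\<forall>b\<in>A. x b \<noteq> b))"
  by (simp add: roots_def fun_eq_iff numeral_2_eq_2)

lemma roots3_iff: "x \<in> roots q 3 A z \<longleftrightarrow> x permutes A \<and> (\<forall>b. x (x (x b)) = z b) \<and> (q \<or> (\<forall>b\<in>A. x b \<noteq> b))"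
  by (simp add: roots_def fun_eq_iff numeral_3_eq_3)

lemma card_roots_fixed:
  assumes A: "finite A" "a \<in> A"
  shows "card {x \<in> roots True m A (\<lambda>d. d). x a = a} = card (roots True m (A - {a}) (\<lambda>d. d))"
  using card_roots_id_cut[of A "{a}" "\<lambda>d. d" m True] A by (simp add: permutes_ident funpow_ident)

lemma card_roots_transpose:
  assumes A: "finite A" "a \<in> A" "b \<in> A" "b \<noteq> a"
  shows "card {x \<in> roots q 2 A (\<lambda>d. d). x a = b} = card (roots q 2 (A - {a, b}) (\<lambda>d. d))"
proof -
  have "{x \<in> roots q 2 A (\<lambda>d. d). x a = b} =
      {x \<in> roots q 2 A (\<lambda>d. d). \<forall>d\<in>{a, b}. x d = Transposition.transpose a b d}"
    using A by (auto simp: roots2_iff)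
  also have "card \<dots> = card (roots q 2 (A - {a, b}) (\<lambda>d. d))"
    using A by (intro card_roots_id_cut) (auto intro: permutes_swap_id simp: numeral_2_eq_2)
  finally show ?thesis .
qed

lemma card_involutions:
  assumes "finite A"
  shows "card (roots True 2 A (\<lambda>d. d)) = invs (card A)"
  using assms
proof (induction "card A" arbitrary: A rule: less_induct)
  case less
  show ?case
  proof (cases "A = {}")
    case True
    then show ?thesis by (simp add: roots_empty)
  next
    case False
    then obtain a where a: "a \<in> A" by blast
    have "card (roots True 2 A (\<lambda>d. d)) = (\<Sum>b\<in>A. card {x \<in> roots True 2 A (\<lambda>d. d). x a = b})"
      using card_roots_split[OF less.prems a, of True 2 "\<lambda>d. d" "\<lambda>_. True"] by simp
    also have "\<dots> = card {x \<in> roots True 2 A (\<lambda>d. d). x a = a} +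
        (\<Sum>b\<in>A - {a}. card {x \<in> roots True 2 A (\<lambda>d. d). x a = b})"
      using less.prems a by (simp add: sum.remove)
    also have "card {x \<in> roots True 2 A (\<lambda>d. d). x a = a} = invs (card A - 1)"
      using less.prems a less.hyps[of "A - {a}"]
      card_Diff1_less[of A a] by (simp add: card_roots_fixed)
    also have "(\<Sum>b\<in>A - {a}. card {x \<in> roots True 2 A (\<lambda>d. d). x a = b}) =
        (\<Sum>b\<in>A - {a}. invs (card A - 2))"
    proof (rule sum.cong[OF refl])
      fix b assume b: "b \<in> A - {a}"
      have "card (A - {a, b}) = card A - 2"
        using b a less.prems by (auto simp: card_Diff_subset)
      moreover have "card A \<ge> 2"
        using b a less.prems card_mono[of A "{a, b}"] by auto
      ultimately show "card {x \<in> roots True 2 A (\<lambda>d. d). x a = b} = invs (card A - 2)"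
        using b a less.prems less.hyps[of "A - {a, b}"] by (simp add: card_roots_transpose)
    qed
    also have "\<dots> = (card A - 1) * invs (card A - 2)"
      using a less.prems by simp
    finally show ?thesis
      using invs_rec[of "card A"] card_gt_0_iff[of A] less.prems False by simp
  qed
qed

lemma card_free_involutions:
  assumes "finite A"
  shows "card (roots False 2 A (\<lambda>d. d)) = free_invs (card A)"
  using assms
proof (induction "card A" arbitrary: A rule: less_induct)
  case less
  show ?case
  proof (cases "A = {}")
    case True
    then show ?thesis by (simp add: roots_empty)
  next
    case False
    then obtain a where a: "a \<in> A" by blast
    have "card (roots False 2 A (\<lambda>d. d)) = (\<Sum>b\<in>A. card {x \<in> roots False 2 A (\<lambda>d. d). x a = b})"
      using card_roots_split[OF less.prems a, of False 2 "\<lambda>d. d" "\<lambda>_. True"] by simp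
    also have "\<dots> = card {x \<in> roots False 2 A (\<lambda>d. d). x a = a} +
        (\<Sum>b\<in>A - {a}. card {x \<in> roots False 2 A (\<lambda>d. d). x a = b})"
      using less.prems a by (simp add: sum.remove)
    also have "{x \<in> roots False 2 A (\<lambda>d. d). x a = a} = {}"
      using a by (auto simp: roots2_iff)
    also have "(\<Sum>b\<in>A - {a}. card {x \<in> roots False 2 A (\<lambda>d. d). x a = b}) =
        (\<Sum>b\<in>A - {a}. free_invs (card A - 2))"
    proof (rule sum.cong[OF refl])
      fix b assume b: "b \<in> A - {a}"
      have "card (A - {a, b}) = card A - 2"
        using b a less.prems by (auto simp: card_Diff_subset)
      moreover have "card A \<ge> 2"
        using b a less.prems card_mono[of A "{a, b}"] by auto
      ultimately show "card {x \<in> roots False 2 A (\<lambda>d. d). x a = b} = free_invs (card A - 2)"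
        using b a less.prems less.hyps[of "A - {a, b}"] by (simp add: card_roots_transpose)
    qed
    also have "\<dots> = (card A - 1) * free_invs (card A - 2)"
      using a less.prems by simp
    finally show ?thesis
      using free_invs_rec[of "card A"] card_gt_0_iff[of A] less.prems False by simp
  qed
qed

lemma card_roots_3_cycle:
  assumes A: "finite A" "a \<in> A" "b \<in> A" "c \<in> A" and d: "distinct [a, b, c]"
  shows "card {x \<in> roots True 3 A (\<lambda>d. d). x a = b \<and> x b = c} = card (roots True 3 (A - {a, b, c}) (\<lambda>d. d))"
proof -
  have "{x \<in> roots True 3 A (\<lambda>d. d). x a = b \<and> x b = c} =
      {x \<in> roots True 3 A (\<lambda>d. d). \<forall>d\<in>{a, b, c}. x d = cycle_of_list [a, b, c] d}"
    using d by (auto simp: roots3_iff transpose_def)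
  also have "card \<dots> = card (roots True 3 (A - {a, b, c}) (\<lambda>d. d))"
  proof -
    have "(cycle_of_list [a, b, c] ^^ 3) d = d" if "d \<in> set [a, b, c]" for d
      using that d by (auto simp: numeral_3_eq_3 transpose_def)
    from card_roots_cut_cycle[OF A(1) _ permutes_ident this] show ?thesis
      using A by (simp del: cycle_of_list.simps add: restrict_id_id)
  qed
  finally show ?thesis .
qed

lemma card_cubics:
  assumes "finite A"
  shows "card (roots True 3 A (\<lambda>d. d)) = cubics (card A)"
  using assms
proof (induction "card A" arbitrary: A rule: less_induct)
  case less
  show ?case
  proof (cases "A = {}")
    case True
    then show ?thesis by (simp add: roots_empty)
  next
    case False
    then obtain a where a: "a \<in> A" by blast
    let ?R = "roots True 3 A (\<lambda>d. d)"
    have "card ?R = (\<Sum>b\<in>A. card {x \<in> ?R. x a = b})"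
      using card_roots_split[OF less.prems a, of True 3 "\<lambda>d. d" "\<lambda>_. True"] by simp
    also have "\<dots> = card {x \<in> ?R. x a = a} + (\<Sum>b\<in>A - {a}. card {x \<in> ?R. x a = b})"
      using less.prems a by (simp add: sum.remove)
    also have "card {x \<in> ?R. x a = a} = cubics (card A - 1)"
      using less.prems a less.hyps[of "A - {a}"]
      card_Diff1_less[of A a] by (simp add: card_roots_fixed)
    also have "(\<Sum>b\<in>A - {a}. card {x \<in> ?R. x a = b}) =
        (\<Sum>b\<in>A - {a}. (card A - 2) * cubics (card A - 3))"
    proof (rule sum.cong[OF refl])
      fix b assume b: "b \<in> A - {a}"
      have "card {x \<in> ?R. x a = b} = (\<Sum>c\<in>A. card {x \<in> ?R. x a = b \<and> x b = c})"
        using b by (intro card_roots_split less.prems) simp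
      also have "\<dots> = (\<Sum>c\<in>A - {a, b}. card {x \<in> ?R. x a = b \<and> x b = c})"
      proof (rule sum.mono_neutral_right[OF less.prems])
        have "x b \<notin> {a, b}" if "x \<in> ?R" "x a = b" for x
          using that b by (simp add: roots3_iff) metis
        then have *: "{x \<in> ?R. x a = b \<and> x b = c} = {}" if "c \<in> {a, b}" for c
          using that by blast
        have "card {x \<in> ?R. x a = b \<and> x b = c} = 0" if "c \<in> {a, b}" for c
          by (simp only: *[OF that] card.empty)
        then show "\<forall>c\<in>A - (A - {a, b}). card {x \<in> ?R. x a = b \<and> x b = c} = 0"
          by (meson DiffD1 DiffD2 DiffI)
      qed auto
      also have "\<dots> = (\<Sum>c\<in>A - {a, b}. cubics (card A - 3))"
      proof (rule sum.cong[OF refl])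
        fix c assume c: "c \<in> A - {a, b}"
        have "card (A - {a, b, c}) = card A - 3"
          using a b c less.prems by (auto simp: card_Diff_subset)
        moreover have "card A \<ge> 3"
          using a b c less.prems card_mono[of A "{a, b, c}"] by auto
        ultimately show "card {x \<in> ?R. x a = b \<and> x b = c} = cubics (card A - 3)"
          using a b c less.prems less.hyps[of "A - {a, b, c}"]
          by (subst card_roots_3_cycle) auto
      qed
      also have "\<dots> = (card A - 2) * cubics (card A - 3)"
        using a b less.prems by (auto simp: card_Diff_subset)
      finally show "card {x \<in> ?R. x a = b} = (card A - 2) * cubics (card A - 3)" .
    qed
    also have "\<dots> = (card A - 1) * ((card A - 2) * cubics (card A - 3))"
      using a less.prems by simp
    finally show ?thesis
      using cubics_rec[of "card A"] card_gt_0_iff[of A] less.prems False by simp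
  qed
qed

lemma restrict_free_involution:
  assumes z: "z \<in> roots False 2 A (\<lambda>d. d)" and C: "C \<subseteq> A" "finite C" "z ` C \<subseteq> C"
  shows "restrict_id z (A - C) \<in> roots False 2 (A - C) (\<lambda>d. d)"
proof -
  have p: "restrict_id z (A - C) permutes (A - C)"
    using z C by (intro permutes_restrict_invariant(2)) (auto simp: roots2_iff)
  have "z b \<notin> C" if "b \<notin> C" for b
    using z C(3) that unfolding roots2_iff by (metis id_apply image_subset_iff)
  then show ?thesis
    using z p permutes_in_image[of z A] by (auto simp: roots2_iff restrict_id_def)
qed

lemma card_sq_roots:
  assumes "finite A" "z \<in> roots False 2 A (\<lambda>d. d)"
  shows "card (roots True 2 A z) = sq_roots (card A)"
  using assms
proof (induction "card A" arbitrary: A z rule: less_induct)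
  case less
  show ?case
  proof (cases "A = {}")
    case True
    then have "z = (\<lambda>d. d)"
      using less.prems by (auto simp: roots2_iff)
    then show ?thesis using True by (simp add: roots_empty sq_roots.simps)
  next
    case False
    then obtain a where a: "a \<in> A" by blast
    let ?R = "roots True 2 A z"
    have z: "z permutes A" "z (z b) = b" "b \<in> A \<Longrightarrow> z b \<noteq> b" "z b \<in> A \<longleftrightarrow> b \<in> A" for b
      using less.prems permutes_in_image[of z A] by (auto simp: roots2_iff)
    have zinj: "z b = z c \<longleftrightarrow> b = c" for b c
      using z(2) by metis
    have fin: "finite A" by fact
    have "card ?R = (\<Sum>b\<in>A. card {x \<in> ?R. x a = b})"
      using card_roots_split[OF fin a, of True 2 z "\<lambda>_. True"] by simp
    also have "\<dots> = (\<Sum>b\<in>A - {a, z a}. card {x \<in> ?R. x a = b})"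
    proof (rule sum.mono_neutral_right[OF fin])
      have "x a \<notin> {a, z a}" if "x \<in> ?R" for x
        using that z(2)[of a] z(3)[OF a] by (simp add: roots2_iff) metis
      then have *: "{x \<in> ?R. x a = b} = {}" if "b \<in> {a, z a}" for b
        using that by blast
      have "card {x \<in> ?R. x a = b} = 0" if "b \<in> {a, z a}" for b
        by (simp only: *[OF that] card.empty)
      then show "\<forall>b\<in>A - (A - {a, z a}). card {x \<in> ?R. x a = b} = 0"
        by (meson DiffD1 DiffD2 DiffI)
    qed auto
    also have "\<dots> = (\<Sum>b\<in>A - {a, z a}. if card A < 4 then 0 else sq_roots (card A - 4))"
    proof (rule sum.cong[OF refl])
      fix b assume b: "b \<in> A - {a, z a}"
      let ?C = "{a, b, z a, z b}" and ?c = "cycle_of_list [a, b, z a, z b]"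
      have dist: "distinct [a, b, z a, z b]"
        using a b z(2,3) zinj by (auto) metis+
      have C: "?C \<subseteq> A" "card ?C = 4"
        using a b z(4) dist by auto
      have eq: "{x \<in> ?R. x a = b} = {x \<in> ?R. \<forall>d\<in>?C. x d = ?c d}"
        using dist z(2) by (auto simp: roots2_iff transpose_def) metis+
      have "card {x \<in> ?R. x a = b} = card (roots True 2 (A - ?C) (restrict_id z (A - ?C)))"
      proof -
        have cyc: "(cycle_of_list [a, b, z a, z b] ^^ 2) d = z d" if "d \<in> set [a, b, z a, z b]" for d
          using that dist z(2) by (auto simp: numeral_2_eq_2 transpose_def)
        have sub: "set [a, b, z a, z b] \<subseteq> A"
          using C(1) by simp
        show ?thesis
          unfolding eq by (rule card_roots_cut_cycle[OF fin sub z(1) cyc, unfolded list.set])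
      qed
      also have "\<dots> = sq_roots (card (A - ?C))"
      proof (intro less.hyps)
        show "card (A - ?C) < card A"
          by (rule psubset_card_mono[OF fin]) (use a in auto)
        show "restrict_id z (A - ?C) \<in> roots False 2 (A - ?C) (\<lambda>d. d)"
          using less.prems C z(2) by (intro restrict_free_involution) auto
      qed (use fin in auto)
      also have "\<dots> = sq_roots (card A - 4)"
        by (simp only: card_Diff_subset[OF finite_subset[OF C(1) fin] C(1)] C(2))
      finally show "card {x \<in> ?R. x a = b} = (if card A < 4 then 0 else sq_roots (card A - 4))"
        using card_mono[OF fin C(1)] C(2) by simp
    qed
    also have "\<dots> = (card A - 2) * (if card A < 4 then 0 else sq_roots (card A - 4))"
      using a z(3)[OF a] z(4) fin by (simp add: card_Diff_subset numeral_2_eq_2)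
    finally show ?thesis
      using a fin by (subst sq_roots.simps) auto
  qed
qed

lemma card_cub_roots:
  assumes "finite A" "z \<in> roots False 2 A (\<lambda>d. d)"
  shows "card (roots True 3 A z) = cub_roots (card A)"
  using assms
proof (induction "card A" arbitrary: A z rule: less_induct)
  case less
  show ?case
  proof (cases "A = {}")
    case True
    then have "z = (\<lambda>d. d)"
      using less.prems by (auto simp: roots2_iff)
    then show ?thesis using True by (simp add: roots_empty cub_roots.simps)
  next
    case False
    then obtain a where a: "a \<in> A" by blast
    let ?R = "roots True 3 A z"
    have z: "z permutes A" "z (z b) = b" "b \<in> A \<Longrightarrow> z b \<noteq> b" "z b \<in> A \<longleftrightarrow> b \<in> A" for b
      using less.prems permutes_in_image[of z A] by (auto simp: roots2_iff)
    have zinj: "z b = z c \<longleftrightarrow> b = c" for b c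
      using z(2) by metis
    have comm: "x (z b) = z (x b)" if "x \<in> ?R" for x b
      using that by (simp add: roots3_iff) metis
    have fin: "finite A" by fact
    have za: "z a \<noteq> a" "z a \<in> A"
      using z a by auto
    have two: "card A \<ge> 2"
      using card_mono[OF fin, of "{a, z a}"] a za by simp
    have "card ?R = (\<Sum>b\<in>A. card {x \<in> ?R. x a = b})"
      using card_roots_split[OF fin a, of True 3 z "\<lambda>_. True"] by simp
    also have "\<dots> = (\<Sum>b\<in>A - {a}. card {x \<in> ?R. x a = b})"
    proof (rule sum.mono_neutral_right[OF fin])
      have "x a \<noteq> a" if "x \<in> ?R" for x
        using that za by (simp add: roots3_iff) metis
      then have *: "{x \<in> ?R. x a = b} = {}" if "b \<in> {a}" for b
        using that by blast
      have "card {x \<in> ?R. x a = b} = 0" if "b \<in> {a}" for b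
        by (simp only: *[OF that] card.empty)
      then show "\<forall>b\<in>A - (A - {a}). card {x \<in> ?R. x a = b} = 0"
        by (meson DiffD1 DiffD2 DiffI)
    qed auto
    also have "\<dots> = card {x \<in> ?R. x a = z a} + (\<Sum>b\<in>A - {a, z a}. card {x \<in> ?R. x a = b})"
      using za fin by (subst sum.remove[of _ "z a"]) (auto simp: insert_commute Diff_insert2[symmetric])
    also have "card {x \<in> ?R. x a = z a} = cub_roots (card A - 2)"
    proof -
      let ?C = "{a, z a}" and ?c = "Transposition.transpose a (z a)"
      have C: "?C \<subseteq> A" "card ?C = 2"
        using a za by auto
      have eq: "{x \<in> ?R. x a = z a} = {x \<in> ?R. \<forall>d\<in>?C. x d = ?c d}"
      proof (intro Collect_cong conj_cong refl)
        fix x assume "x \<in> ?R"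
        then have "x (z a) = z (x a)" by (rule comm)
        then show "(x a = z a) = (\<forall>d\<in>?C. x d = ?c d)"
          using z(2) by auto
      qed
      have "card {x \<in> ?R. x a = z a} = card (roots True 3 (A - ?C) (restrict_id z (A - ?C)))"
        unfolding eq using C fin z by (intro card_roots_cut) (auto simp: numeral_3_eq_3 intro: permutes_swap_id)
      also have "\<dots> = cub_roots (card (A - ?C))"
      proof (intro less.hyps)
        show "card (A - ?C) < card A"
          by (rule psubset_card_mono[OF fin]) (use a in auto)
        show "restrict_id z (A - ?C) \<in> roots False 2 (A - ?C) (\<lambda>d. d)"
          using less.prems C z(2) by (intro restrict_free_involution) auto
      qed (use fin in auto)
      also have "\<dots> = cub_roots (card A - 2)"
        by (simp only: card_Diff_subset[OF finite_subset[OF C(1) fin] C(1)] C(2))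
      finally show ?thesis .
    qed
    also have "(\<Sum>b\<in>A - {a, z a}. card {x \<in> ?R. x a = b}) =
        (\<Sum>b\<in>A - {a, z a}. (card A - 4) * (if card A < 6 then 0 else cub_roots (card A - 6)))"
    proof (rule sum.cong[OF refl])
      fix b assume b: "b \<in> A - {a, z a}"
      have zb: "z b \<noteq> a" "z b \<noteq> z a" "z b \<noteq> b" "z b \<in> A"
        using b z zinj by auto
      let ?D = "{a, b, z a, z b}"
      have D: "?D \<subseteq> A" "card ?D = 4"
        using a b za zb by auto
      have "card {x \<in> ?R. x a = b} = (\<Sum>c\<in>A. card {x \<in> ?R. x a = b \<and> x b = c})"
        using b by (intro card_roots_split fin) simp
      also have "\<dots> = (\<Sum>c\<in>A - ?D. card {x \<in> ?R. x a = b \<and> x b = c})"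
      proof (rule sum.mono_neutral_right[OF fin])
        have "c \<notin> ?D" if x: "x \<in> ?R" "x a = b" "x b = c" for x c
        proof
          have x3: "x (x (x d)) = z d" for d
            using x(1) by (simp add: roots3_iff)
          have 1: "x c = z a" "x (x c) = z b" "x (z b) = z c" "b \<noteq> z a"
            using x3[of a] x3[of b] x(2,3) comm[OF x(1)] b by auto
          assume "c \<in> ?D"
          then consider "c = a" | "c = b" | "c = z a" | "c = z b"
            by blast
          then show False
          proof cases
            case 1
            then show ?thesis using \<open>x c = z a\<close> x(2) \<open>b \<noteq> z a\<close> by simp
          next
            case 2
            then show ?thesis using \<open>x c = z a\<close> x(3) \<open>b \<noteq> z a\<close> by simp
          next
            case 3
            then have "z b = z a"
              using \<open>x c = z a\<close> comm[OF x(1), of a] x(2) by simp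
            then show ?thesis using zb by simp
          next
            case 4
            then have "z c = z a"
              using \<open>x c = z a\<close> \<open>x (z b) = z c\<close> by simp
            then show ?thesis using 4 zinj zb by simp
          qed
        qed
        then have *: "{x \<in> ?R. x a = b \<and> x b = c} = {}" if "c \<in> ?D" for c
          using that by blast
        have "card {x \<in> ?R. x a = b \<and> x b = c} = 0" if "c \<in> ?D" for c
          by (simp only: *[OF that] card.empty)
        then show "\<forall>c\<in>A - (A - ?D). card {x \<in> ?R. x a = b \<and> x b = c} = 0"
          by (meson DiffD1 DiffD2 DiffI)
      qed auto
      also have "\<dots> = (\<Sum>c\<in>A - ?D. if card A < 6 then 0 else cub_roots (card A - 6))"
      proof (rule sum.cong[OF refl])
        fix c assume c: "c \<in> A - ?D"
        let ?C = "{a, b, c, z a, z b, z c}" and ?c = "cycle_of_list [a, b, c, z a, z b, z c]"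
        have zc: "z c \<noteq> a" "z c \<noteq> z a" "z c \<noteq> b" "z c \<noteq> z b" "z c \<noteq> c" "z c \<in> A"
          using c z zinj by auto
        have dist: "distinct [a, b, c, z a, z b, z c]"
          using a b c za zb zc by auto
        have C: "?C \<subseteq> A" "card ?C = 6"
          using a b c za zb zc by auto
        have eq: "{x \<in> ?R. x a = b \<and> x b = c} = {x \<in> ?R. \<forall>d\<in>?C. x d = ?c d}"
        proof (intro Collect_cong conj_cong refl)
          fix x assume x: "x \<in> ?R"
          have "x (x (x a)) = z a"
            using x by (simp add: roots3_iff)
          then show "(x a = b \<and> x b = c) = (\<forall>d\<in>?C. x d = ?c d)"
            using comm[OF x] dist z(2) by (auto simp: transpose_def)
        qed
        have "card {x \<in> ?R. x a = b \<and> x b = c} = card (roots True 3 (A - ?C) (restrict_id z (A - ?C)))"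
        proof -
          have cyc: "(cycle_of_list [a, b, c, z a, z b, z c] ^^ 3) d = z d"
            if "d \<in> set [a, b, c, z a, z b, z c]" for d
            using that dist z(2) by (auto simp: numeral_3_eq_3 transpose_def)
          have sub: "set [a, b, c, z a, z b, z c] \<subseteq> A"
            using C(1) by simp
          show ?thesis
            unfolding eq by (rule card_roots_cut_cycle[OF fin sub z(1) cyc, unfolded list.set])
        qed
        also have "\<dots> = cub_roots (card (A - ?C))"
        proof (intro less.hyps)
          show "card (A - ?C) < card A"
            by (rule psubset_card_mono[OF fin]) (use a in auto)
          show "restrict_id z (A - ?C) \<in> roots False 2 (A - ?C) (\<lambda>d. d)"
            using less.prems C z(2) by (intro restrict_free_involution) auto
        qed (use fin in auto)
        also have "\<dots> = cub_roots (card A - 6)"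
          by (simp only: card_Diff_subset[OF finite_subset[OF C(1) fin] C(1)] C(2))
        finally show "card {x \<in> ?R. x a = b \<and> x b = c} = (if card A < 6 then 0 else cub_roots (card A - 6))"
          using card_mono[OF fin C(1)] C(2) by simp
      qed
      also have "\<dots> = (card A - 4) * (if card A < 6 then 0 else cub_roots (card A - 6))"
        using D fin by (simp add: card_Diff_subset)
      finally show "card {x \<in> ?R. x a = b} =
          (card A - 4) * (if card A < 6 then 0 else cub_roots (card A - 6))" .
    qed
    also have "\<dots> = (card A - 2) * ((card A - 4) * (if card A < 6 then 0 else cub_roots (card A - 6)))"
      using a za fin by (simp add: card_Diff_subset numeral_2_eq_2)
    finally show ?thesis
      using two by (subst cub_roots.simps) auto
  qed
qed

definition num_pairs :: "bool \<Rightarrow> nat \<Rightarrow> nat" where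
  "num_pairs e n = (if e then invs n * cubics n else free_invs n * sq_roots n * cub_roots n)"

lemma amalgam_pairs_True:
  "amalgam_pairs True A = roots True 2 A (\<lambda>d. d) \<times> roots True 3 A (\<lambda>d. d)"
proof -
  have "(x, y) \<in> amalgam_pairs True A \<longleftrightarrow> x \<in> roots True 2 A (\<lambda>d. d) \<and> y \<in> roots True 3 A (\<lambda>d. d)" for x y
  proof
    assume xy: "(x, y) \<in> amalgam_pairs True A"
    then have "x (x b) = b" for b
      by (cases "b \<in> A") (auto simp: amalgam_pairs_def permutes_not_in)
    then show "x \<in> roots True 2 A (\<lambda>d. d) \<and> y \<in> roots True 3 A (\<lambda>d. d)"
      using xy by (simp add: amalgam_pairs_def roots2_iff roots3_iff fun_eq_iff)
  qed (simp add: amalgam_pairs_def roots2_iff roots3_iff fun_eq_iff)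
  then show ?thesis
    by auto
qed

lemma amalgam_pairs_False:
  "amalgam_pairs False A = (\<Union>z\<in>roots False 2 A (\<lambda>d. d). roots True 2 A z \<times> roots True 3 A z)"
proof (intro subset_antisym subsetI)
  fix xy assume xy: "xy \<in> amalgam_pairs False A"
  obtain x y where [simp]: "xy = (x, y)" by (cases xy)
  have "x \<circ> x \<in> roots False 2 A (\<lambda>d. d)"
    using xy by (auto simp: amalgam_pairs_def roots2_iff fun_eq_iff intro: permutes_compose)
  moreover have "x \<in> roots True 2 A (x \<circ> x)" "y \<in> roots True 3 A (x \<circ> x)"
    using xy by (simp_all add: amalgam_pairs_def roots2_iff roots3_iff fun_eq_iff)
  ultimately show "xy \<in> (\<Union>z\<in>roots False 2 A (\<lambda>d. d). roots True 2 A z \<times> roots True 3 A z)"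
    by auto
next
  fix xy assume "xy \<in> (\<Union>z\<in>roots False 2 A (\<lambda>d. d). roots True 2 A z \<times> roots True 3 A z)"
  then obtain x y z where "xy = (x, y)" "z \<in> roots False 2 A (\<lambda>d. d)"
      "x \<in> roots True 2 A z" "y \<in> roots True 3 A z"
    by auto
  then show "xy \<in> amalgam_pairs False A"
    by (simp add: amalgam_pairs_def roots2_iff roots3_iff fun_eq_iff)
qed

lemma card_amalgam_pairs:
  assumes "finite A"
  shows "card (amalgam_pairs e A) = num_pairs e (card A)"
proof (cases e)
  case True
  then show ?thesis
    using assms by (simp add: num_pairs_def amalgam_pairs_True card_cartesian_product card_involutions card_cubics)
next
  case False
  have "roots True 2 A z \<inter> roots True 2 A z' = {}" if "z \<noteq> z'" for z z'
    using that by (auto simp: roots_def)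
  then have "card (amalgam_pairs False A) =
      (\<Sum>z\<in>roots False 2 A (\<lambda>d. d). card (roots True 2 A z \<times> roots True 3 A z))"
    unfolding amalgam_pairs_False using assms
    by (intro card_UN_disjoint) (auto simp: finite_roots)
  also have "\<dots> = (\<Sum>z\<in>roots False 2 A (\<lambda>d. d). sq_roots (card A) * cub_roots (card A))"
    using assms by (intro sum.cong refl) (simp add: card_cartesian_product card_sq_roots card_cub_roots)
  also have "\<dots> = num_pairs False (card A)"
    using assms by (simp add: num_pairs_def card_free_involutions)
  finally show ?thesis
    using False by simp
qed

lemma sum_subsets_card:
  fixes f :: "nat \<Rightarrow> nat"
  assumes "finite M"
  shows "(\<Sum>C\<in>Pow M. f (card C)) = (\<Sum>j\<le>card M. (card M choose j) * f j)"
proof -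
  have "(\<Sum>C\<in>Pow M. f (card C)) = (\<Sum>j\<le>card M. \<Sum>C\<in>{C \<in> Pow M. card C = j}. f (card C))"
    using assms by (intro sum.group[symmetric]) (auto intro: card_mono)
  also have "\<dots> = (\<Sum>j\<le>card M. (card M choose j) * f j)"
    using n_subsets[OF assms] by (intro sum.cong refl) (simp add: Pow_def)
  finally show ?thesis .
qed

lemma num_pairs_recursion:
  "num_pairs e (Suc n) =
     (\<Sum>j\<le>n. (n choose j) * (fact j * card (SL2Z_subgroups e (Suc j)) * num_pairs e (n - j)))"
proof -
  let ?A = "{..n}" and ?M = "{..<n}"
  have "num_pairs e (Suc n) = card (amalgam_pairs e ?A)"
    by (simp add: card_amalgam_pairs)
  also have "\<dots> = (\<Sum>B | B \<subseteq> ?A \<and> n \<in> B. card (transitive_pairs e B n) * card (amalgam_pairs e (?A - B)))"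
    by (rule card_amalgam_pairs_orbit) auto
  also have "\<dots> = (\<Sum>C\<in>Pow ?M. fact (card C) * card (SL2Z_subgroups e (Suc (card C))) * num_pairs e (n - card C))"
  proof (rule sum.reindex_bij_witness[of _ "\<lambda>C. insert n C" "\<lambda>B. B - {n}"])
    fix B assume B: "B \<in> {B. B \<subseteq> ?A \<and> n \<in> B}"
    then have fin: "finite B"
      using finite_subset by blast
    have c: "card B = Suc (card (B - {n}))"
      using B fin card.remove[of B n] by blast
    have "card (?A - B) = n - card (B - {n})"
      using B fin c by (simp add: card_Diff_subset)
    then show "fact (card (B - {n})) * card (SL2Z_subgroups e (Suc (card (B - {n})))) * num_pairs e (n - card (B - {n})) =
        card (transitive_pairs e B n) * card (amalgam_pairs e (?A - B))"
      using B fin c by (simp add: card_transitive_pairs card_amalgam_pairs)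
  qed (auto simp: le_less)
  also have "\<dots> = (\<Sum>j\<le>n. (n choose j) * (fact j * card (SL2Z_subgroups e (Suc j)) * num_pairs e (n - j)))"
    using sum_subsets_card[of ?M "\<lambda>c. fact c * card (SL2Z_subgroups e (Suc c)) * num_pairs e (n - c)"] by simp
  finally show ?thesis .
qed

section \<open>The differential equations\<close>

unbundle no vec_syntax
lemma invs_cubics_identity:
  fixes N :: real
  assumes T: "T2 = T1 + (N + 1) * T0" "T3 = T2 + (N + 2) * T1" "T4 = T3 + (N + 3) * T2"
      "T5 = T4 + (N + 4) * T3" "T6 = T5 + (N + 5) * T4" "T7 = T6 + (N + 6) * T5"
      "T8 = T7 + (N + 7) * T6" "T9 = T8 + (N + 8) * T7"
    and U: "U3 = U2 + (N + 2) * (N + 1) * U0" "U4 = U3 + (N + 3) * (N + 2) * U1"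
      "U5 = U4 + (N + 4) * (N + 3) * U2" "U6 = U5 + (N + 5) * (N + 4) * U3"
      "U7 = U6 + (N + 6) * (N + 5) * U4" "U8 = U7 + (N + 7) * (N + 6) * U5"
      "U9 = U8 + (N + 8) * (N + 7) * U6"
  shows "T9 * U9 = T8 * U8 + (N + 8) * (T7 * U7 + (N + 7) * ((4 * N + 28) * (T6 * U6)
    + (N + 6) * ((2 * N + 14) * (T5 * U5) + (N + 5) * (- (T4 * U4) + (N + 4) * ((N ^ 2 + 9 * N + 22) * (T3 * U3)
    + (N + 3) * (- (2 * N + 6) * (T2 * U2) - (N + 2) * (N + 1) * ((N + 2) * (N + 1)) * (T0 * U0)))))))"
  unfolding T U by algebra

lemma cub_identity:
  fixes i :: real
  assumes "b3 = b2 + 4 * (2 * i + 2) * (2 * i + 1) * b0" "b4 = b3 + 4 * (2 * i + 3) * (2 * i + 2) * b1"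
     "b5 = b4 + 4 * (2 * i + 4) * (2 * i + 3) * b2" "b6 = b5 + 4 * (2 * i + 5) * (2 * i + 4) * b3"
   shows "b6 = b4 + 32 * (i + 2)^2 * b2 + 64 * (i + 2) * (i + 1) * (2 * i + 1) * (2 * i + 5) * b0"
  unfolding assms by algebra

definition pairs_fps :: "bool \<Rightarrow> real fps" where
  "pairs_fps e = Abs_fps (\<lambda>n. real (num_pairs e n) / fact n)"

definition subgroups_fps :: "bool \<Rightarrow> int fps" where
  "subgroups_fps e = Abs_fps (\<lambda>n. int (card (SL2Z_subgroups e (Suc n))))"

definition real_fps :: "int fps \<Rightarrow> real fps" where
  "real_fps f = Abs_fps (\<lambda>n. of_int (f $ n))"

lemma real_fps_nth [simp]: "real_fps f $ n = of_int (f $ n)"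
  by (simp add: real_fps_def)

lemma real_fps_hom:
  "real_fps (f + g) = real_fps f + real_fps g"
  "real_fps (f - g) = real_fps f - real_fps g"
  "real_fps (f * g) = real_fps f * real_fps g"
  "real_fps 1 = 1"
  "real_fps (fps_X ^ k) = fps_X ^ k"
  "real_fps fps_X = fps_X"
  "real_fps (fps_deriv f) = fps_deriv (real_fps f)"
  "real_fps (numeral m) = numeral m"
  by (simp_all add: fps_eq_iff fps_mult_nth fps_X_power_nth numeral_fps_const fps_X_nth)

lemma real_fps_inject: "real_fps f = real_fps g \<longleftrightarrow> f = g"
  by (simp add: fps_eq_iff)

lemma pairs_fps_deriv: "fps_deriv (pairs_fps e) = real_fps (subgroups_fps e) * pairs_fps e"
proof (rule fps_ext)
  fix n
  have "fps_deriv (pairs_fps e) $ n = real (num_pairs e (Suc n)) / fact n"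
    by (simp add: pairs_fps_def)
  also have "\<dots> = (\<Sum>j\<le>n. real (card (SL2Z_subgroups e (Suc j))) * (real (num_pairs e (n - j)) / fact (n - j)))"
    unfolding num_pairs_recursion of_nat_sum sum_divide_distrib
    by (intro sum.cong refl) (simp add: binomial_fact)
  also have "\<dots> = (real_fps (subgroups_fps e) * pairs_fps e) $ n"
    by (simp add: fps_mult_nth pairs_fps_def subgroups_fps_def atLeast0AtMost)
  finally show "fps_deriv (pairs_fps e) $ n = (real_fps (subgroups_fps e) * pairs_fps e) $ n" .
qed

lemma pairs_fps_nonzero: "pairs_fps e \<noteq> 0"
proof
  assume "pairs_fps e = 0"
  then have "pairs_fps e $ 0 = 0"
    by simp
  then show False
    by (auto simp: pairs_fps_def num_pairs_def sq_roots.simps cub_roots.simps split: if_splits)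
qed

lemma pairs_True_rec:
  fixes N :: nat
  defines "h \<equiv> \<lambda>n. pairs_fps True $ n" and "M \<equiv> real N"
  shows "(M + 9) * h (N + 9) = h (N + 8) + h (N + 7) + (4 * M + 28) * h (N + 6) +
    (2 * M + 14) * h (N + 5) - h (N + 4) + (M ^ 2 + 9 * M + 22) * h (N + 3) -
    (2 * M + 6) * h (N + 2) - (M + 1) * (M + 2) * h N"
proof -
  define T where "T k = real (invs (N + k))" for k
  define U where "U k = real (cubics (N + k))" for k
  define f where "f k = (fact (N + k) :: real)" for k
  have T: "T (Suc (Suc k)) = T (Suc k) + (M + (real k + 1)) * T k" for k
    by (simp add: T_def M_def algebra_simps)
  have U: "U (Suc (Suc (Suc k))) = U (Suc (Suc k)) + (M + (real k + 2)) * (M + (real k + 1)) * U k" for k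
    by (simp add: U_def M_def algebra_simps)
  have f: "f (Suc k) = (M + (real k + 1)) * f k" for k
    by (simp add: f_def M_def algebra_simps)
  have hf: "T k * U k = h (N + k) * f k" for k
    by (simp add: h_def pairs_fps_def num_pairs_def T_def U_def f_def)
  have "T 9 * U 9 = T 8 * U 8 + (M + 8) * (T 7 * U 7 + (M + 7) * ((4 * M + 28) * (T 6 * U 6)
    + (M + 6) * ((2 * M + 14) * (T 5 * U 5) + (M + 5) * (- (T 4 * U 4) + (M + 4) * ((M ^ 2 + 9 * M + 22) * (T 3 * U 3)
    + (M + 3) * (- (2 * M + 6) * (T 2 * U 2) - (M + 2) * (M + 1) * ((M + 2) * (M + 1)) * (T 0 * U 0)))))))"
    using T[of 0] T[of 1] T[of 2] T[of 3] T[of 4] T[of 5] T[of 6] T[of 7]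
      U[of 0] U[of 1] U[of 2] U[of 3] U[of 4] U[of 5] U[of 6]
    by (intro invs_cubics_identity[of "T 2" "T 1" M "T 0" "T 3" "T 4" "T 5" "T 6" "T 7" "T 8" "T 9"
          "U 3" "U 2" "U 0" "U 4" "U 1" "U 5" "U 6" "U 7" "U 8" "U 9"])
      (simp_all add: eval_nat_numeral algebra_simps)
  note this[unfolded hf]
  moreover have "f 1 = (M + 1) * f 0" "f 2 = (M + 2) * f 1" "f 3 = (M + 3) * f 2" "f 4 = (M + 4) * f 3"
      "f 5 = (M + 5) * f 4" "f 6 = (M + 6) * f 5" "f 7 = (M + 7) * f 6" "f 8 = (M + 8) * f 7"
      "f 9 = (M + 9) * f 8"
    using f[of 0] f[of 1] f[of 2] f[of 3] f[of 4] f[of 5] f[of 6] f[of 7] f[of 8]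
    by (simp_all add: eval_nat_numeral algebra_simps)
  ultimately have "f 8 * ((M + 9) * h (N + 9)) = f 8 * (h (N + 8) + h (N + 7) + (4 * M + 28) * h (N + 6) +
    (2 * M + 14) * h (N + 5) - h (N + 4) + (M ^ 2 + 9 * M + 22) * h (N + 3) -
    (2 * M + 6) * h (N + 2) - (M + 1) * (M + 2) * h (N + 0))"
    by algebra
  moreover have "f 8 \<noteq> 0"
    by (simp add: f_def)
  ultimately show ?thesis
    by simp
qed

lemma invs_values: "invs 2 = 2" "invs 3 = 4" "invs 4 = 10" "invs 5 = 26" "invs 6 = 76" "invs 7 = 232" "invs 8 = 764"
  by (simp_all add: eval_nat_numeral)

lemma cubics_values: "cubics 2 = 1" "cubics 3 = 3" "cubics 4 = 9" "cubics 5 = 21" "cubics 6 = 81"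
  "cubics 7 = 351" "cubics 8 = 1233"
  by (simp_all add: eval_nat_numeral)

text \<open>The coefficients of the two differential equations were found by linear algebra from the
  initial terms of the series.\<close>

lemma pairs_True_ode:
  defines "H \<equiv> pairs_fps True"
  shows "fps_X ^ 7 * fps_deriv (fps_deriv H) - fps_X ^ 10 * fps_deriv (fps_deriv H)
    + fps_const 4 * (fps_X ^ 3 * fps_deriv H) + fps_const 2 * (fps_X ^ 4 * fps_deriv H)
    + fps_const 4 * (fps_X ^ 6 * fps_deriv H) - fps_const 2 * (fps_X ^ 7 * fps_deriv H)
    - fps_const 4 * (fps_X ^ 9 * fps_deriv H) - fps_deriv H
    + H + fps_X ^ 1 * H + fps_const 4 * (fps_X ^ 2 * H) + fps_const 4 * (fps_X ^ 3 * H) - fps_X ^ 4 * H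
    + fps_const 4 * (fps_X ^ 5 * H) - fps_const 2 * (fps_X ^ 6 * H) - fps_const 2 * (fps_X ^ 8 * H) = 0"
    (is "?E = 0")
proof (rule fps_ext)
  fix n
  show "?E $ n = 0 $ n"
  proof (cases "n < 8")
    case True
    then have "n = 0 \<or> n = 1 \<or> n = 2 \<or> n = 3 \<or> n = 4 \<or> n = 5 \<or> n = 6 \<or> n = 7"
      by linarith
    then show ?thesis
      by (elim disjE)
        (simp_all add: fps_X_power_mult_nth H_def pairs_fps_def num_pairs_def invs_values cubics_values fact_numeral)
  next
    case False
    then obtain N where n: "n = N + 8"
      by (metis add.commute le_Suc_ex not_less)
    have "?E $ n = - ((real N + 9) * H $ (N + 9)) + H $ (N + 8) + H $ (N + 7) + (4 * real N + 28) * H $ (N + 6) +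
      (2 * real N + 14) * H $ (N + 5) - H $ (N + 4) + (real N ^ 2 + 9 * real N + 22) * H $ (N + 3) -
      (2 * real N + 6) * H $ (N + 2) - (real N + 1) * (real N + 2) * H $ N"
    proof (cases "N \<ge> 2")
      case True
      then obtain K where K: "N = K + 2"
        by (metis add.commute le_Suc_ex)
      show ?thesis
        unfolding n K by (simp add: fps_X_power_mult_nth)
          (simp add: algebra_simps power2_eq_square eval_nat_numeral)
    next
      case False
      then have "N = 0 \<or> N = 1"
        by linarith
      then show ?thesis
        unfolding n by (elim disjE; simp add: fps_X_power_mult_nth; simp add: eval_nat_numeral)
    qed
    then show ?thesis
      using pairs_True_rec[of N] by (simp add: H_def)
  qed
qed

lemma sq_roots_zero: "n mod 4 \<noteq> 0 \<Longrightarrow> sq_roots n = 0"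
proof (induction n rule: sq_roots.induct)
  case (1 n)
  then show ?case
    by (subst sq_roots.simps) (auto simp: le_mod_geq)
qed

lemma free_roots_value: "free_invs (4 * j) * sq_roots (4 * j) * (4 ^ j * fact j) = fact (4 * j)"
proof (induction j)
  case 0
  then show ?case by (simp add: sq_roots.simps)
next
  case (Suc j)
  have "free_invs (4 * Suc j) = (4 * j + 3) * (4 * j + 1) * free_invs (4 * j)"
  proof -
    have "4 * Suc j = Suc (Suc (Suc (Suc (4 * j))))"
      by simp
    then show ?thesis
      by (simp only: free_invs.simps) (simp add: algebra_simps)
  qed
  moreover have "sq_roots (4 * Suc j) = (4 * j + 2) * sq_roots (4 * j)"
    by (subst sq_roots.simps) simp
  moreover have "fact (4 * Suc j) = (4 * j + 4) * ((4 * j + 3) * ((4 * j + 2) * ((4 * j + 1) * fact (4 * j))))"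
  proof -
    have "4 * Suc j = Suc (Suc (Suc (Suc (4 * j))))"
      by simp
    then show ?thesis
      by (simp only: fact_Suc) (simp add: algebra_simps)
  qed
  moreover have "fact (Suc j) = (j + 1) * fact j"
    by simp
  ultimately show ?case
    unfolding Suc.IH[symmetric] by (simp only: power_Suc) (simp add: algebra_simps)
qed

lemma pairs_False_value: "pairs_fps False $ (4 * j) = real (cub_roots (4 * j)) / (4 ^ j * fact j)"
proof -
  have "real (free_invs (4 * j) * sq_roots (4 * j)) * (4 ^ j * fact j) = fact (4 * j)"
    using arg_cong[OF free_roots_value[of j], of real] by simp
  then show ?thesis
    by (simp add: pairs_fps_def num_pairs_def field_simps)
qed

lemma pairs_False_zero: "n mod 4 \<noteq> 0 \<Longrightarrow> pairs_fps False $ n = 0"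
  by (simp add: pairs_fps_def num_pairs_def sq_roots_zero)

lemma pairs_False_rec:
  fixes i :: nat
  defines "q \<equiv> \<lambda>j. pairs_fps False $ (4 * j)" and "M \<equiv> real i"
  shows "4 * (M + 3) * q (i + 3) = q (i + 2) + 8 * (M + 2) * q (i + 1) + 4 * (2 * M + 1) * (2 * M + 5) * q i"
proof -
  define b where "b k = real (cub_roots (4 * i + 2 * k))" for k
  define d where "d k = (4 ^ (i + k) * fact (i + k) :: real)" for k
  have b: "b (Suc (Suc (Suc k))) = b (Suc (Suc k)) + 4 * (2 * M + (real k + 2)) * (2 * M + (real k + 1)) * b k" for k
    unfolding b_def M_def by (subst cub_roots.simps) (simp add: algebra_simps)
  have d: "d (Suc k) = 4 * (M + (real k + 1)) * d k" for k
    by (simp add: d_def M_def algebra_simps)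
  have bd: "b (2 * k) = q (i + k) * d k" for k
  proof -
    have "4 * i + 2 * (2 * k) = 4 * (i + k)"
      by simp
    then show ?thesis
      unfolding q_def b_def d_def pairs_False_value by simp
  qed
  have "b 6 = b 4 + 32 * (M + 2)^2 * b 2 + 64 * (M + 2) * (M + 1) * (2 * M + 1) * (2 * M + 5) * b 0"
    using b[of 0] b[of 1] b[of 2] b[of 3]
    by (intro cub_identity[of "b 3" "b 2" M "b 0" "b 4" "b 1" "b 5" "b 6"])
      (simp_all add: eval_nat_numeral algebra_simps)
  then have "q (i + 3) * d 3 = q (i + 2) * d 2 + 32 * (M + 2)^2 * (q (i + 1) * d 1) +
      64 * (M + 2) * (M + 1) * (2 * M + 1) * (2 * M + 5) * (q (i + 0) * d 0)"
    using bd[of 3] bd[of 2] bd[of 1] bd[of 0] by simp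
  moreover have "d 1 = 4 * (M + 1) * d 0" "d 2 = 4 * (M + 2) * d 1" "d 3 = 4 * (M + 3) * d 2"
    using d[of 0] d[of 1] d[of 2] by (simp_all add: eval_nat_numeral algebra_simps)
  ultimately have "d 2 * (4 * (M + 3) * q (i + 3)) = d 2 * (q (i + 2) + 8 * (M + 2) * q (i + 1)
      + 4 * (2 * M + 1) * (2 * M + 5) * q (i + 0))"
    by algebra
  moreover have "d 2 \<noteq> 0"
    by (simp add: d_def)
  ultimately show ?thesis
    by simp
qed

lemma pairs_False_ode:
  defines "H \<equiv> pairs_fps False"
  shows "fps_X ^ 13 * fps_deriv (fps_deriv H) + fps_const 2 * (fps_X ^ 8 * fps_deriv H)
    + fps_const 13 * (fps_X ^ 12 * fps_deriv H) - fps_deriv H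
    + fps_X ^ 3 * H + fps_const 8 * (fps_X ^ 7 * H) + fps_const 20 * (fps_X ^ 11 * H) = 0" (is "?E = 0")
proof (rule fps_ext)
  fix n
  show "?E $ n = 0 $ n"
  proof (cases "n mod 4 = 3")
    case False
    have z: "H $ m = 0" if "n + 1 = m + 4 * t" for m t
    proof -
      have "m mod 4 \<noteq> 0"
        using False that by presburger
      then show ?thesis
        by (simp add: H_def pairs_False_zero)
    qed
    have "H $ (n + 1) = 0" "3 \<le> n \<Longrightarrow> H $ (n - 3) = 0" "7 \<le> n \<Longrightarrow> H $ (n - 7) = 0"
      "8 \<le> n \<Longrightarrow> H $ Suc (n - 8) = 0" "11 \<le> n \<Longrightarrow> H $ (n - 11) = 0"
      "12 \<le> n \<Longrightarrow> H $ Suc (n - 12) = 0" "13 \<le> n \<Longrightarrow> H $ Suc (Suc (n - 13)) = 0"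
      "\<not> n < 12 \<Longrightarrow> n < 13 \<Longrightarrow> H $ Suc 0 = 0"
      using z[of "Suc 0" 3] z[of "n + 1" 0] z[of "n - 3" 1] z[of "n - 7" 2] z[of "Suc (n - 8)" 2] z[of "n - 11" 3]
        z[of "Suc (n - 12)" 3] z[of "Suc (Suc (n - 13))" 3] by simp_all
    then show ?thesis
      by (simp add: fps_X_power_mult_nth)
  next
    case True
    then obtain j where j: "n = 4 * j + 3"
      by (metis mult_div_mod_eq)
    consider "j = 0" | "j = 1" | i where "j = i + 2"
      by (metis One_nat_def add_2_eq_Suc' not0_implies_Suc)
    then show ?thesis
    proof cases
      case 1
      then show ?thesis
        using pairs_False_value[of 0] pairs_False_value[of 1]
        by (simp add: j fps_X_power_mult_nth H_def cub_roots.simps)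
    next
      case 2
      then show ?thesis
        using pairs_False_value[of 0] pairs_False_value[of 1] pairs_False_value[of 2]
        by (simp add: j fps_X_power_mult_nth H_def cub_roots.simps)
    next
      case 3
      show ?thesis
      proof (cases i)
        case 0
        then show ?thesis
          using pairs_False_rec[of i] by (simp add: 3 j fps_X_power_mult_nth H_def)
      next
        case (Suc k)
        then show ?thesis
          using pairs_False_rec[of i]
          by (simp add: 3 j fps_X_power_mult_nth H_def)
            (simp add: algebra_simps power2_eq_square eval_nat_numeral)
      qed
    qed
  qed
qed

lemma riccati_of_ode:
  fixes H S :: "real fps"
  assumes "fps_deriv H = S * H" "H \<noteq> 0"
    and "b * fps_deriv (fps_deriv H) + a * fps_deriv H - fps_deriv H + c * H = 0"
  shows "S = c + a * S + b * (fps_deriv S + S ^ 2)"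
proof -
  have "fps_deriv (fps_deriv H) = (fps_deriv S + S ^ 2) * H"
    by (simp add: assms(1) algebra_simps power2_eq_square)
  then have "(b * (fps_deriv S + S ^ 2) + a * S - S + c) * H = 0"
    using assms(1,3) by algebra
  then have "b * (fps_deriv S + S ^ 2) + a * S - S + c = 0"
    using assms(2) by simp
  then show ?thesis
    by algebra
qed

lemma subgroups_True_riccati:
  defines "S \<equiv> subgroups_fps True" and "X \<equiv> fps_X :: int fps"
  shows "S = (1 + X + 4 * X ^ 2 + 4 * X ^ 3 - X ^ 4 + 4 * X ^ 5 - 2 * X ^ 6 - 2 * X ^ 8)
    + (4 * X ^ 3 + 2 * X ^ 4 + 4 * X ^ 6 - 2 * X ^ 7 - 4 * X ^ 9) * S
    + (X ^ 7 - X ^ 10) * (fps_deriv S + S ^ 2)"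
  unfolding real_fps_inject[symmetric] S_def X_def real_fps_hom power2_eq_square[of "subgroups_fps True"]
    power2_eq_square[of "real_fps (subgroups_fps True)", symmetric]
proof (rule riccati_of_ode[OF pairs_fps_deriv pairs_fps_nonzero])
  show "(fps_X ^ 7 - fps_X ^ 10) * fps_deriv (fps_deriv (pairs_fps True)) +
    (4 * fps_X ^ 3 + 2 * fps_X ^ 4 + 4 * fps_X ^ 6 - 2 * fps_X ^ 7 - 4 * fps_X ^ 9) * fps_deriv (pairs_fps True) -
    fps_deriv (pairs_fps True) +
    (1 + fps_X + 4 * fps_X ^ 2 + 4 * fps_X ^ 3 - fps_X ^ 4 + 4 * fps_X ^ 5 - 2 * fps_X ^ 6 - 2 * fps_X ^ 8) *
    pairs_fps True = 0"
    using pairs_True_ode unfolding numeral_fps_const[symmetric] power_one_right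
    by algebra
qed

lemma subgroups_False_riccati:
  defines "S \<equiv> subgroups_fps False" and "X \<equiv> fps_X :: int fps"
  shows "S = (X ^ 3 + 8 * X ^ 7 + 20 * X ^ 11) + (2 * X ^ 8 + 13 * X ^ 12) * S
    + X ^ 13 * (fps_deriv S + S ^ 2)"
  unfolding real_fps_inject[symmetric] S_def X_def real_fps_hom power2_eq_square[of "subgroups_fps False"]
    power2_eq_square[of "real_fps (subgroups_fps False)", symmetric]
proof (rule riccati_of_ode[OF pairs_fps_deriv pairs_fps_nonzero])
  show "fps_X ^ 13 * fps_deriv (fps_deriv (pairs_fps False)) +
    (2 * fps_X ^ 8 + 13 * fps_X ^ 12) * fps_deriv (pairs_fps False) - fps_deriv (pairs_fps False) +
    (fps_X ^ 3 + 8 * fps_X ^ 7 + 20 * fps_X ^ 11) * pairs_fps False = 0"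
    using pairs_False_ode unfolding numeral_fps_const[symmetric]
    by algebra
qed

section \<open>Computing with Laurent polynomials modulo 16\<close>

fun lp_add :: "(int \<times> int) list \<Rightarrow> (int \<times> int) list \<Rightarrow> (int \<times> int) list" where
  "lp_add [] ys = ys"
| "lp_add xs [] = xs"
| "lp_add ((i, a) # xs) ((j, b) # ys) =
     (if i < j then (i, a) # lp_add xs ((j, b) # ys)
      else if j < i then (j, b) # lp_add ((i, a) # xs) ys
      else let c = (a + b) mod 16 in if c = 0 then lp_add xs ys else (i, c) # lp_add xs ys)"

fun lp_scale :: "int \<Rightarrow> int \<Rightarrow> (int \<times> int) list \<Rightarrow> (int \<times> int) list" where
  "lp_scale i a [] = []"
| "lp_scale i a ((j, b) # ys) =
     (let c = (a * b) mod 16 in if c = 0 then lp_scale i a ys else (i + j, c) # lp_scale i a ys)"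

fun lp_mult :: "(int \<times> int) list \<Rightarrow> (int \<times> int) list \<Rightarrow> (int \<times> int) list" where
  "lp_mult [] ys = []"
| "lp_mult ((i, a) # xs) ys = lp_add (lp_scale i a ys) (lp_mult xs ys)"

fun lp_deriv :: "(int \<times> int) list \<Rightarrow> (int \<times> int) list" where
  "lp_deriv [] = []"
| "lp_deriv ((i, a) # xs) = (i - 1, i * a) # lp_deriv xs"

datatype lx = Lp "(int \<times> int) list" | Plus lx lx | Times lx lx

fun lx_nf :: "lx \<Rightarrow> (int \<times> int) list" where
  "lx_nf (Lp xs) = lp_scale 0 1 xs"
| "lx_nf (Plus x y) = lp_add (lx_nf x) (lx_nf y)"
| "lx_nf (Times x y) = lp_mult (lx_nf x) (lx_nf y)"

fun lp_val :: "(int \<times> int) list \<Rightarrow> int fls" where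
  "lp_val [] = 0"
| "lp_val ((i, a) # xs) = of_int a * zpow i + lp_val xs"

fun lx_val :: "lx \<Rightarrow> int fls" where
  "lx_val (Lp xs) = lp_val xs"
| "lx_val (Plus x y) = lx_val x + lx_val y"
| "lx_val (Times x y) = lx_val x * lx_val y"

lemma of_int_mod_16: "\<exists>w. (of_int (a mod 16) :: int fls) = of_int a + 16 * w"
proof -
  have "a mod 16 = a + 16 * (- (a div 16))"
    by (simp add: minus_div_mult_eq_mod[symmetric])
  then have "(of_int (a mod 16) :: int fls) = of_int a + 16 * of_int (- (a div 16))"
    by (metis of_int_add of_int_mult of_int_numeral)
  then show ?thesis
    by blast
qed

lemma lp_add_val: "\<exists>w. lp_val (lp_add xs ys) = lp_val xs + lp_val ys + 16 * w"
proof (induction xs ys rule: lp_add.induct)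
  case (1 ys)
  show ?case by (simp add: exI[of _ 0])
next
  case (2 x xs)
  show ?case by (simp add: exI[of _ 0])
next
  case (3 i a xs j b ys)
  show ?case
  proof (cases "i = j")
    case False
    then consider "i < j" | "j < i" "\<not> i < j" by linarith
    then show ?thesis
    proof cases
      case 1
      then obtain w where "lp_val (lp_add xs ((j, b) # ys)) = lp_val xs + lp_val ((j, b) # ys) + 16 * w"
        using 3(1) by blast
      then show ?thesis
        using 1 by (intro exI[of _ w]) (simp add: algebra_simps)
    next
      case 2
      then obtain w where "lp_val (lp_add ((i, a) # xs) ys) = lp_val ((i, a) # xs) + lp_val ys + 16 * w"
        using 3(2) by blast
      then show ?thesis
        using 2 by (intro exI[of _ w]) (simp add: algebra_simps)
    qed
  next
    case True
    obtain w where w: "lp_val (lp_add xs ys) = lp_val xs + lp_val ys + 16 * w"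
      using 3(3,4) True by (cases "(a + b) mod 16 = 0") auto
    obtain v where v: "(of_int ((a + b) mod 16) :: int fls) = of_int (a + b) + 16 * v"
      using of_int_mod_16 by blast
    have "lp_val (lp_add ((i, a) # xs) ((j, b) # ys)) = of_int ((a + b) mod 16) * zpow i + lp_val (lp_add xs ys)"
      using True by (simp add: Let_def)
    then show ?thesis
      unfolding v w using True by (intro exI[of _ "v * zpow i + w"]) (simp add: algebra_simps)
  qed
qed

lemma zpow_mult: "zpow i * zpow j = zpow (i + j)"
  by (rule fls_X_intpow_times_fls_X_intpow)

lemma lp_scale_val: "\<exists>w. lp_val (lp_scale i a ys) = of_int a * zpow i * lp_val ys + 16 * w"
proof (induction i a ys rule: lp_scale.induct)
  case (1 i a)
  show ?case by (simp add: exI[of _ 0])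
next
  case (2 i a j b ys)
  obtain w where w: "lp_val (lp_scale i a ys) = of_int a * zpow i * lp_val ys + 16 * w"
    using 2 by (cases "(a * b) mod 16 = 0") auto
  obtain v where v: "(of_int ((a * b) mod 16) :: int fls) = of_int (a * b) + 16 * v"
    using of_int_mod_16 by blast
  have "lp_val (lp_scale i a ((j, b) # ys)) = of_int ((a * b) mod 16) * zpow (i + j) + lp_val (lp_scale i a ys)"
    by (simp add: Let_def)
  also have "\<dots> = of_int a * zpow i * lp_val ((j, b) # ys) + 16 * (v * zpow (i + j) + w)"
    unfolding v w lp_val.simps zpow_mult[of i j, symmetric] of_int_mult by algebra
  finally show ?case
    by blast
qed

lemma lp_mult_val: "\<exists>w. lp_val (lp_mult xs ys) = lp_val xs * lp_val ys + 16 * w"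
proof (induction xs ys rule: lp_mult.induct)
  case (1 ys)
  show ?case by (simp add: exI[of _ 0])
next
  case (2 i a xs ys)
  obtain u where u: "lp_val (lp_mult xs ys) = lp_val xs * lp_val ys + 16 * u"
    using 2 by blast
  obtain v where v: "lp_val (lp_scale i a ys) = of_int a * zpow i * lp_val ys + 16 * v"
    using lp_scale_val by blast
  obtain w where "lp_val (lp_add (lp_scale i a ys) (lp_mult xs ys)) =
      lp_val (lp_scale i a ys) + lp_val (lp_mult xs ys) + 16 * w"
    using lp_add_val by blast
  then have "lp_val (lp_mult ((i, a) # xs) ys) = lp_val ((i, a) # xs) * lp_val ys + 16 * (u + v + w)"
    unfolding lp_mult.simps u v lp_val.simps by algebra
  then show ?case
    by blast
qed

lemma lx_nf_val: "\<exists>w. lx_val x = lp_val (lx_nf x) + 16 * w"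
proof (induction x)
  case (Lp xs)
  obtain w where "lp_val (lp_scale 0 1 xs) = of_int 1 * zpow 0 * lp_val xs + 16 * w"
    using lp_scale_val by blast
  then show ?case
    by (intro exI[of _ "- w"]) simp
next
  case (Plus x y)
  obtain u v w where "lx_val x = lp_val (lx_nf x) + 16 * u" "lx_val y = lp_val (lx_nf y) + 16 * v"
      "lp_val (lp_add (lx_nf x) (lx_nf y)) = lp_val (lx_nf x) + lp_val (lx_nf y) + 16 * w"
    using Plus lp_add_val by blast
  then show ?case
    by (intro exI[of _ "u + v - w"]) (simp add: algebra_simps)
next
  case (Times x y)
  obtain u v w where uvw: "lx_val x = lp_val (lx_nf x) + 16 * u" "lx_val y = lp_val (lx_nf y) + 16 * v"
      "lp_val (lp_mult (lx_nf x) (lx_nf y)) = lp_val (lx_nf x) * lp_val (lx_nf y) + 16 * w"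
    using Times lp_mult_val by blast
  have "lx_val x * lx_val y = lp_val (lp_mult (lx_nf x) (lx_nf y)) +
      16 * (u * lp_val (lx_nf y) + v * lp_val (lx_nf x) + 16 * u * v - w)"
    unfolding uvw by algebra
  then show ?case
    unfolding lx_val.simps lx_nf.simps by blast
qed

lemma lx_zero: "lx_nf x = [] \<Longrightarrow> \<exists>w. lx_val x = 16 * w"
  using lx_nf_val[of x] by simp

lemma fls_deriv_zpow: "fls_deriv (zpow i) = of_int i * (zpow (i - 1) :: int fls)"
  by (rule fls_eqI) (simp add: fls_of_int)

lemma lp_deriv_val: "fls_deriv (lp_val xs) = lp_val (lp_deriv xs)"
  by (induction xs rule: lp_deriv.induct) (simp_all add: fls_deriv_zpow mult_ac)

abbreviation Const :: "int \<Rightarrow> lx" where "Const c \<equiv> Lp [(0, c)]"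
abbreviation Var :: lx where "Var \<equiv> Lp [(1, 1)]"

definition lx_sum :: "lx list \<Rightarrow> lx" where "lx_sum xs = foldr Plus xs (Lp [])"

lemma lx_val_sum: "lx_val (lx_sum xs) = sum_list (map lx_val xs)"
  by (induction xs) (simp_all add: lx_sum_def)

definition lx_prod :: "lx list \<Rightarrow> lx" where "lx_prod xs = foldr Times xs (Const 1)"

lemma lx_val_prod: "lx_val (lx_prod xs) = prod_list (map lx_val xs)"
  by (induction xs) (simp_all add: lx_prod_def)

lemma lx_val_Var: "lx_val Var = fls_X"
  by (simp add: fls_X_conv_shift_1)

lemma lx_val_Const: "lx_val (Const c) = of_int c"
  by simp

section \<open>The Riccati equation modulo 16\<close>

text \<open>Modulo 16 the series \<open>\<Phi>' = \<Sum>2\<^sup>n z\<^bsup>2\<^sup>n - 1\<^esup>\<close> is this polynomial.\<close>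

definition dPhi :: "(int \<times> int) list" where "dPhi = [(0, 1), (1, 2), (3, 4), (7, 8)]"

text \<open>A tuple \<open>(\<alpha>, \<beta>, \<gamma>, \<delta>, \<tau>)\<close> encodes \<open>\<alpha> + \<beta>P + \<gamma>E + 2\<delta>PE + 8\<tau>t\<close> where \<open>P = \<Phi>\<close>,
  \<open>E = P\<^sup>2 - P + z\<close> is divisible by 2, and \<open>8t = E\<^sup>2 - 2E + 4zP - 4z\<^sup>2\<close>.
  Hence the coefficients of \<open>E\<close> and \<open>PE\<close> only matter modulo 8, and that of \<open>8t\<close> modulo 2.\<close>

definition riccati_components ::
  "(int \<times> int) list \<Rightarrow> (int \<times> int) list \<Rightarrow> (int \<times> int) list \<Rightarrow> (int \<times> int) list \<Rightarrow> (int \<times> int) list \<Rightarrow>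
   (int \<times> int) list \<Rightarrow> (int \<times> int) list \<Rightarrow> (int \<times> int) list \<Rightarrow> lx list" where
  "riccati_components c a b al be ga de ta =
    [lx_sum [Lp c, lx_prod [Lp a, Lp al], lx_prod [Const (-1), Lp al],
       lx_prod [Lp b, lx_sum [Lp (lp_deriv al), lx_prod [Lp be, Lp dPhi], Lp ga,
         lx_prod [Const (-1), Lp ga, Lp dPhi], lx_prod [Const (-4), Var, Lp de, Lp dPhi],
         lx_prod [Lp ta, lx_sum [lx_prod [Const 2, Lp dPhi], Const (-2), lx_prod [Const 4, Var, Lp dPhi],
           lx_prod [Const (-8), Var]]],
         lx_prod [Lp al, Lp al], lx_prod [Const (-1), Var, Lp be, Lp be],
         lx_prod [Const 4, Var, Var, Lp ga, Lp ga]]]],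
     lx_sum [lx_prod [Lp a, Lp be], lx_prod [Const (-1), Lp be],
       lx_prod [Lp b, lx_sum [Lp (lp_deriv be), lx_prod [Const 2, Lp ga, Lp dPhi],
         lx_prod [Const 2, Lp de, Lp dPhi], lx_prod [Const 2, Lp de],
         lx_prod [Const 4, Lp ta], lx_prod [Const (-4), Lp ta, Lp dPhi],
         lx_prod [Const 2, Lp al, Lp be], lx_prod [Lp be, Lp be],
         lx_prod [Const (-4), Var, Lp ga, Lp ga]]]],
     lx_prod [Const 2, lx_sum [lx_prod [Lp a, Lp ga], lx_prod [Const (-1), Lp ga],
       lx_prod [Lp b, lx_sum [Lp (lp_deriv ga), lx_prod [Const 6, Lp de, Lp dPhi],
         lx_prod [Const 2, Lp ta], lx_prod [Const (-2), Lp ta, Lp dPhi],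
         lx_prod [Lp be, Lp be], lx_prod [Const 2, Lp al, Lp ga],
         lx_prod [Const (-4), Var, Lp be, Lp de], lx_prod [Const 2, Lp ga, Lp ga]]]]],
     lx_prod [Const 2, lx_sum [lx_prod [Const 2, Lp a, Lp de], lx_prod [Const (-2), Lp de],
       lx_prod [Lp b, lx_sum [lx_prod [Const 2, Lp (lp_deriv de)], lx_prod [Const 4, Lp ta, Lp dPhi],
         lx_prod [Const 4, Lp al, Lp de], lx_prod [Const 2, Lp be, Lp ga],
         lx_prod [Const 4, Lp be, Lp de]]]]],
     lx_prod [Const 8, lx_sum [lx_prod [Lp a, Lp ta], lx_prod [Const (-1), Lp ta],
       lx_prod [Lp b, lx_sum [Lp (lp_deriv ta), lx_prod [Lp ga, Lp ga]]]]]]"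

locale phi_relations =
  fixes P E e t w X :: "int fls"
  assumes X: "X = fls_X"
    and PP: "P ^ 2 = P - X + E"
    and E: "E = 2 * e"
    and EE: "E ^ 2 = 2 * E - 4 * X * P + 4 * X ^ 2 + 8 * t"
    and dP: "fls_deriv P = lp_val dPhi + 16 * w"
begin

definition elt :: "(int \<times> int) list \<Rightarrow> (int \<times> int) list \<Rightarrow> (int \<times> int) list \<Rightarrow> (int \<times> int) list \<Rightarrow> (int \<times> int) list \<Rightarrow> int fls"
  where "elt al be ga de ta = lp_val al + lp_val be * P + lp_val ga * E + 2 * lp_val de * P * E + 8 * lp_val ta * t"

lemma dX: "fls_deriv X = 1"
  by (simp add: X)

lemma dE: "fls_deriv E = (2 * P - 1) * fls_deriv P + 1"
proof -
  have "E = P ^ 2 - P + X"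
    unfolding PP by simp
  then have "fls_deriv E = fls_deriv (P * P - P + X)"
    by (simp add: power2_eq_square)
  then show ?thesis
    by (simp add: dX algebra_simps)
qed

lemma dt: "8 * fls_deriv t = 2 * E * fls_deriv E - 2 * fls_deriv E + 4 * P + 4 * X * fls_deriv P - 8 * X"
proof -
  have "8 * t = E * E - 2 * E + 4 * (X * P) - 4 * (X * X)"
    using EE by algebra
  then have "fls_deriv (8 * t) = fls_deriv (E * E - 2 * E + 4 * (X * P) - 4 * (X * X))"
    by simp
  then show ?thesis
    by (simp add: dX algebra_simps)
qed

lemma elt_square:
  "\<exists>u. (al + be * P + ga * E + 2 * de * P * E + 8 * ta * t) ^ 2 =
    (al ^ 2 - X * be ^ 2 + 4 * X ^ 2 * ga ^ 2) + (2 * al * be + be ^ 2 - 4 * X * ga ^ 2) * P +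
    (be ^ 2 + 2 * al * ga - 4 * X * be * de + 2 * ga ^ 2) * E +
    (4 * al * de + 2 * be * ga + 4 * be * de) * P * E + 8 * ga ^ 2 * t + 16 * u"
proof (rule exI)
  show "(al + be * P + ga * E + 2 * de * P * E + 8 * ta * t) ^ 2 =
    (al ^ 2 - X * be ^ 2 + 4 * X ^ 2 * ga ^ 2) + (2 * al * be + be ^ 2 - 4 * X * ga ^ 2) * P +
    (be ^ 2 + 2 * al * ga - 4 * X * be * de + 2 * ga ^ 2) * E +
    (4 * al * de + 2 * be * ga + 4 * be * de) * P * E + 8 * ga ^ 2 * t +
    16 * (4 * ta ^ 2 * t ^ 2 + ta * t * (al + be * P + ga * E + 2 * de * P * E) +
      de ^ 2 * P ^ 2 * e ^ 2 + de * ga * P * e ^ 2 + be * de * e ^ 2)"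
  proof -
    have "(al + be * P + ga * E + 2 * de * P * E + 8 * ta * t) ^ 2 =
      al ^ 2 + 2 * al * be * P + be ^ 2 * P ^ 2 + 2 * al * ga * E + 4 * al * de * P * E + 2 * be * ga * P * E
      + 4 * be * de * P ^ 2 * E + ga ^ 2 * E ^ 2 + 16 * de * ga * P * e ^ 2 + 16 * de ^ 2 * P ^ 2 * e ^ 2
      + 16 * (4 * ta ^ 2 * t ^ 2 + ta * t * (al + be * P + ga * E + 2 * de * P * E))"
      unfolding E by algebra
    moreover have "4 * be * de * P ^ 2 * E = 4 * be * de * P * E - 4 * be * de * X * E + 16 * be * de * e ^ 2"
      unfolding PP E by algebra
    ultimately show ?thesis
      unfolding PP EE by algebra
  qed
qed

lemma elt_deriv:
  "\<exists>u. fls_deriv (elt al be ga de ta) =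
    (let al0 = lp_val al; be0 = lp_val be; ga0 = lp_val ga; de0 = lp_val de; ta0 = lp_val ta;
      pi = lp_val dPhi in
    (lp_val (lp_deriv al) + be0 * pi + ga0 - ga0 * pi - 4 * X * de0 * pi +
      ta0 * (2 * pi - 2 + 4 * X * pi - 8 * X)) +
    (lp_val (lp_deriv be) + 2 * ga0 * pi + 2 * de0 * pi + 2 * de0 + 4 * ta0 - 4 * ta0 * pi) * P +
    (lp_val (lp_deriv ga) + 6 * de0 * pi + 2 * ta0 - 2 * ta0 * pi) * E +
    (2 * lp_val (lp_deriv de) + 4 * ta0 * pi) * P * E + 8 * lp_val (lp_deriv ta) * t + 16 * u)"
proof -
  let ?al = "lp_val al" and ?be = "lp_val be" and ?ga = "lp_val ga" and ?de = "lp_val de" and ?ta = "lp_val ta"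
  let ?pi = "lp_val dPhi"
  let ?al' = "lp_val (lp_deriv al)" and ?be' = "lp_val (lp_deriv be)" and ?ga' = "lp_val (lp_deriv ga)"
    and ?de' = "lp_val (lp_deriv de)" and ?ta' = "lp_val (lp_deriv ta)"
  have "fls_deriv (elt al be ga de ta) = ?al' + (?be' * P + ?be * fls_deriv P) + (?ga' * E + ?ga * fls_deriv E)
      + 2 * (?de' * P * E + ?de * fls_deriv P * E + ?de * P * fls_deriv E) + 8 * ?ta' * t + ?ta * (8 * fls_deriv t)"
    unfolding elt_def by (simp add: lp_deriv_val algebra_simps)
  also have "\<dots> = ?al' + (?be' * P + ?be * fls_deriv P) + (?ga' * E + ?ga * ((2 * P - 1) * fls_deriv P + 1))
      + 2 * (?de' * P * E + ?de * fls_deriv P * E + ?de * (2 * P ^ 2 * fls_deriv P - P * fls_deriv P + P))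
      + 8 * ?ta' * t + ?ta * (2 * E * ((2 * P - 1) * fls_deriv P + 1) - 2 * ((2 * P - 1) * fls_deriv P + 1)
        + 4 * P + 4 * X * fls_deriv P - 8 * X)"
    unfolding dt dE by algebra
  also have "\<dots> = (?al' + ?be * ?pi + ?ga - ?ga * ?pi - 4 * X * ?de * ?pi +
      ?ta * (2 * ?pi - 2 + 4 * X * ?pi - 8 * X)) +
    (?be' + 2 * ?ga * ?pi + 2 * ?de * ?pi + 2 * ?de + 4 * ?ta - 4 * ?ta * ?pi) * P +
    (?ga' + 6 * ?de * ?pi + 2 * ?ta - 2 * ?ta * ?pi) * E +
    (2 * ?de' + 4 * ?ta * ?pi) * P * E + 8 * ?ta' * t +
    16 * (w * (?be + ?ga * (2 * P - 1) + 2 * ?de * E + 2 * ?de * (2 * (P - X + E) - P)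
      + ?ta * (2 * E * (2 * P - 1) - 2 * (2 * P - 1) + 4 * X)))"
    unfolding dP PP by algebra
  finally show ?thesis
    unfolding Let_def by blast
qed

lemma riccati_sound:
  assumes "\<forall>x\<in>set (riccati_components c a b al be ga de ta). lx_nf x = []"
  shows "16 dvd lp_val c + lp_val a * elt al be ga de ta
    + lp_val b * (fls_deriv (elt al be ga de ta) + elt al be ga de ta ^ 2) - elt al be ga de ta"
proof -
  let ?al = "lp_val al" and ?be = "lp_val be" and ?ga = "lp_val ga" and ?de = "lp_val de" and ?ta = "lp_val ta"
  let ?pi = "lp_val dPhi" and ?F = "elt al be ga de ta"
  obtain u where u: "?F ^ 2 = (?al ^ 2 - X * ?be ^ 2 + 4 * X ^ 2 * ?ga ^ 2) +
      (2 * ?al * ?be + ?be ^ 2 - 4 * X * ?ga ^ 2) * P +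
      (?be ^ 2 + 2 * ?al * ?ga - 4 * X * ?be * ?de + 2 * ?ga ^ 2) * E +
      (4 * ?al * ?de + 2 * ?be * ?ga + 4 * ?be * ?de) * P * E + 8 * ?ga ^ 2 * t + 16 * u"
    unfolding elt_def using elt_square by blast
  obtain v where v: "fls_deriv ?F = (lp_val (lp_deriv al) + ?be * ?pi + ?ga - ?ga * ?pi - 4 * X * ?de * ?pi +
      ?ta * (2 * ?pi - 2 + 4 * X * ?pi - 8 * X)) +
    (lp_val (lp_deriv be) + 2 * ?ga * ?pi + 2 * ?de * ?pi + 2 * ?de + 4 * ?ta - 4 * ?ta * ?pi) * P +
    (lp_val (lp_deriv ga) + 6 * ?de * ?pi + 2 * ?ta - 2 * ?ta * ?pi) * E +
    (2 * lp_val (lp_deriv de) + 4 * ?ta * ?pi) * P * E + 8 * lp_val (lp_deriv ta) * t + 16 * v"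
    using elt_deriv[of al be ga de ta] unfolding Let_def by blast
  have c: "\<exists>k. lx_val (riccati_components c a b al be ga de ta ! i) = 16 * k" if "i < 5" for i
  proof -
    have "i < length (riccati_components c a b al be ga de ta)"
      using that by (simp add: riccati_components_def)
    then show ?thesis
      using assms by (intro lx_zero) (metis nth_mem)
  qed
  obtain k0 k1 k2 k3 k4 where k: "lx_val (riccati_components c a b al be ga de ta ! 0) = 16 * k0"
    "lx_val (riccati_components c a b al be ga de ta ! Suc 0) = 16 * k1"
    "lx_val (riccati_components c a b al be ga de ta ! Suc (Suc 0)) = 16 * k2"
    "lx_val (riccati_components c a b al be ga de ta ! Suc (Suc (Suc 0))) = 16 * k3"
    "lx_val (riccati_components c a b al be ga de ta ! Suc (Suc (Suc (Suc 0)))) = 16 * k4"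
    using c[of 0] c[of "Suc 0"] c[of "Suc (Suc 0)"] c[of "Suc (Suc (Suc 0))"]
      c[of "Suc (Suc (Suc (Suc 0)))"] by auto
  have "lp_val c + lp_val a * ?F + lp_val b * (fls_deriv ?F + ?F ^ 2) - ?F =
      16 * (k0 + k1 * P + k2 * e + k3 * P * e + k4 * t + lp_val b * (u + v))"
  proof -
    have z1: "zpow 1 = X"
      by (simp add: X fls_X_conv_shift_1)
    have k': "lp_val c + lp_val a * ?al - ?al + lp_val b * (lp_val (lp_deriv al) + ?be * ?pi + ?ga - ?ga * ?pi - 4 * X * ?de * ?pi +
      ?ta * (2 * ?pi - 2 + 4 * X * ?pi - 8 * X) + ?al ^ 2 - X * ?be ^ 2 + 4 * X ^ 2 * ?ga ^ 2) = 16 * k0"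
      "lp_val a * ?be - ?be + lp_val b * (lp_val (lp_deriv be) + 2 * ?ga * ?pi + 2 * ?de * ?pi + 2 * ?de + 4 * ?ta - 4 * ?ta * ?pi
        + 2 * ?al * ?be + ?be ^ 2 - 4 * X * ?ga ^ 2) = 16 * k1"
      "2 * (lp_val a * ?ga - ?ga + lp_val b * (lp_val (lp_deriv ga) + 6 * ?de * ?pi + 2 * ?ta - 2 * ?ta * ?pi
        + ?be ^ 2 + 2 * ?al * ?ga - 4 * X * ?be * ?de + 2 * ?ga ^ 2)) = 16 * k2"
      "2 * (2 * lp_val a * ?de - 2 * ?de + lp_val b * (2 * lp_val (lp_deriv de) + 4 * ?ta * ?pi
        + 4 * ?al * ?de + 2 * ?be * ?ga + 4 * ?be * ?de)) = 16 * k3"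
      "8 * (lp_val a * ?ta - ?ta + lp_val b * (lp_val (lp_deriv ta) + ?ga ^ 2)) = 16 * k4"
      unfolding k[symmetric] riccati_components_def
      by (simp_all only: lx_val_sum lx_val_prod lx_val_Var lx_val_Const lx_val.simps(1) X[symmetric] list.map
          sum_list.Cons sum_list.Nil prod_list.Cons prod_list.Nil nth_Cons_0 nth_Cons_Suc
          of_int_numeral of_int_neg_numeral)
        (simp_all add: z1 algebra_simps power2_eq_square)
    show ?thesis
      unfolding u v unfolding elt_def using k' E by algebra
  qed
  then show ?thesis
    by simp
qed

end

definition total_components ::
  "(int \<times> int) list \<Rightarrow> (int \<times> int) list \<Rightarrow> (int \<times> int) list \<Rightarrow> (int \<times> int) list \<Rightarrow> (int \<times> int) list \<Rightarrow>
   (int \<times> int) list \<Rightarrow> (int \<times> int) list \<Rightarrow> (int \<times> int) list \<Rightarrow> (int \<times> int) list \<Rightarrow> (int \<times> int) list \<Rightarrow>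
   (int \<times> int) list \<Rightarrow> (int \<times> int) list \<Rightarrow> (int \<times> int) list \<Rightarrow> (int \<times> int) list \<Rightarrow> (int \<times> int) list \<Rightarrow>
   (int \<times> int) list \<Rightarrow> lx list" where
  "total_components a0 a1 a2 a3 a4 a5 al1 be1 ga1 de1 ta1 al2 be2 ga2 de2 ta2 =
    [lx_sum [Lp a0, lx_prod [Const (-1), Var, Lp a2], lx_prod [Const (-1), Var, Lp a3],
       lx_prod [lx_sum [lx_prod [Const (-1), Var], lx_prod [Const 5, Var, Var]], Lp a4],
       lx_prod [lx_sum [lx_prod [Const (-1), Var], lx_prod [Const 14, Var, Var]], Lp a5],
       lx_prod [Const (-1), Lp al1], lx_prod [Const (-1), Lp al2]],
     lx_sum [Lp a1, Lp a2, lx_prod [lx_sum [Const 1, lx_prod [Const (-1), Var]], Lp a3],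
       lx_prod [lx_sum [Const 1, lx_prod [Const (-6), Var]], Lp a4],
       lx_prod [lx_sum [Const 1, lx_prod [Const (-15), Var], lx_prod [Const 5, Var, Var]], Lp a5],
       lx_prod [Const (-1), Lp be1], lx_prod [Const (-1), Lp be2]],
     lx_prod [Const 2, lx_sum [Lp a2, Lp a3, lx_prod [lx_sum [Const 3, lx_prod [Const (-2), Var]], Lp a4],
       lx_prod [lx_sum [Const 5, lx_prod [Const (-8), Var]], Lp a5],
       lx_prod [Const (-1), Lp ga1], lx_prod [Const (-1), Lp ga2]]],
     lx_prod [Const 2, lx_sum [Lp a3, lx_prod [Const 2, Lp a4],
       lx_prod [lx_sum [Const 5, lx_prod [Const (-2), Var]], Lp a5],
       lx_prod [Const (-2), Lp de1], lx_prod [Const (-2), Lp de2]]],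
     lx_prod [Const 8, lx_sum [Lp a4, lx_prod [Const (-1), Lp ta1], lx_prod [Const (-1), Lp ta2]]],
     lx_prod [Const 8, Lp a5]]"

lemma zpow_1: "zpow 1 = fls_X"
  by (simp add: fls_X_conv_shift_1)

lemma (in phi_relations) total_sound:
  assumes "\<forall>x\<in>set (total_components a0 a1 a2 a3 a4 a5 al1 be1 ga1 de1 ta1 al2 be2 ga2 de2 ta2). lx_nf x = []"
  shows "16 dvd lp_val a0 + lp_val a1 * P + lp_val a2 * P ^ 2 + lp_val a3 * P ^ 3 + lp_val a4 * P ^ 4
    + lp_val a5 * P ^ 5 - (elt al1 be1 ga1 de1 ta1 + elt al2 be2 ga2 de2 ta2)"
proof -
  let ?T = "total_components a0 a1 a2 a3 a4 a5 al1 be1 ga1 de1 ta1 al2 be2 ga2 de2 ta2"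
  have c: "\<exists>k. lx_val (?T ! i) = 16 * k" if "i < 6" for i
  proof -
    have "i < length ?T"
      using that by (simp add: total_components_def)
    then show ?thesis
      using assms by (intro lx_zero) (metis nth_mem)
  qed
  obtain k0 k1 k2 k3 k4 k5 where k: "lx_val (?T ! 0) = 16 * k0"
    "lx_val (?T ! Suc 0) = 16 * k1"
    "lx_val (?T ! Suc (Suc 0)) = 16 * k2"
    "lx_val (?T ! Suc (Suc (Suc 0))) = 16 * k3"
    "lx_val (?T ! Suc (Suc (Suc (Suc 0)))) = 16 * k4"
    "lx_val (?T ! Suc (Suc (Suc (Suc (Suc 0))))) = 16 * k5"
    using c[of 0] c[of "Suc 0"] c[of "Suc (Suc 0)"] c[of "Suc (Suc (Suc 0))"]
      c[of "Suc (Suc (Suc (Suc 0)))"] c[of "Suc (Suc (Suc (Suc (Suc 0))))"] by auto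
  have P3: "P ^ 3 = - X + (1 - X) * P + E + P * E"
    using PP by algebra
  have P4: "P ^ 4 = (- X + 5 * X ^ 2) + (1 - 6 * X) * P + (3 - 2 * X) * E + 2 * (P * E) + 8 * t"
    using PP EE by algebra
  have P5: "P ^ 5 = (- X + 14 * X ^ 2) + (1 - 15 * X + 5 * X ^ 2) * P + (5 - 8 * X) * E + (5 - 2 * X) * (P * E)
      + 16 * t + 8 * (t * P)"
    using PP EE by algebra
  have "lp_val a0 + lp_val a1 * P + lp_val a2 * P ^ 2 + lp_val a3 * P ^ 3 + lp_val a4 * P ^ 4
    + lp_val a5 * P ^ 5 - (elt al1 be1 ga1 de1 ta1 + elt al2 be2 ga2 de2 ta2) =
    16 * (k0 + k1 * P + k2 * e + k3 * P * e + k4 * t + k5 * t * P + lp_val a5 * t)"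
  proof -
    have "lp_val a0 - X * lp_val a2 - X * lp_val a3 + (- X + 5 * X ^ 2) * lp_val a4
        + (- X + 14 * X ^ 2) * lp_val a5 - lp_val al1 - lp_val al2 = 16 * k0"
      "lp_val a1 + lp_val a2 + (1 - X) * lp_val a3 + (1 - 6 * X) * lp_val a4
        + (1 - 15 * X + 5 * X ^ 2) * lp_val a5 - lp_val be1 - lp_val be2 = 16 * k1"
      "2 * (lp_val a2 + lp_val a3 + (3 - 2 * X) * lp_val a4 + (5 - 8 * X) * lp_val a5
        - lp_val ga1 - lp_val ga2) = 16 * k2"
      "2 * (lp_val a3 + 2 * lp_val a4 + (5 - 2 * X) * lp_val a5 - 2 * lp_val de1 - 2 * lp_val de2) = 16 * k3"
      "8 * (lp_val a4 - lp_val ta1 - lp_val ta2) = 16 * k4"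
      "8 * lp_val a5 = 16 * k5"
      unfolding k[symmetric] total_components_def
      by (simp_all only: lx_val_sum lx_val_prod lx_val_Var lx_val_Const lx_val.simps(1) X[symmetric] list.map
          sum_list.Cons sum_list.Nil prod_list.Cons prod_list.Nil nth_Cons_0 nth_Cons_Suc
          of_int_numeral of_int_neg_numeral)
        (simp_all add: zpow_1 X algebra_simps power2_eq_square)
    then show ?thesis
      unfolding elt_def P3 P4 P5 PP using E by algebra
  qed
  then show ?thesis
    by simp
qed

definition holo :: "int fls \<Rightarrow> bool" where "holo f \<longleftrightarrow> (\<exists>g. f = fps_to_fls g)"

lemma holo_intros:
  "holo (fps_to_fls h)" "holo 0" "holo 1" "holo fls_X" "holo (of_int a)" "holo (numeral m)"
  "holo f \<Longrightarrow> holo g \<Longrightarrow> holo (f + g)" "holo f \<Longrightarrow> holo g \<Longrightarrow> holo (f - g)"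
  "holo f \<Longrightarrow> holo g \<Longrightarrow> holo (f * g)" "holo f \<Longrightarrow> holo (f ^ n)"
  unfolding holo_def
  by (metis fps_to_fls_eq_iff fps_zero_to_fls fps_one_to_fls fps_X_to_fls fps_to_fls_of_int fps_to_fls_numeral
      fps_to_fls_plus fps_to_fls_minus fls_times_fps_to_fls fps_to_fls_power)+

lemma holo_zpow: "0 \<le> i \<Longrightarrow> holo (zpow i)"
proof -
  assume "0 \<le> i"
  then obtain n where "i = int n"
    using nonneg_int_cases by blast
  then have "zpow i = fls_X ^ n"
    by (simp add: fls_X_power_conv_shift_1)
  then show ?thesis
    by (simp add: holo_intros)
qed

lemma holo_lp_val: "list_all (\<lambda>(i, a). 0 \<le> i) xs \<Longrightarrow> holo (lp_val xs)"
  by (induction xs rule: lp_val.induct) (simp_all add: holo_intros holo_zpow)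

lemma holo_zpow_lp_val: "list_all (\<lambda>(i, a). - k \<le> i) xs \<Longrightarrow> holo (zpow k * lp_val xs)"
proof (induction xs rule: lp_val.induct)
  case (2 i a xs)
  have eq: "zpow k * lp_val ((i, a) # xs) = of_int a * zpow (k + i) + zpow k * lp_val xs"
    unfolding lp_val.simps zpow_mult[symmetric] by (simp add: algebra_simps)
  have "0 \<le> k + i"
    using 2(2) by simp
  then have "holo (zpow (k + i))"
    by (rule holo_zpow)
  moreover have "holo (zpow k * lp_val xs)"
    using 2 by simp
  ultimately show ?case
    unfolding eq by - (assumption | rule holo_intros)+
qed (simp add: holo_intros)

definition phi_head :: "(int \<times> int) list" where "phi_head = [(1, 1), (2, 1), (4, 1), (8, 1)]"

definition lx_E :: lx where
  "lx_E = lx_sum [lx_prod [Lp phi_head, Lp phi_head], lx_prod [Const (-1), Lp phi_head], Var]"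

definition head_component ::
  "(int \<times> int) list \<Rightarrow> (int \<times> int) list \<Rightarrow> (int \<times> int) list \<Rightarrow> (int \<times> int) list \<Rightarrow> (int \<times> int) list \<Rightarrow> lx" where
  "head_component al be ga de ta =
    lx_sum [Lp al, lx_prod [Lp be, Lp phi_head], lx_prod [Lp ga, lx_E],
      lx_prod [Const 2, Lp de, Lp phi_head, lx_E],
      lx_prod [Lp ta, lx_sum [lx_prod [lx_E, lx_E], lx_prod [Const (-2), lx_E],
        lx_prod [Const 4, Var, Lp phi_head], lx_prod [Const (-4), Var, Var]]]]"

definition head_check where
  "head_check al be ga de ta \<longleftrightarrow>
    list_all (\<lambda>(i, a). 0 \<le> i) (lx_nf (head_component al be ga de ta)) \<and>
    list_all (list_all (\<lambda>(i, a). - 16 \<le> i)) [be, ga, de, ta]"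

text \<open>The poles of the coefficients cancel modulo 16: \<open>\<Phi>\<close> agrees with \<^term>\<open>phi_head\<close> up to
  order 16, and all poles have order at most 16.\<close>

lemma (in phi_relations) elt_regular:
  assumes check: "head_check al be ga de ta"
    and P: "P = lp_val phi_head + zpow 16 * u" "holo u"
  shows "\<exists>g. 16 dvd elt al be ga de ta - fps_to_fls g"
proof -
  define p where "p = lp_val phi_head"
  define z where "z = zpow 16"
  define E0 where "E0 = p ^ 2 - p + X"
  define v where "v = u * (2 * p - 1) + z * u ^ 2"
  define T0 where "T0 = E0 ^ 2 - 2 * E0 + 4 * X * p - 4 * X ^ 2"
  have Ppz: "P = p + z * u"
    using P(1) by (simp add: p_def z_def)
  have Ev: "E = E0 + z * v"
    using PP unfolding Ppz E0_def v_def by algebra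
  have t8: "8 * t = T0 + z * (2 * E0 * v + z * v ^ 2 - 2 * v + 4 * X * u)"
    using EE unfolding Ppz Ev T0_def by algebra
  obtain k where "lx_val (head_component al be ga de ta) = lp_val (lx_nf (head_component al be ga de ta)) + 16 * k"
    using lx_nf_val by blast
  moreover have "lx_val (head_component al be ga de ta) =
      lp_val al + lp_val be * p + lp_val ga * E0 + 2 * lp_val de * p * E0 + lp_val ta * T0"
    unfolding head_component_def lx_E_def
    by (simp_all only: lx_val_sum lx_val_prod lx_val_Var lx_val_Const lx_val.simps(1) X[symmetric] list.map
        sum_list.Cons sum_list.Nil prod_list.Cons prod_list.Nil of_int_numeral of_int_neg_numeral)
      (simp_all add: zpow_1 X E0_def T0_def p_def algebra_simps power2_eq_square)
  ultimately have head: "lp_val al + lp_val be * p + lp_val ga * E0 + 2 * lp_val de * p * E0 + lp_val ta * T0 =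
      lp_val (lx_nf (head_component al be ga de ta)) + 16 * k"
    by simp
  define r where "r = lp_val (lx_nf (head_component al be ga de ta)) + (z * lp_val be) * u + (z * lp_val ga) * v
      + 2 * (z * lp_val de) * (p * v + u * E0 + z * u * v)
      + (z * lp_val ta) * (2 * E0 * v + z * v ^ 2 - 2 * v + 4 * X * u)"
  have "elt al be ga de ta = lp_val al + lp_val be * P + lp_val ga * E + 2 * lp_val de * P * E + lp_val ta * (8 * t)"
    by (simp add: elt_def)
  also have "\<dots> = r + 16 * k"
    unfolding t8 unfolding Ppz Ev r_def using head by algebra
  finally have "elt al be ga de ta - r = 16 * k"
    by simp
  moreover have "holo r"
  proof -
    have "holo p" "holo z"
      unfolding p_def z_def phi_head_def by (intro holo_lp_val holo_zpow; simp)+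
    moreover from this have "holo E0" "holo v" "holo X"
      using P(2) unfolding E0_def v_def by (simp_all add: X holo_intros)
    moreover have "holo (z * lp_val be)" "holo (z * lp_val ga)" "holo (z * lp_val de)" "holo (z * lp_val ta)"
      using check unfolding z_def head_check_def by (simp_all add: holo_zpow_lp_val)
    moreover have "holo (lp_val (lx_nf (head_component al be ga de ta)))"
      using check unfolding head_check_def by (intro holo_lp_val) simp
    ultimately show ?thesis
      unfolding r_def using P(2) by - (assumption | rule holo_intros)+
  qed
  ultimately show ?thesis
    unfolding holo_def by (metis dvd_triv_left)
qed

section \<open>Arithmetic of the series \<open>\<Phi>\<close>\<close>

lemma fps_numeral_dvd: "(\<And>n. numeral m dvd fps_nth f n) \<Longrightarrow> (numeral m :: int fps) dvd f"
  by (intro dvdI[of _ _ "Abs_fps (\<lambda>n. fps_nth f n div numeral m)"] fps_ext)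
    (simp add: numeral_fps_const)

lemma compose_X2_nth: "fps_nth (f oo fps_X ^ 2) n = (if even n then fps_nth f (n div 2) else (0::int))"
proof -
  have "fps_nth (f oo fps_X ^ 2) n = (\<Sum>i\<in>{0..n}. fps_nth f i * (if n = 2 * i then 1 else 0))"
    by (simp add: fps_compose_nth power_mult[symmetric] fps_X_power_nth)
  also have "\<dots> = (\<Sum>i\<in>{0..n}. if i = n div 2 \<and> even n then fps_nth f i else 0)"
    by (intro sum.cong refl) auto
  also have "\<dots> = (if even n then fps_nth f (n div 2) else 0)"
    by (cases "even n") (simp_all add: sum.delta)
  finally show ?thesis .
qed

lemma frobenius_2:
  fixes f :: "int fps"
  shows "2 dvd f ^ 2 - (f oo fps_X ^ 2)"
proof (rule fps_numeral_dvd)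
  fix n
  let ?g = "\<lambda>i. fps_nth f i * fps_nth f (n - i)"
  let ?A = "{i \<in> {0..n}. 2 * i < n}" and ?B = "{i \<in> {0..n}. n < 2 * i}" and ?M = "{i \<in> {0..n}. 2 * i = n}"
  have "fps_nth (f ^ 2) n = (\<Sum>i\<in>{0..n}. ?g i)"
    by (simp add: power2_eq_square fps_mult_nth)
  also have "{0..n} = ?A \<union> ?B \<union> ?M"
    by auto
  also have "(\<Sum>i\<in>\<dots>. ?g i) = (\<Sum>i\<in>?A. ?g i) + (\<Sum>i\<in>?B. ?g i) + (\<Sum>i\<in>?M. ?g i)"
    by (subst sum.union_disjoint; (subst sum.union_disjoint)?) auto
  also have "(\<Sum>i\<in>?B. ?g i) = (\<Sum>i\<in>?A. ?g i)"
    by (rule sum.reindex_bij_witness[of _ "\<lambda>i. n - i" "\<lambda>i. n - i"]) auto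
  also have "(\<Sum>i\<in>?M. ?g i) = (if even n then fps_nth f (n div 2) ^ 2 else 0)"
  proof (cases "even n")
    case True
    then have "?M = {n div 2}"
      by auto
    then show ?thesis
      using True by (auto simp: power2_eq_square elim!: evenE)
  next
    case False
    then have "?M = {}"
      by auto
    then show ?thesis
      using False by (simp only: sum.empty if_False)
  qed
  finally have "fps_nth (f ^ 2 - (f oo fps_X ^ 2)) n =
      2 * (\<Sum>i\<in>?A. ?g i) + (if even n then fps_nth f (n div 2) ^ 2 - fps_nth f (n div 2) else 0)"
    by (simp add: compose_X2_nth)
  also have "2 dvd \<dots>"
    by simp
  finally show "2 dvd fps_nth (f ^ 2 - (f oo fps_X ^ 2)) n" .
qed

definition phi :: "int fps" where "phi = Abs_fps (\<lambda>m. if \<exists>n. m = 2 ^ n then 1 else 0)"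

lemma phi_functional_equation: "phi oo fps_X ^ 2 = phi - fps_X"
proof (rule fps_ext)
  fix n
  show "fps_nth (phi oo fps_X ^ 2) n = fps_nth (phi - fps_X) n"
  proof (cases "even n")
    case True
    have "(\<exists>k. n div 2 = 2 ^ k) \<longleftrightarrow> (\<exists>k. n = 2 ^ k)"
    proof
      assume "\<exists>k. n div 2 = 2 ^ k"
      then obtain k where "n div 2 = 2 ^ k" by blast
      then have "n = 2 ^ Suc k"
        using True by auto
      then show "\<exists>k. n = 2 ^ k" by blast
    next
      assume "\<exists>k. n = 2 ^ k"
      then obtain k where k: "n = 2 ^ k" by blast
      then obtain j where "k = Suc j"
        using True by (cases k) auto
      then show "\<exists>k. n div 2 = 2 ^ k"
        using k by auto
    qed
    then show ?thesis
      using True by (auto simp: compose_X2_nth phi_def fps_X_nth)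
  next
    case False
    have "(\<exists>k. n = 2 ^ k) \<longleftrightarrow> n = 1"
    proof
      assume "\<exists>k. n = 2 ^ k"
      then obtain k where "n = 2 ^ k" by blast
      then show "n = 1"
        using False by (cases k) auto
    qed (auto intro: exI[of _ 0])
    then show ?thesis
      using False by (auto simp: compose_X2_nth phi_def fps_X_nth)
  qed
qed

lemma phi_relations_fps:
  obtains e t :: "int fps" where "phi ^ 2 - phi + fps_X = 2 * e"
    "(2 * e) ^ 2 = 2 * (2 * e) - 4 * fps_X * phi + 4 * fps_X ^ 2 + 8 * t"
proof -
  have "2 dvd phi ^ 2 - (phi - fps_X)"
    using frobenius_2[of phi] unfolding phi_functional_equation .
  then obtain e where e: "phi ^ 2 - phi + fps_X = 2 * e"
    by (auto simp: dvd_def algebra_simps)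
  obtain t where t: "e ^ 2 - (e oo fps_X ^ 2) = 2 * t"
    using frobenius_2[of e] by (auto simp: dvd_def)
  have c0: "fps_nth (fps_X ^ 2 :: int fps) 0 = 0"
    by simp
  have "2 * (e oo fps_X ^ 2) = (phi - fps_X) ^ 2 - (phi - fps_X) + fps_X ^ 2"
  proof -
    have "2 * (e oo fps_X ^ 2) = (2 * e) oo fps_X ^ 2"
      by (simp add: fps_eq_iff compose_X2_nth numeral_fps_const)
    also have "\<dots> = (phi * phi - phi + fps_X) oo fps_X ^ 2"
      using e by (simp add: power2_eq_square)
    also have "\<dots> = (phi oo fps_X ^ 2) * (phi oo fps_X ^ 2) - (phi oo fps_X ^ 2) + (fps_X oo fps_X ^ 2)"
      by (simp only: fps_compose_add_distrib fps_compose_sub_distrib fps_compose_mult_distrib[OF c0])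
    also have "fps_X oo fps_X ^ 2 = (fps_X ^ 2 :: int fps)"
      by (rule fps_X_fps_compose_startby0[OF c0])
    finally show ?thesis
      unfolding phi_functional_equation by (simp add: power2_eq_square)
  qed
  then have "(2 * e) ^ 2 = 2 * (2 * e) - 4 * fps_X * phi + 4 * fps_X ^ 2 + 8 * t"
    using e t by algebra
  then show ?thesis
    using that e by blast
qed

lemma phi_deriv:
  "\<exists>w. fps_deriv phi = 1 + 2 * fps_X + 4 * fps_X ^ 3 + 8 * fps_X ^ 7 + 16 * w"
proof -
  have "16 dvd fps_deriv phi - (1 + 2 * fps_X + 4 * fps_X ^ 3 + 8 * fps_X ^ 7)"
  proof (rule fps_numeral_dvd)
    fix n
    show "16 dvd fps_nth (fps_deriv phi - (1 + 2 * fps_X + 4 * fps_X ^ 3 + 8 * fps_X ^ 7)) n"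
    proof (cases "\<exists>k. n + 1 = 2 ^ k")
      case False
      have "n \<noteq> 0" "n \<noteq> 1" "n \<noteq> 3" "n \<noteq> 7"
        using False power_0[of "2::nat"] power_one_right[of "2::nat"] by (auto simp: eval_nat_numeral dest: spec[of _ 0] spec[of _ 1] spec[of _ 2] spec[of _ 3])
      then show ?thesis
        using False by (simp add: phi_def fps_X_nth fps_X_power_nth numeral_fps_const)
    next
      case True
      then obtain k where k: "n + 1 = 2 ^ k" by blast
      have phi_n: "fps_nth (fps_deriv phi) n = 2 ^ k"
        using True k by (simp add: phi_def)
      show ?thesis
      proof (cases "k < 4")
        case True
        then have "k = 0 \<or> k = 1 \<or> k = 2 \<or> k = 3"
          by linarith
        then show ?thesis
          using k phi_n by (elim disjE) (simp_all add: fps_X_nth fps_X_power_nth numeral_fps_const)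
      next
        case False
        have "(2::nat) ^ 4 \<le> 2 ^ k"
          using False by (intro power_increasing) auto
        then have "n \<ge> 15"
          using k by simp
        moreover have "(2::int) ^ 4 dvd 2 ^ k"
          using False by (intro le_imp_power_dvd) simp
        ultimately show ?thesis
          using phi_n by (simp add: fps_X_nth fps_X_power_nth numeral_fps_const)
      qed
    qed
  qed
  then show ?thesis
    by (auto simp: dvd_def algebra_simps)
qed

lemma phi_head_tail: "\<exists>w. phi = fps_X + fps_X ^ 2 + fps_X ^ 4 + fps_X ^ 8 + fps_X ^ 16 * w"
proof (rule exI, rule fps_ext)
  fix n
  show "fps_nth phi n = fps_nth (fps_X + fps_X ^ 2 + fps_X ^ 4 + fps_X ^ 8 +
      fps_X ^ 16 * Abs_fps (\<lambda>n. fps_nth phi (n + 16))) n"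
  proof (cases "n < 16")
    case False
    then show ?thesis
      by (simp add: fps_X_power_mult_nth fps_X_nth fps_X_power_nth)
  next
    case True
    have "(\<exists>k. n = 2 ^ k) \<longleftrightarrow> n \<in> {1, 2, 4, 8}"
    proof
      assume "\<exists>k. n = 2 ^ k"
      then obtain k where k: "n = 2 ^ k" by blast
      have "k < 4"
        using True k power_increasing[of 4 k "2::nat"] by (cases "k < 4") auto
      then have "k = 0 \<or> k = 1 \<or> k = 2 \<or> k = 3"
        by linarith
      then show "n \<in> {1, 2, 4, 8}"
        using k by auto
    next
      assume "n \<in> {1, 2, 4, 8}"
      moreover have "(1::nat) = 2 ^ 0" "(2::nat) = 2 ^ 1" "(4::nat) = 2 ^ 2" "(8::nat) = 2 ^ 3"
        by simp_all
      ultimately show "\<exists>k. n = 2 ^ k"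
        by blast
    qed
    then show ?thesis
      using True by (auto simp: phi_def fps_X_power_mult_nth fps_X_nth fps_X_power_nth)
  qed
qed

section \<open>Uniqueness of the solution\<close>

lemma dvd_fps_mult_nth:
  fixes f g :: "int fps"
  assumes "\<And>i. i \<le> n \<Longrightarrow> k dvd fps_nth g i"
  shows "k dvd fps_nth (f * g) n"
  unfolding fps_mult_nth by (intro dvd_sum dvd_mult assms) simp

lemma riccati_unique:
  fixes S g :: "int fps"
  assumes S: "S = c + a * S + b * (fps_deriv S + S ^ 2)"
    and g: "\<And>n. k dvd fps_nth (c + a * g + b * (fps_deriv g + g ^ 2) - g) n"
    and a: "a = fps_X * a'" and b: "b = fps_X ^ 2 * b'"
  shows "k dvd fps_nth (S - g) n"
proof (induction n rule: less_induct)
  case (less n)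
  define D where "D = S - g"
  have Dj: "k dvd fps_nth D j" if "j < n" for j
    using less[OF that] by (simp add: D_def)
  have "D = fps_X ^ 1 * (a' * D) + fps_X ^ 2 * (b' * (fps_deriv D + (S + g) * D))
      + (c + a * g + b * (fps_deriv g + g ^ 2) - g)"
    using S unfolding D_def a b fps_deriv_sub by algebra
  moreover have "k dvd fps_nth (fps_X ^ 1 * (a' * D)) n"
    unfolding fps_X_power_mult_nth
    by (auto intro!: dvd_fps_mult_nth Dj)
  moreover have "k dvd fps_nth (fps_X ^ 2 * (b' * (fps_deriv D + (S + g) * D))) n"
  proof -
    have "k dvd fps_nth (b' * (fps_deriv D + (S + g) * D)) (n - 2)" if n: "\<not> n < 2"
    proof (rule dvd_fps_mult_nth)
      fix i assume i: "i \<le> n - 2"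
      have "k dvd fps_nth (fps_deriv D) i"
        using Dj[of "i + 1"] i n by (simp add: dvd_mult)
      moreover have "k dvd fps_nth ((S + g) * D) i"
        using i n by (intro dvd_fps_mult_nth Dj) auto
      ultimately show "k dvd fps_nth (fps_deriv D + (S + g) * D) i"
        unfolding fps_add_nth by (rule dvd_add)
    qed
    then show ?thesis
      unfolding fps_X_power_mult_nth by simp
  qed
  ultimately have "k dvd fps_nth D n"
    using g[of n] by (metis dvd_add fps_add_nth)
  then show ?case
    by (simp add: D_def)
qed

lemma fls_numeral_dvd_nth:
  assumes "(numeral m :: int fls) dvd f"
  shows "numeral m dvd fls_nth f k"
proof -
  obtain w where "f = numeral m * w"
    using assms by (auto simp: dvd_def)
  then have "fls_nth f k = numeral m * fls_nth w k"
    by (simp flip: fls_const_numeral)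
  then show ?thesis
    by simp
qed

lemma riccati_transfer:
  fixes S g :: "int fps"
  assumes S: "S = c + a * S + b * (fps_deriv S + S ^ 2)"
    and F: "16 dvd fps_to_fls c + fps_to_fls a * F + fps_to_fls b * (fls_deriv F + F ^ 2) - F"
    and g: "16 dvd F - fps_to_fls g"
    and a: "a = fps_X * a'" and b: "b = fps_X ^ 2 * b'"
  shows "16 dvd F - fps_to_fls S"
proof -
  obtain k where k: "F - fps_to_fls g = 16 * k"
    using g by (auto simp: dvd_def)
  then have Fk: "F = fps_to_fls g + 16 * k"
    by (simp add: algebra_simps)
  obtain m where m: "fps_to_fls c + fps_to_fls a * F + fps_to_fls b * (fls_deriv F + F ^ 2) - F = 16 * m"
    using F by (auto simp: dvd_def)
  have "fps_to_fls (c + a * g + b * (fps_deriv g + g ^ 2) - g) =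
      fps_to_fls c + fps_to_fls a * fps_to_fls g
      + fps_to_fls b * (fls_deriv (fps_to_fls g) + fps_to_fls g ^ 2) - fps_to_fls g"
    by (simp add: fls_times_fps_to_fls fps_to_fls_power fls_deriv_fps_to_fls)
  also have "\<dots> = 16 * (m - fps_to_fls a * k - fps_to_fls b * (fls_deriv k + 2 * fps_to_fls g * k + 16 * k ^ 2) + k)"
  proof -
    have "fls_deriv F = fls_deriv (fps_to_fls g) + 16 * fls_deriv k"
      unfolding Fk by simp
    then show ?thesis
      using m unfolding Fk by algebra
  qed
  finally have "16 dvd fls_nth (fps_to_fls (c + a * g + b * (fps_deriv g + g ^ 2) - g)) k" for k
    by (intro fls_numeral_dvd_nth) simp
  then have "16 dvd fps_nth (c + a * g + b * (fps_deriv g + g ^ 2) - g) n" for n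
    by (metis fps_to_fls_nth nat_int of_nat_less_0_iff)
  then have "16 dvd fps_nth (S - g) n" for n
    by (rule riccati_unique[OF S _ a b])
  then have "16 dvd S - g"
    by (rule fps_numeral_dvd)
  then obtain l where "S - g = 16 * l"
    by (auto simp: dvd_def)
  then have "fps_to_fls S - fps_to_fls g = 16 * fps_to_fls l"
    by (metis fls_times_fps_to_fls fps_to_fls_minus fps_to_fls_numeral)
  then have "F - fps_to_fls S = 16 * (k - fps_to_fls l)"
    using k by (simp add: algebra_simps)
  then show ?thesis
    by simp
qed

section \<open>The explicit solutions\<close>

text \<open>The tuple \<open>f2\<close> (subgroups without \<open>-1\<close>) is the fixed point reached by iterating the right-hand side
  of its Riccati equation on \<open>z\<^bsup>-13\<^esup>\<Phi>(z\<^bsup>16\<^esup>)\<close>, its solution modulo 2. The tuple \<open>f1\<close> is the difference of the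
  claimed sum, reduced by the relations for \<open>P\<close>, and \<open>f2\<close>.\<close>

definition f1_al :: "(int \<times> int) list" where
  "f1_al =
     [(-6, 15), (-5, 9), (-4, 14), (-3, 8), (-2, 9), (-1, 14), (0, 2), (2, 12), (3, 2), (4, 10),
      (5, 8), (6, 8), (7, 8), (8, 6), (10, 4), (11, 4), (12, 4), (13, 8), (14, 12), (17, 4),
      (19, 8), (20, 12), (21, 8), (22, 8), (26, 8)]"

definition f1_be :: "(int \<times> int) list" where
  "f1_be =
     [(-7, 1), (-6, 6), (-5, 6), (-4, 9), (-3, 2), (-2, 6), (-1, 12), (0, 12), (2, 14), (3, 12),
      (4, 12), (5, 8), (6, 8), (8, 4), (10, 8), (12, 8), (17, 8), (20, 8)]"

definition f1_ga :: "(int \<times> int) list" where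
  "f1_ga =
     [(-7, 3), (-6, 2), (-5, 2), (-4, 3), (-3, 6), (-2, 2), (-1, 4), (0, 4), (2, 2), (3, 4),
      (4, 4), (8, 4)]"

definition f1_de :: "(int \<times> int) list" where
  "f1_de =
     [(-7, 1), (-6, 2), (-5, 2), (-4, 1), (-3, 2), (-2, 2), (2, 2)]"

definition f1_ta :: "(int \<times> int) list" where
  "f1_ta =
     [(-7, 1), (-4, 1)]"

definition f2_al :: "(int \<times> int) list" where
  "f2_al =
     [(-12, 15), (-11, 9), (-10, 14), (-9, 5), (-8, 2), (-7, 10), (-6, 12), (-5, 13), (-4, 12),
      (-3, 12), (-2, 8), (-1, 8), (3, 4), (4, 8), (5, 8), (11, 4), (12, 8), (13, 8), (15, 8)]"

definition f2_be :: "(int \<times> int) list" where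
  "f2_be =
     [(-13, 1), (-12, 6), (-11, 6), (-10, 12), (-9, 6), (-8, 4), (-7, 12), (-6, 8), (-5, 4),
      (-4, 8), (-3, 8), (3, 8), (11, 8)]"

definition f2_ga :: "(int \<times> int) list" where
  "f2_ga =
     [(-13, 3), (-12, 2), (-11, 2), (-10, 4), (-9, 2), (-8, 4), (-7, 4), (-5, 4)]"

definition f2_de :: "(int \<times> int) list" where
  "f2_de =
     [(-13, 1), (-12, 2), (-11, 2), (-9, 2)]"

definition f2_ta :: "(int \<times> int) list" where
  "f2_ta =
     [(-13, 1)]"

definition a0_list :: "(int \<times> int) list" where
  "a0_list =
     [(-10, 6), (-9, 3), (-8, 4), (-7, 12), (-6, 4), (-5, 9), (-4, 14), (-3, 3), (-2, 12),
      (-1, 10), (0, 8), (2, 8), (3, 12), (4, 12), (5, 16), (6, 12), (7, 8), (8, 14), (9, 12),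
      (12, 4), (14, 4), (15, 8), (16, 8), (17, 12), (20, 12), (21, 8), (24, 8), (26, 8), (31, 8),
      (35, 8), (38, 8), (40, 8), (41, 8), (42, 8), (43, 8), (44, 8), (45, 8), (47, 8), (48, 8),
      (50, 8), (54, 8), (56, 8), (57, 8), (61, 8), (62, 8), (67, 8), (68, 8), (71, 8), (74, 8)]"

definition a1_list :: "(int \<times> int) list" where
  "a1_list =
     [(-11, 14), (-10, 8), (-9, 4), (-7, 4), (-5, 6), (-4, 8), (-3, 12), (-2, 6), (-1, 16), (0, 4),
      (3, 8), (4, 12), (5, 8), (7, 8), (8, 8), (9, 8), (12, 8), (13, 8), (14, 8), (17, 8), (21, 8),
      (23, 8), (24, 8), (27, 8), (28, 8), (29, 8), (30, 8), (32, 8), (35, 8), (36, 8), (38, 8),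
      (41, 8), (47, 8), (49, 8), (54, 8), (55, 8), (59, 8), (60, 8), (61, 8), (62, 8), (63, 8),
      (64, 8), (66, 8), (67, 8), (68, 8), (69, 8), (71, 8), (72, 8), (73, 8)]"

definition a2_list :: "(int \<times> int) list" where
  "a2_list =
     [(-12, 2), (-11, 8), (-10, 12), (-8, 12), (-6, 10), (-4, 4), (-3, 10), (-2, 8), (-1, 4),
      (0, 8), (2, 8), (3, 12), (4, 8), (8, 8), (10, 8), (11, 8), (14, 8), (17, 8), (18, 8),
      (22, 8), (24, 8), (25, 8), (28, 8), (35, 8), (36, 8), (37, 8), (38, 8), (49, 8), (50, 8),
      (51, 8), (53, 8), (55, 8), (56, 8), (57, 8), (58, 8), (61, 8), (62, 8), (65, 8), (66, 8),
      (68, 8), (69, 8), (72, 8)]"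

definition a3_list :: "(int \<times> int) list" where
  "a3_list =
     [(-13, 10), (-12, 12), (-11, 4), (-10, 8), (-9, 12), (-8, 8), (-7, 18), (-6, 12), (-5, 12),
      (-4, 10), (-3, 4), (-2, 4), (-1, 8), (1, 8), (2, 12), (3, 8), (8, 8), (9, 8), (10, 8),
      (12, 8), (13, 8), (16, 8), (17, 8), (19, 8), (20, 8), (25, 8), (28, 8), (30, 8), (31, 8),
      (32, 8), (33, 8), (37, 8), (40, 8), (42, 8), (45, 8), (46, 8), (47, 8), (50, 8), (55, 8),
      (56, 8), (60, 8), (61, 8), (66, 8), (67, 8), (69, 8), (72, 8)]"

definition a4_list :: "(int \<times> int) list" where
  "a4_list =
     [(-13, 1), (-12, 2), (-11, 2), (-10, 12), (-9, 14), (-8, 12), (-7, 5), (-6, 10), (-5, 14),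
      (-4, 1), (-3, 14), (-2, 10), (-1, 4), (0, 12), (1, 8), (2, 6), (3, 12), (4, 12), (5, 8),
      (6, 8), (7, 8), (8, 12), (9, 8), (11, 8), (13, 8), (17, 8), (18, 8), (21, 8), (24, 8),
      (25, 8), (28, 8), (29, 8), (30, 8), (32, 8), (33, 8), (34, 8), (36, 8), (37, 8), (40, 8),
      (45, 8), (48, 8), (49, 8), (51, 8), (53, 8), (54, 8), (56, 8), (57, 8), (58, 8), (59, 8),
      (60, 8), (63, 8), (64, 8), (65, 8), (67, 8), (70, 8), (71, 8), (72, 8)]"

definition a5_list :: "(int \<times> int) list" where
  "a5_list =
     [(-13, 6), (-11, 4), (-9, 4), (-7, 14), (-5, 12), (-4, 14), (-3, 8), (-2, 4), (1, 8), (2, 4),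
      (4, 8), (5, 8), (7, 8), (8, 8), (9, 8), (11, 8), (13, 8), (15, 8), (17, 8), (20, 8), (23, 8),
      (26, 8), (28, 8), (33, 8), (34, 8), (37, 8), (39, 8), (40, 8), (43, 8), (44, 8), (46, 8),
      (48, 8), (50, 8), (52, 8), (53, 8), (57, 8), (58, 8), (62, 8), (63, 8), (65, 8), (67, 8)]"

definition riccati1_c :: "(int \<times> int) list" where
  "riccati1_c = [(0, 1), (1, 1), (2, 4), (3, 4), (4, -1), (5, 4), (6, -2), (8, -2)]"
definition riccati1_a :: "(int \<times> int) list" where "riccati1_a = [(3, 4), (4, 2), (6, 4), (7, -2), (9, -4)]"
definition riccati1_b :: "(int \<times> int) list" where "riccati1_b = [(7, 1), (10, -1)]"
definition riccati2_c :: "(int \<times> int) list" where "riccati2_c = [(3, 1), (7, 8), (11, 20)]"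
definition riccati2_a :: "(int \<times> int) list" where "riccati2_a = [(8, 2), (12, 13)]"
definition riccati2_b :: "(int \<times> int) list" where "riccati2_b = [(13, 1)]"

lemma f1_riccati: "\<forall>x\<in>set (riccati_components riccati1_c riccati1_a riccati1_b f1_al f1_be f1_ga f1_de f1_ta). lx_nf x = []"
  by code_simp

lemma f2_riccati: "\<forall>x\<in>set (riccati_components riccati2_c riccati2_a riccati2_b f2_al f2_be f2_ga f2_de f2_ta). lx_nf x = []"
  by code_simp

lemma f1_head_check: "head_check f1_al f1_be f1_ga f1_de f1_ta"
  by code_simp

lemma f2_head_check: "head_check f2_al f2_be f2_ga f2_de f2_ta"
  by code_simp

lemma total_check: "\<forall>x\<in>set (total_components a0_list a1_list a2_list a3_list a4_list a5_list
    f1_al f1_be f1_ga f1_de f1_ta f2_al f2_be f2_ga f2_de f2_ta). lx_nf x = []"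
  by code_simp

lemma coeff_lists:
  "coeff_a0 = lp_val a0_list" "coeff_a1 = lp_val a1_list" "coeff_a2 = lp_val a2_list"
  "coeff_a3 = lp_val a3_list" "coeff_a4 = lp_val a4_list" "coeff_a5 = lp_val a5_list"
  unfolding coeff_a0_def coeff_a1_def coeff_a2_def coeff_a3_def coeff_a4_def coeff_a5_def
    a0_list_def a1_list_def a2_list_def a3_list_def a4_list_def a5_list_def lp_val.simps
  by (simp_all add: ac_simps)

lemma zpow_numeral: "zpow (numeral n) = fls_X ^ numeral n"
  by (simp add: fls_X_power_conv_shift_1)

lemma lists_fps:
  "lp_val riccati1_c = fps_to_fls (1 + fps_X + 4 * fps_X ^ 2 + 4 * fps_X ^ 3 - fps_X ^ 4 + 4 * fps_X ^ 5
    - 2 * fps_X ^ 6 - 2 * fps_X ^ 8)"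
  "lp_val riccati1_a = fps_to_fls (4 * fps_X ^ 3 + 2 * fps_X ^ 4 + 4 * fps_X ^ 6 - 2 * fps_X ^ 7 - 4 * fps_X ^ 9)"
  "lp_val riccati1_b = fps_to_fls (fps_X ^ 7 - fps_X ^ 10)"
  "lp_val riccati2_c = fps_to_fls (fps_X ^ 3 + 8 * fps_X ^ 7 + 20 * fps_X ^ 11)"
  "lp_val riccati2_a = fps_to_fls (2 * fps_X ^ 8 + 13 * fps_X ^ 12)"
  "lp_val riccati2_b = fps_to_fls (fps_X ^ 13)"
  "lp_val dPhi = fps_to_fls (1 + 2 * fps_X + 4 * fps_X ^ 3 + 8 * fps_X ^ 7)"
  "lp_val phi_head = fps_to_fls (fps_X + fps_X ^ 2 + fps_X ^ 4 + fps_X ^ 8)"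
  by (simp_all add: riccati1_c_def riccati1_a_def riccati1_b_def riccati2_c_def riccati2_a_def riccati2_b_def dPhi_def phi_head_def fls_times_fps_to_fls
      fps_to_fls_power zpow_numeral zpow_1)

theorem theorem28:
  shows "fls_cong 16
    (fps_to_fls (Abs_fps (\<lambda>n. int (num_subgroups SL2Z (n + 1)))))
    (\<Sum>i = 0..5. [coeff_a0, coeff_a1, coeff_a2, coeff_a3, coeff_a4, coeff_a5] ! i * Phi ^ i)"
proof -
  obtain e t :: "int fps" where et: "phi ^ 2 - phi + fps_X = 2 * e"
    "(2 * e) ^ 2 = 2 * (2 * e) - 4 * fps_X * phi + 4 * fps_X ^ 2 + 8 * t"
    by (rule phi_relations_fps)
  obtain w where w: "fps_deriv phi = 1 + 2 * fps_X + 4 * fps_X ^ 3 + 8 * fps_X ^ 7 + 16 * w"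
    using phi_deriv by blast
  obtain u where u: "phi = fps_X + fps_X ^ 2 + fps_X ^ 4 + fps_X ^ 8 + fps_X ^ 16 * u"
    using phi_head_tail by blast
  interpret phi_relations "fps_to_fls phi" "fps_to_fls (2 * e)" "fps_to_fls e" "fps_to_fls t" "fps_to_fls w" fls_X
  proof
    show "fps_to_fls phi ^ 2 = fps_to_fls phi - fls_X + fps_to_fls (2 * e)"
      unfolding et(1)[symmetric] by (simp add: fps_to_fls_power)
    show "fps_to_fls (2 * e) ^ 2 = 2 * fps_to_fls (2 * e) - 4 * fls_X * fps_to_fls phi + 4 * fls_X ^ 2
        + 8 * fps_to_fls t"
      using arg_cong[OF et(2), of fps_to_fls] by (simp add: fls_times_fps_to_fls fps_to_fls_power)
    show "fls_deriv (fps_to_fls phi) = lp_val dPhi + 16 * fps_to_fls w"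
      unfolding lists_fps fls_deriv_fps_to_fls w by (simp add: fls_times_fps_to_fls)
  qed (simp_all add: fls_times_fps_to_fls)
  let ?f1 = "elt f1_al f1_be f1_ga f1_de f1_ta" and ?f2 = "elt f2_al f2_be f2_ga f2_de f2_ta"
  have head: "fps_to_fls phi = lp_val phi_head + zpow 16 * fps_to_fls u"
  proof -
    have "zpow 16 = fps_to_fls (fps_X ^ 16)"
      by (simp add: fps_to_fls_power fls_X_power_conv_shift_1)
    then show ?thesis
      unfolding lists_fps by (subst u) (simp add: fls_times_fps_to_fls)
  qed
  obtain g1 where g1: "16 dvd ?f1 - fps_to_fls g1"
    using elt_regular[OF f1_head_check head] by (auto simp: holo_intros)
  obtain g2 where g2: "16 dvd ?f2 - fps_to_fls g2"
    using elt_regular[OF f2_head_check head] by (auto simp: holo_intros)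
  have "16 dvd ?f1 - fps_to_fls (subgroups_fps True)"
    using riccati_sound[OF f1_riccati] unfolding lists_fps
    by (rule riccati_transfer[OF subgroups_True_riccati _ g1, where
          a' = "4 * fps_X ^ 2 + 2 * fps_X ^ 3 + 4 * fps_X ^ 5 - 2 * fps_X ^ 6 - 4 * fps_X ^ 8" and
          b' = "fps_X ^ 5 - fps_X ^ 8"]) algebra+
  moreover have "16 dvd ?f2 - fps_to_fls (subgroups_fps False)"
    using riccati_sound[OF f2_riccati] unfolding lists_fps
    by (rule riccati_transfer[OF subgroups_False_riccati _ g2, where
          a' = "2 * fps_X ^ 7 + 13 * fps_X ^ 11" and b' = "fps_X ^ 11"]) algebra+
  ultimately have "16 dvd ?f1 - fps_to_fls (subgroups_fps True) + (?f2 - fps_to_fls (subgroups_fps False))"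
    by (rule dvd_add)
  then have "16 dvd (lp_val a0_list + lp_val a1_list * fps_to_fls phi + lp_val a2_list * fps_to_fls phi ^ 2
      + lp_val a3_list * fps_to_fls phi ^ 3 + lp_val a4_list * fps_to_fls phi ^ 4
      + lp_val a5_list * fps_to_fls phi ^ 5 - (?f1 + ?f2)) +
      (?f1 - fps_to_fls (subgroups_fps True) + (?f2 - fps_to_fls (subgroups_fps False)))"
    by (rule dvd_add[OF total_sound[OF total_check]])
  moreover have "(\<Sum>i = 0..5. [coeff_a0, coeff_a1, coeff_a2, coeff_a3, coeff_a4, coeff_a5] ! i * Phi ^ i) =
      lp_val a0_list + lp_val a1_list * fps_to_fls phi + lp_val a2_list * fps_to_fls phi ^ 2
      + lp_val a3_list * fps_to_fls phi ^ 3 + lp_val a4_list * fps_to_fls phi ^ 4 + lp_val a5_list * fps_to_fls phi ^ 5"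
    unfolding Phi_altdef phi_def[symmetric] coeff_lists by (simp add: eval_nat_numeral)
  moreover have "Abs_fps (\<lambda>n. int (num_subgroups SL2Z (n + 1))) = subgroups_fps True + subgroups_fps False"
    by (rule fps_ext) (simp add: subgroups_fps_def num_subgroups_SL2Z)
  ultimately have "16 dvd (\<Sum>i = 0..5. [coeff_a0, coeff_a1, coeff_a2, coeff_a3, coeff_a4, coeff_a5] ! i * Phi ^ i) -
      fps_to_fls (Abs_fps (\<lambda>n. int (num_subgroups SL2Z (n + 1))))" (is "16 dvd ?R - ?L")
    by (simp add: algebra_simps)
  then have "16 dvd fls_nth (?R - ?L) k" for k
    by (rule fls_numeral_dvd_nth)
  then have "[fls_nth ?R k = fls_nth ?L k] (mod 16)" for k
    unfolding cong_iff_dvd_diff fls_minus_nth .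
  then show ?thesis
    unfolding fls_cong_def by (blast intro: cong_sym)
qed

end
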